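(* Let $\{\mathcal{T}(t)\}_{t\ge 0}$ be the symmetric telegraph process with speed $c>0$ and rate $\lambda>0$, and let $t>0$. For $0<\beta<ct$, $$P\Bigl\{ \max_{0\le s\le t} \mathcal{T}(s) \in d\beta \,\Big|\, V(0) = -c\Bigr\} = e^{-\lambda t}\Biggl[ \frac{\lambda t}{ct+\beta}\, I_0\Bigl(\tfrac{\lambda}{c}\sqrt{c^2t^2-\beta^2}\Bigr) + \sqrt{\frac{ct-\beta}{ct+\beta}}\Bigl(\frac{\lambda}{c}-\frac{1}{ct+\beta}\Bigr) I_1\Bigl(\tfrac{\lambda}{c}\sqrt{c^2t^2-\beta^2}\Bigr)\Biggr]d\beta$$ and $$P\Bigl\{ \max_{0\le s\le t} \mathcal{T}(s) = 0 \,\Big|\, V(0) = -c\Bigr\} = e^{-\lambda t}\bigl[I_0(\lambda t)+I_1(\lambda t)\bigr].$$ Moreover, for fixed $t>0$, as $\lambda\to\infty$ and $c\to\infty$ with $\lambda/c^2\to1$, the conditional law of $\max_{0\le s\le t}\mathcal{T}(s)$ given $V(0)=-c$ converges weakly to the law of $\max_{0\le s\le t}B(s)$, where $\{B(s)\}_{s\ge0}$ is a standard Brownian motion, and hence also unconditionally $$\max_{0\le s\le t}\mathcal{T}(s)\ \xrightarrow{d}\ \max_{0\le s\le t}B(s).$$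
   Context: Let $c>0$, $\lambda>0$. Let $V(0)$ be a random variable with $P\{V(0)=c\}=P\{V(0)=-c\}=\tfrac12$ and let $\{N(t)\}_{t\ge0}$ be a homogeneous Poisson process with rate $\lambda$, independent of $V(0)$. The symmetric telegraph process is $\mathcal{T}(t)=\int_0^t V(0)(-1)^{N(s)}\,ds$, $t\ge 0$ (so $\mathcal{T}(0)=0$). A formula $P\{X\in d\beta\mid A\}=f(\beta)\,d\beta$ for $0<\beta<ct$ means that the conditional law of $X$ given the event $A$, restricted to the open interval $(0,ct)$, is absolutely continuous with density $f$. $I_\nu$ is the modified Bessel function of the first kind, $I_\nu(x)=\sum_{j\ge0}\frac{(x/2)^{2j+\nu}}{j!\,\Gamma(j+\nu+1)}$. *)

theory Defs
  imports "HOL-Probability.Probability"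
begin

text \<open>
  The order is a natural number so that the power series can be written with \<open>(^)\<close>:
  with \<open>powr\<close> the summand \<open>j = 0\<close> of $I_0(0)$ would be \<open>0 powr 0 = 0\<close>.
\<close>
definition bessel_I :: "nat \<Rightarrow> real \<Rightarrow> real" where
  "bessel_I n x =
     (\<Sum>j. (x / 2) ^ (2 * j + n) / (fact j * Gamma (real j + real n + 1)))"

definition (in prob_space) indep_increments ::
  "'b::minus measure \<Rightarrow> (real \<Rightarrow> 'a \<Rightarrow> 'b) \<Rightarrow> bool" where
  "indep_increments S X \<longleftrightarrow>
     (\<forall>(n::nat) (\<tau> :: nat \<Rightarrow> real). 0 \<le> \<tau> 0 \<and> (\<forall>i<n. \<tau> i \<le> \<tau> (Suc i)) \<longrightarrow>
        indep_vars (\<lambda>_. S) (\<lambda>i \<omega>. X (\<tau> (Suc i)) \<omega> - X (\<tau> i) \<omega>) {..<n})"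

text \<open>
  Processes are indexed by all of \<^typ>\<open>real\<close>, but only their values at times \<open>\<ge> 0\<close> matter.
  Path regularity is required for every outcome, not just almost surely, so that path
  functionals such as a running maximum are random variables although \<open>M\<close> need not be complete.
  Right-continuity below refers to the discrete topology of \<^typ>\<open>nat\<close>, and the truncated
  subtraction of \<^typ>\<open>nat\<close> is the true one because paths are nondecreasing.
\<close>
locale poisson_process = prob_space M
  for M :: "'a measure" and rate :: real and N :: "real \<Rightarrow> 'a \<Rightarrow> nat" +
  assumes rate_pos: "0 < rate"
    and N_measurable: "\<And>s. 0 \<le> s \<Longrightarrow> N s \<in> measurable M (count_space UNIV)"
    and N_start: "\<And>\<omega>. \<omega> \<in> space M \<Longrightarrow> N 0 \<omega> = 0"
    and N_mono: "\<And>\<omega>. \<omega> \<in> space M \<Longrightarrow> mono_on {0..} (\<lambda>s. N s \<omega>)"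
    and N_right_continuous:
      "\<And>\<omega> s. \<omega> \<in> space M \<Longrightarrow> 0 \<le> s \<Longrightarrow> continuous (at_right s) (\<lambda>u. N u \<omega>)"
    and N_indep_increments: "indep_increments (count_space UNIV) N"
    and N_increments: "\<And>s u. 0 \<le> s \<Longrightarrow> s < u \<Longrightarrow>
      distr M (count_space UNIV) (\<lambda>\<omega>. N u \<omega> - N s \<omega>) = measure_pmf (poisson_pmf (rate * (u - s)))"

locale brownian_motion = prob_space M
  for M :: "'a measure" and B :: "real \<Rightarrow> 'a \<Rightarrow> real" +
  assumes B_measurable: "\<And>s. 0 \<le> s \<Longrightarrow> B s \<in> borel_measurable M"
    and B_start: "\<And>\<omega>. \<omega> \<in> space M \<Longrightarrow> B 0 \<omega> = 0"
    and B_continuous: "\<And>\<omega>. \<omega> \<in> space M \<Longrightarrow> continuous_on {0..} (\<lambda>s. B s \<omega>)"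
    and B_indep_increments: "indep_increments borel B"
    and B_increments: "\<And>s u. 0 \<le> s \<Longrightarrow> s < u \<Longrightarrow>
      distributed M lborel (\<lambda>\<omega>. B u \<omega> - B s \<omega>) (normal_density 0 (sqrt (u - s)))"

text \<open>
  Independence of \<open>V\<close> and the whole process \<open>N\<close> is independence of the \<open>\<sigma>\<close>-algebras
  they generate, that of \<open>N\<close> being generated by \<open>N\<close> as a random element of the product space.
  (The constant \<open>indep_var\<close> needs both random variables to take values in the same type.)
\<close>
locale telegraph = poisson_process M rate N
  for M :: "'a measure" and c rate :: real and V :: "'a \<Rightarrow> real" and N :: "real \<Rightarrow> 'a \<Rightarrow> nat" +
  assumes speed_pos: "0 < c"
    and V_measurable: "V \<in> borel_measurable M"
    and V_plus: "\<P>(\<omega> in M. V \<omega> = c) = 1 / 2"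
    and V_minus: "\<P>(\<omega> in M. V \<omega> = - c) = 1 / 2"
    and V_N_indep: "indep_set
      (sets (vimage_algebra (space M) V borel))
      (sets (vimage_algebra (space M) (\<lambda>\<omega>. \<lambda>s\<in>{0..}. N s \<omega>) (\<Pi>\<^sub>M s\<in>{0..}. count_space UNIV)))"

definition telegraph_process ::
  "('a \<Rightarrow> real) \<Rightarrow> (real \<Rightarrow> 'a \<Rightarrow> nat) \<Rightarrow> real \<Rightarrow> 'a \<Rightarrow> real" where
  "telegraph_process V N s \<omega> = integral {0..s} (\<lambda>u. V \<omega> * (- 1) ^ N u \<omega>)"

text \<open>
  For a process with continuous paths the supremum is attained, hence is the maximum.
\<close>
definition running_max :: "(real \<Rightarrow> 'a \<Rightarrow> real) \<Rightarrow> real \<Rightarrow> 'a \<Rightarrow> real" where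
  "running_max X t \<omega> = (SUP s\<in>{0..t}. X s \<omega>)"

definition cond_law :: "'a measure \<Rightarrow> ('a \<Rightarrow> bool) \<Rightarrow> ('a \<Rightarrow> real) \<Rightarrow> real measure" where
  "cond_law M A X = distr (uniform_measure M {\<omega> \<in> space M. A \<omega>}) borel X"

definition max_density :: "real \<Rightarrow> real \<Rightarrow> real \<Rightarrow> real \<Rightarrow> real" where
  "max_density c rate t \<beta> =
     exp (- rate * t) *
     (rate * t / (c * t + \<beta>) * bessel_I 0 (rate / c * sqrt (c\<^sup>2 * t\<^sup>2 - \<beta>\<^sup>2)) +
      sqrt ((c * t - \<beta>) / (c * t + \<beta>)) * (rate / c - 1 / (c * t + \<beta>)) *
        bessel_I 1 (rate / c * sqrt (c\<^sup>2 * t\<^sup>2 - \<beta>\<^sup>2)))"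

end

theory Submission
  imports Defs
begin

text \<open>
  Let \<open>X\<close> and \<open>Y\<close> be independent Poisson variables with means
  $a, b = \frac{1}{2}(\lambda t \pm \lambda\beta/c)$ and $D = X - Y$.  The whole theorem rests on the identities
  $$P\{\max_{s\le t}\mathcal{T}(s)\le\beta \mid V(0)=-c\} = E\,\mathrm{sgn}(D+1), \qquad
    P\{\max_{s\le t}\mathcal{T}(s)\le\beta \mid V(0)=c\} = E\,\mathrm{sgn}(D)$$
  for $0\le\beta<ct$.  In the light-cone coordinates \<open>a\<close>, \<open>b\<close> the right-hand sides
  \<open>A\<close>, \<open>B\<close> satisfy $\partial_b A = B - A$ and $\partial_a B = A - B$ with $B = 0$ for \<open>a = b\<close> and
  $A = 1$ for \<open>b = 0\<close>, which are the backward equations of the process absorbed above \<open>\<beta>\<close>.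
  They are compared with the process observed on a time grid of mesh \<open>h\<close>, where only finitely many
  independent Poisson increments matter: the one-step error is of order $h^2$, and the grid
  maxima converge pathwise.

  Differentiating in \<open>\<beta>\<close> turns the sign into the point masses of \<open>D\<close> at
  $0, -1, -2$, which are Bessel functions; the recurrence $I_2(x) = I_0(x) - \frac{2}{x}I_1(x)$
  gives the stated density, and \<open>\<beta> = 0\<close> gives the atom.  For the Kac limit the central limit
  theorem for \<open>D\<close> yields the limit law $2\Phi(\beta/\sqrt{t})-1$, which is the law of the maximum of
  Brownian motion by the reflection principle, proved here through Levy's maximal inequality
  for grid values.
\<close>

section \<open>Poisson and Skellam expectations\<close>

text \<open>With time in units of \<open>1 / rate\<close> and distance in units of
  \<open>c / rate\<close>, a step of length h changes the remaining time and the distance to the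
  level by the same amount. An upward step therefore lowers \<open>a\<close> by h and keeps
  \<open>b\<close>; a downward step lowers \<open>b\<close> by h and keeps \<open>a\<close>. Read
  backwards, undoing a step adds an independent Poisson variable of mean h to X or to Y, and one
  jump of it turns sgn D into sgn(D + 1) or conversely. That is exactly the effect of a velocity
  flip, and this is why the expected signs solve the backward equations.

  The Poisson process is given through its increments, without jump times, and no regularity of the
  law of the maximum is known beforehand. The grid comparison needs neither a decomposition at the
  first jump nor a derivative of the unknown probability. Two atoms limit its range: the one at 0,
  and for an upward start the one at \<open>c * t\<close> left by the path without flips. The
  identities are therefore derived strictly between these points, and the value at 0 is recovered
  from right continuity of the distribution function.\<close>

lemma poisson_pmf_add:
  assumes "0 < a" "0 < b"
  shows "map_pmf (\<lambda>(x, y). x + y) (pair_pmf (poisson_pmf a) (poisson_pmf b)) = poisson_pmf (a + b)"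
proof (rule pmf_eqI)
  fix n :: nat
  have eq: "(\<lambda>(x, y). x + y) -` {n} = (\<lambda>k. (k, n - k)) ` {..n}"
    by (auto simp: image_iff)
  have inj: "inj_on (\<lambda>k. (k, n - k)) {..n}"
    by (auto simp: inj_on_def)
  have "pmf (map_pmf (\<lambda>(x, y). x + y) (pair_pmf (poisson_pmf a) (poisson_pmf b))) n
      = (\<Sum>k\<le>n. pmf (pair_pmf (poisson_pmf a) (poisson_pmf b)) (k, n - k))"
    unfolding pmf_map eq by (subst measure_measure_pmf_finite) (auto simp: sum.reindex[OF inj])
  also have "\<dots> = (\<Sum>k\<le>n. (of_nat (n choose k) * a ^ k * b ^ (n - k)) * (exp (- (a + b)) / fact n))"
    using assms
    by (intro sum.cong refl)
      (simp add: pmf_pair binomial_fact exp_add exp_minus exp_diff field_simps)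
  also have "\<dots> = pmf (poisson_pmf (a + b)) n"
    using assms by (simp add: binomial_ring sum_distrib_right[symmetric] sum_divide_distrib[symmetric])
  finally show "pmf (map_pmf (\<lambda>(x, y). x + y) (pair_pmf (poisson_pmf a) (poisson_pmf b))) n
      = pmf (poisson_pmf (a + b)) n" .
qed

lemma integrable_pmf_bounded:
  fixes f :: "'a \<Rightarrow> real"
  assumes "\<And>x. \<bar>f x\<bar> \<le> K"
  shows "integrable (measure_pmf p) f"
  using assms by (intro measure_pmf.integrable_const_bound[where B=K]) auto

lemma expectation_nat_pmf_sums:
  fixes g :: "nat \<Rightarrow> 'b::{banach, second_countable_topology}"
  assumes "\<And>i. norm (g i) \<le> K"
  shows "(\<lambda>i. pmf p i *\<^sub>R g i) sums measure_pmf.expectation p g"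
proof -
  have "integrable (measure_pmf p) g"
    using assms by (intro measure_pmf.integrable_const_bound[where B=K]) auto
  then have int: "integrable (count_space UNIV) (\<lambda>i. pmf p i *\<^sub>R g i)"
    unfolding measure_pmf_eq_density by (subst (asm) integrable_density) auto
  have "measure_pmf.expectation p g = (\<integral>i. pmf p i *\<^sub>R g i \<partial>count_space UNIV)"
    unfolding measure_pmf_eq_density by (subst integral_density) auto
  then show ?thesis using sums_integral_count_space_nat[OF int] by simp
qed

lemma expectation_pmf_abs_le:
  fixes f :: "'a \<Rightarrow> real"
  assumes "\<And>x. \<bar>f x\<bar> \<le> K"
  shows "\<bar>measure_pmf.expectation p f\<bar> \<le> K"
proof -
  have "\<bar>measure_pmf.expectation p f\<bar> \<le> measure_pmf.expectation p (\<lambda>x. \<bar>f x\<bar>)"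
    by (rule integral_abs_bound)
  also have "\<dots> \<le> measure_pmf.expectation p (\<lambda>x. K)"
    using assms order_trans[OF abs_ge_zero assms] by (intro integral_mono integrable_pmf_bounded[where K=K]) auto
  finally show ?thesis by simp
qed

text \<open>Adding \<open>K\<close> makes the integrand nonnegative, so the iterated nonnegative
  integral applies; the constant is removed at the end.\<close>

lemma expectation_pair_pmf:
  fixes f :: "'a \<times> 'b \<Rightarrow> real"
  assumes "\<And>z. \<bar>f z\<bar> \<le> K"
  shows "measure_pmf.expectation (pair_pmf p q) f
    = measure_pmf.expectation p (\<lambda>x. measure_pmf.expectation q (\<lambda>y. f (x, y)))"
proof -
  define g where "g z = f z + K" for z
  have g: "0 \<le> g z" "\<bar>g z\<bar> \<le> 2 * K" for z
    using assms[of z] by (auto simp: g_def)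
  note int = integrable_pmf_bounded[where K="2*K"] integrable_pmf_bounded[where K=K]
  have inner: "(\<integral>\<^sup>+y. ennreal (g (x, y)) \<partial>measure_pmf q) = ennreal (measure_pmf.expectation q (\<lambda>y. g (x, y)))" for x
    by (intro nn_integral_eq_integral int) (use g in auto)
  have inner_bd: "\<bar>measure_pmf.expectation q (\<lambda>y. g (x, y))\<bar> \<le> 2 * K" for x
    by (intro expectation_pmf_abs_le g)
  have "ennreal (measure_pmf.expectation (pair_pmf p q) g) = (\<integral>\<^sup>+z. ennreal (g z) \<partial>measure_pmf (pair_pmf p q))"
    by (intro nn_integral_eq_integral[symmetric] int) (use g in auto)
  also have "\<dots> = (\<integral>\<^sup>+x. ennreal (measure_pmf.expectation q (\<lambda>y. g (x, y))) \<partial>measure_pmf p)"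
    by (simp add: nn_integral_pair_pmf' inner)
  also have "\<dots> = ennreal (measure_pmf.expectation p (\<lambda>x. measure_pmf.expectation q (\<lambda>y. g (x, y))))"
    by (intro nn_integral_eq_integral int) (use g inner_bd in \<open>auto intro!: integral_nonneg\<close>)
  finally have "measure_pmf.expectation (pair_pmf p q) g
      = measure_pmf.expectation p (\<lambda>x. measure_pmf.expectation q (\<lambda>y. g (x, y)))"
    by (subst (asm) ennreal_inj) (auto intro!: integral_nonneg simp: g)
  moreover have "measure_pmf.expectation (pair_pmf p q) g = measure_pmf.expectation (pair_pmf p q) f + K"
    unfolding g_def using int(2)[of f "pair_pmf p q"] assms by simp
  moreover have "measure_pmf.expectation q (\<lambda>y. g (x, y)) = measure_pmf.expectation q (\<lambda>y. f (x, y)) + K" for x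
    unfolding g_def using int(2)[of "\<lambda>y. f (x, y)" q] assms by simp
  moreover have "integrable p (\<lambda>x. measure_pmf.expectation q (\<lambda>y. f (x, y)))"
    by (intro int(2) expectation_pmf_abs_le assms)
  ultimately show ?thesis by simp
qed

lemma poisson_tail_ge_1:
  assumes "0 < h" shows "measure_pmf.prob (poisson_pmf h) {1..} \<le> h"
proof -
  have "{1..} = UNIV - {0::nat}" by auto
  then have "measure_pmf.prob (poisson_pmf h) {1..} = 1 - pmf (poisson_pmf h) 0"
    by (metis measure_pmf.prob_compl UNIV_I measure_pmf_single sets_measure_pmf space_measure_pmf)
  also have "\<dots> = 1 - exp (- h)" using assms by simp
  also have "\<dots> \<le> h" using exp_ge_add_one_self[of "-h"] by simp
  finally show ?thesis .
qed

text \<open>Since e^(-h) is at least 1 - h, at most one jump occurs with probability at least (1 -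
  h)(1 + h). This quadratic bound is what leaves a total error of order h after about 1/h
  steps.\<close>

lemma poisson_tail_ge_2:
  assumes "0 < h" shows "measure_pmf.prob (poisson_pmf h) {2..} \<le> h\<^sup>2"
proof -
  have "{2..} = UNIV - {0,1::nat}" by auto
  then have "measure_pmf.prob (poisson_pmf h) {2..} = 1 - measure_pmf.prob (poisson_pmf h) {0,1}"
    by (metis measure_pmf.prob_compl UNIV_I sets_measure_pmf space_measure_pmf)
  also have "measure_pmf.prob (poisson_pmf h) {0,1} = exp (- h) * (1 + h)"
    using assms by (subst measure_measure_pmf_finite) (auto simp: algebra_simps)
  also have "exp (- h) * (1 + h) \<ge> (1 - h) * (1 + h)"
    using exp_ge_add_one_self[of "-h"] assms by (intro mult_right_mono) auto
  then have "1 - exp (- h) * (1 + h) \<le> h\<^sup>2" by (simp add: algebra_simps power2_eq_square)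
  finally show ?thesis .
qed

text \<open>Discarding an event \<open>S\<close> costs at most \<open>2 * K\<close> times its
  probability. It serves to replace a function of the number of jumps by one that agrees with it for
  0, or for 0 and 1, jumps.\<close>

lemma expectation_pmf_diff_le:
  fixes G H :: "'a \<Rightarrow> real"
  assumes "\<And>k. \<bar>G k\<bar> \<le> K" "\<And>k. \<bar>H k\<bar> \<le> K" "\<And>k. k \<notin> S \<Longrightarrow> G k = H k"
  shows "\<bar>measure_pmf.expectation p G - measure_pmf.expectation p H\<bar> \<le> 2 * K * measure_pmf.prob p S"
proof -
  have "\<bar>measure_pmf.expectation p G - measure_pmf.expectation p H\<bar> = \<bar>measure_pmf.expectation p (\<lambda>k. G k - H k)\<bar>"
    using assms by (subst Bochner_Integration.integral_diff) (auto intro!: integrable_pmf_bounded[where K=K])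
  also have "\<dots> \<le> measure_pmf.expectation p (\<lambda>k. \<bar>G k - H k\<bar>)"
    by (rule integral_abs_bound)
  also have "\<dots> \<le> measure_pmf.expectation p (\<lambda>k. 2 * K * indicator S k)"
  proof (rule integral_mono)
    have "K \<ge> 0" using assms(1) abs_ge_zero order_trans by blast
    have "\<bar>G k - H k\<bar> \<le> 2 * K" for k
      using assms(1,2)[of k] by linarith
    then show "integrable p (\<lambda>k. \<bar>G k - H k\<bar>)"
      by (intro integrable_pmf_bounded[where K="2*K"]) auto
    show "integrable p (\<lambda>k. 2 * K * indicator S k :: real)"
      using \<open>K \<ge> 0\<close> by (intro integrable_pmf_bounded[where K="2*K"]) (auto simp: indicator_def)
    show "\<bar>G k - H k\<bar> \<le> 2 * K * indicator S k" for k
      using \<open>\<bar>G k - H k\<bar> \<le> 2 * K\<close> assms(3)[of k] by (auto simp: indicator_def)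
  qed
  also have "\<dots> = 2 * K * measure_pmf.prob p S" by simp
  finally show ?thesis .
qed

definition skellam_expectation :: "(int \<Rightarrow> real) \<Rightarrow> real \<Rightarrow> real \<Rightarrow> real" where
  "skellam_expectation f a b =
     measure_pmf.expectation (pair_pmf (poisson_pmf a) (poisson_pmf b)) (\<lambda>(i, j). f (int i - int j))"

lemma skellam_expectation_abs_le:
  "(\<And>k. \<bar>f k\<bar> \<le> K) \<Longrightarrow> \<bar>skellam_expectation f a b\<bar> \<le> K"
  unfolding skellam_expectation_def by (intro expectation_pmf_abs_le) auto

lemma skellam_expectation_swap:
  "skellam_expectation f a b = skellam_expectation (\<lambda>k. f (- k)) b a"
  unfolding skellam_expectation_def
  by (subst pair_commute_pmf) (simp add: case_prod_unfold algebra_simps)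

text \<open>A Poisson variable of mean \<open>a + h\<close> splits into independent ones of means
  \<open>h\<close> and \<open>a\<close>; conditioning on the first makes it a random translation of
  D. Both the one-step recursion and the derivatives come from this semigroup property.\<close>

lemma skellam_expectation_shift_left:
  assumes "0 < a" "0 < h" and f: "\<And>k. \<bar>f k\<bar> \<le> K"
  shows "skellam_expectation f (a + h) b
    = measure_pmf.expectation (poisson_pmf h) (\<lambda>k. skellam_expectation (\<lambda>d. f (d + int k)) a b)"
proof -
  let ?a = "poisson_pmf a" and ?b = "poisson_pmf b" and ?h = "poisson_pmf h"
  have "skellam_expectation f (a + h) b =
      measure_pmf.expectation (poisson_pmf (a + h)) (\<lambda>i. measure_pmf.expectation ?b (\<lambda>j. f (int i - int j)))"
    unfolding skellam_expectation_def by (subst expectation_pair_pmf[where K=K]) (auto simp: f)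
  also have "poisson_pmf (a + h) = map_pmf (\<lambda>(x, y). x + y) (pair_pmf ?h ?a)"
    using assms by (simp add: poisson_pmf_add add.commute)
  also have "measure_pmf.expectation \<dots> (\<lambda>i. measure_pmf.expectation ?b (\<lambda>j. f (int i - int j)))
     = measure_pmf.expectation (pair_pmf ?h ?a)
         (\<lambda>(k, i). measure_pmf.expectation ?b (\<lambda>j. f (int i - int j + int k)))"
    by (auto simp: case_prod_unfold algebra_simps intro!: Bochner_Integration.integral_cong)
  also have "\<dots> = measure_pmf.expectation ?h (\<lambda>k. measure_pmf.expectation ?a
         (\<lambda>i. measure_pmf.expectation ?b (\<lambda>j. f (int i - int j + int k))))"
    by (subst expectation_pair_pmf[where K=K]) (auto simp: f intro!: expectation_pmf_abs_le)
  also have "\<dots> = measure_pmf.expectation (poisson_pmf h) (\<lambda>k. skellam_expectation (\<lambda>d. f (d + int k)) a b)"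
    unfolding skellam_expectation_def by (subst expectation_pair_pmf[where K=K]) (auto simp: f)
  finally show ?thesis .
qed

lemma skellam_expectation_shift_right:
  assumes "0 < b" "0 < h" and f: "\<And>k. \<bar>f k\<bar> \<le> K"
  shows "skellam_expectation f a (b + h)
    = measure_pmf.expectation (poisson_pmf h) (\<lambda>k. skellam_expectation (\<lambda>d. f (d - int k)) a b)"
  unfolding skellam_expectation_swap[of _ a]
  by (subst skellam_expectation_shift_left[where K=K]) (auto simp: assms algebra_simps)

lemma skellam_expectation_diff:
  assumes "\<And>k. \<bar>f k\<bar> \<le> K" "\<And>k. \<bar>g k\<bar> \<le> K"
  shows "skellam_expectation (\<lambda>k. f k - g k) a b = skellam_expectation f a b - skellam_expectation g a b"
  unfolding skellam_expectation_def
  by (subst Bochner_Integration.integral_diff[symmetric])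
    (auto simp: assms case_prod_unfold intro!: integrable_pmf_bounded[where K=K])

section \<open>The discretised telegraph process\<close>

text \<open>
  The two directions of motion are encoded as Booleans; a telegraph path starts with
  velocity \<open>vel p * c\<close>.
\<close>
definition vel :: "bool \<Rightarrow> real" where
  "vel p = (if p then 1 else - 1)"

definition level_sign :: "bool \<Rightarrow> int \<Rightarrow> real" where
  "level_sign p d = sgn (of_int (if p then d else d + 1))"

lemma level_sign_abs_le: "\<bar>level_sign p d\<bar> \<le> 1"
  by (auto simp: level_sign_def sgn_if)

text \<open>
  With $a, b = \frac{1}{2}(\lambda t \pm \lambda\beta/c)$ this is the candidate for
  $P\{\max_{s\le t}\mathcal{T}(s)\le\beta \mid V(0)=\pm c\}$; for \<open>b \<le> 0\<close> the level cannot be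
  exceeded in the available time (and \<open>poisson_pmf b\<close> is meaningless).
\<close>
definition skellam_cdf :: "bool \<Rightarrow> real \<Rightarrow> real \<Rightarrow> real" where
  "skellam_cdf p a b = (if b \<le> 0 then 1 else skellam_expectation (level_sign p) a b)"

text \<open>One extra jump shifts the argument of the sign by one and so exchanges
  \<open>level_sign True\<close> and \<open>level_sign False\<close>. The weight \<open>q\<close> is
  the probability of an odd number of jumps, not of exactly one: parity and exact count disagree
  only from two jumps on, at cost h^2.\<close>

lemma skellam_step:
  assumes "0 < a" "0 < b" "0 < h"
    and q: "q = measure_pmf.prob (poisson_pmf h) {k. odd k}"
  shows "\<bar>skellam_expectation (level_sign True) (a + h) b
      - ((1 - q) * skellam_expectation (level_sign True) a b + q * skellam_expectation (level_sign False) a b)\<bar> \<le> 2 * h\<^sup>2"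
    and "\<bar>skellam_expectation (level_sign False) a (b + h)
      - ((1 - q) * skellam_expectation (level_sign False) a b + q * skellam_expectation (level_sign True) a b)\<bar> \<le> 2 * h\<^sup>2"
proof -
  have mix: "measure_pmf.expectation (poisson_pmf h) (\<lambda>k. if odd k then y else x) = (1 - q) * x + q * y" for x y :: real
  proof -
    define S :: "nat set" where "S = {k. odd k}"
    have *: "(\<lambda>k. if odd k then y else x) = (\<lambda>k. x + (y - x) * indicator S k)"
      by (auto simp: S_def)
    have "measure_pmf.expectation (poisson_pmf h) (\<lambda>k. if odd k then y else x) = x + (y - x) * q"
      unfolding *
      using integrable_pmf_bounded[of "indicator S" 1 "poisson_pmf h"]
      by (simp add: q S_def[symmetric])
    then show ?thesis by (simp add: algebra_simps)
  qed
  have *: "\<bar>measure_pmf.expectation (poisson_pmf h) G - ((1 - q) * G 0 + q * G 1)\<bar> \<le> 2 * h\<^sup>2"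
    if G: "\<And>k. \<bar>G k\<bar> \<le> 1" for G :: "nat \<Rightarrow> real"
  proof -
    have "\<bar>measure_pmf.expectation (poisson_pmf h) G
          - measure_pmf.expectation (poisson_pmf h) (\<lambda>k. if odd k then G 1 else G 0)\<bar>
        \<le> 2 * 1 * measure_pmf.prob (poisson_pmf h) {2..}"
      by (rule expectation_pmf_diff_le) (auto simp: G not_le less_2_cases_iff)
    then show ?thesis
      using poisson_tail_ge_2[OF \<open>0 < h\<close>] unfolding mix by linarith
  qed
  have level_sign_shift: "(\<lambda>d. level_sign True (d + 1)) = level_sign False" "(\<lambda>d. level_sign False (d - 1)) = level_sign True"
    by (auto simp: level_sign_def)
  have "\<bar>skellam_expectation (\<lambda>d. level_sign p (d + int k)) a b\<bar> \<le> 1"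
       "\<bar>skellam_expectation (\<lambda>d. level_sign p (d - int k)) a b\<bar> \<le> 1" for p k
    by (auto intro!: skellam_expectation_abs_le level_sign_abs_le)
  from *[of "\<lambda>k. skellam_expectation (\<lambda>d. level_sign True (d + int k)) a b"]
    *[of "\<lambda>k. skellam_expectation (\<lambda>d. level_sign False (d - int k)) a b"] this
  show "\<bar>skellam_expectation (level_sign True) (a + h) b
      - ((1 - q) * skellam_expectation (level_sign True) a b + q * skellam_expectation (level_sign False) a b)\<bar> \<le> 2 * h\<^sup>2"
    "\<bar>skellam_expectation (level_sign False) a (b + h)
      - ((1 - q) * skellam_expectation (level_sign False) a b + q * skellam_expectation (level_sign True) a b)\<bar> \<le> 2 * h\<^sup>2"
    using assms(1-3)
    by (simp_all add: skellam_expectation_shift_left[where K=1] skellam_expectation_shift_right[where K=1] level_sign_abs_le level_sign_shift)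
qed

text \<open>D is symmetric when both means agree, and the sign is odd. This is the absorbing
  boundary value for a particle moving upwards at the level itself.\<close>

lemma skellam_expectation_antisym: "skellam_expectation (level_sign True) b b = 0"
proof -
  have "skellam_expectation (level_sign True) b b = skellam_expectation (\<lambda>k. level_sign True (- k)) b b"
    by (rule skellam_expectation_swap)
  also have "(\<lambda>k. level_sign True (- k)) = (\<lambda>k. 0 - level_sign True k)"
    by (auto simp: level_sign_def sgn_minus)
  also have "skellam_expectation \<dots> b b = skellam_expectation (\<lambda>k. 0) b b - skellam_expectation (level_sign True) b b"
    by (rule skellam_expectation_diff[where K=1]) (auto simp: level_sign_abs_le)
  finally show ?thesis by (simp add: skellam_expectation_def case_prod_unfold)
qed

text \<open>Without a jump of the extra Poisson variable of mean \<open>h\<close> the expectation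
  vanishes by antisymmetry, so only an event of probability at most \<open>h\<close> contributes.
  This controls the overshoot of the grid path over the level.\<close>

lemma skellam_near_diagonal:
  assumes "0 < b" "0 \<le> h"
  shows "\<bar>skellam_expectation (level_sign True) (b + h) b\<bar> \<le> 2 * h"
proof (cases "h = 0")
  case False
  then have "0 < h" using assms by simp
  have "\<bar>measure_pmf.expectation (poisson_pmf h) (\<lambda>k. skellam_expectation (\<lambda>d. level_sign True (d + int k)) b b)
     - measure_pmf.expectation (poisson_pmf h) (\<lambda>k. 0)\<bar> \<le> 2 * 1 * measure_pmf.prob (poisson_pmf h) {1..}"
    by (rule expectation_pmf_diff_le)
      (auto simp: skellam_expectation_antisym not_le intro!: skellam_expectation_abs_le level_sign_abs_le)
  then show ?thesis
    using assms \<open>0 < h\<close> poisson_tail_ge_1[OF \<open>0 < h\<close>]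
    by (subst skellam_expectation_shift_left[where K=1]) (auto simp: level_sign_abs_le)
qed (simp add: skellam_expectation_antisym)

text \<open>If Y = 0 then D + 1 is positive and the sign is 1; the event that Y is at least 1 has
  probability at most \<open>b\<close>.\<close>

lemma skellam_near_boundary:
  assumes "0 < b"
  shows "\<bar>skellam_expectation (level_sign False) a b - 1\<bar> \<le> 2 * b"
proof -
  have "\<bar>measure_pmf.expectation (poisson_pmf b) (\<lambda>j. measure_pmf.expectation (poisson_pmf a) (\<lambda>i. level_sign False (int i - int j)))
     - measure_pmf.expectation (poisson_pmf b) (\<lambda>k. 1)\<bar> \<le> 2 * 1 * measure_pmf.prob (poisson_pmf b) {1..}"
    by (rule expectation_pmf_diff_le)
      (auto simp: not_le level_sign_def sgn_if intro!: expectation_pmf_abs_le)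
  moreover have "skellam_expectation (level_sign False) a b =
     measure_pmf.expectation (poisson_pmf b) (\<lambda>j. measure_pmf.expectation (poisson_pmf a) (\<lambda>i. level_sign False (int i - int j)))"
    unfolding skellam_expectation_swap[of _ a b]
    unfolding skellam_expectation_def by (subst expectation_pair_pmf[where K=1]) (auto simp: level_sign_abs_le)
  ultimately show ?thesis
    using poisson_tail_ge_1[OF assms] by simp
qed

text \<open>
  Distances are measured in units of \<open>c / rate\<close>, so that time steps and space steps have the
  same length \<open>h\<close>.  The velocity moves the particle first and may flip afterwards.
\<close>
fun chain_prob :: "real \<Rightarrow> real \<Rightarrow> nat \<Rightarrow> real \<Rightarrow> bool \<Rightarrow> real" where
  "chain_prob h q 0 r p = (if r < 0 then 0 else 1)"
| "chain_prob h q (Suc m) r p = (if r < 0 then 0 else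
     (1 - q) * chain_prob h q m (r - vel p * h) p + q * chain_prob h q m (r - vel p * h) (\<not> p))"

lemma chain_prob_eq_1: "0 < h \<Longrightarrow> real m * h \<le> r \<Longrightarrow> chain_prob h q m r p = 1"
proof (induction m arbitrary: r p)
  case (Suc m)
  have "real m * h \<le> r - vel p * h" "0 \<le> r"
    using Suc.prems by (auto simp: vel_def algebra_simps intro: order_trans[rotated])
  then show ?case using Suc by simp
qed auto

lemma chain_prob_neg: "r < 0 \<Longrightarrow> chain_prob h q m r p = 0"
  by (cases m) auto

text \<open>The weights are nonnegative with sum 1, so the error \<open>e\<close> already present is
  not amplified and only the local error \<open>d\<close> is added.\<close>

lemma convex_combination_abs_diff_le:
  fixes q :: real
  assumes "0 \<le> q" "q \<le> 1" "\<bar>x - x'\<bar> \<le> e" "\<bar>y - y'\<bar> \<le> e" "\<bar>z - ((1 - q) * x' + q * y')\<bar> \<le> d"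
  shows "\<bar>(1 - q) * x + q * y - z\<bar> \<le> d + e"
proof -
  have "\<bar>(1 - q) * (x - x') + q * (y - y')\<bar> \<le> \<bar>(1 - q) * (x - x')\<bar> + \<bar>q * (y - y')\<bar>"
    by (rule abs_triangle_ineq)
  also have "\<dots> \<le> (1 - q) * e + q * e"
    using assms by (simp add: abs_mult mult_left_mono add_mono)
  finally have "\<bar>(1 - q) * (x - x') + q * (y - y')\<bar> \<le> e" by (simp add: algebra_simps)
  moreover have "(1 - q) * x + q * y - z
      = (1 - q) * (x - x') + q * (y - y') - (z - ((1 - q) * x' + q * y'))"
    by (simp add: algebra_simps)
  ultimately show ?thesis using assms(5) by linarith
qed

text \<open>
  A regular step costs $2h^2$.  The further error $2h$ is paid only once: when the path jumps
  over the level or when the level gets out of reach, the recursion stops at an exact value.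
\<close>
lemma chain_prob_approx:
  assumes h: "0 < h" and q: "q = measure_pmf.prob (poisson_pmf h) {k. odd k}"
  shows "0 \<le> r \<Longrightarrow>
    \<bar>chain_prob h q m r p - skellam_cdf p ((real m * h + r) / 2) ((real m * h - r) / 2)\<bar>
      \<le> 2 * real m * h\<^sup>2 + 2 * h"
proof (induction m arbitrary: r p)
  case 0
  \<comment> \<open>With no time left the second parameter is \<open>- r / 2\<close>, which is
    nonpositive, so the default branch of \<open>skellam_cdf\<close> gives exactly 1.\<close>
  then show ?case using h by (simp add: skellam_cdf_def)
next
  case (Suc m)
  define a b where "a = (real (Suc m) * h + r) / 2" and "b = (real (Suc m) * h - r) / 2"
  have pos: "0 \<le> 2 * real (Suc m) * h\<^sup>2 + 2 * h" "2 * h \<le> 2 * real (Suc m) * h\<^sup>2 + 2 * h" using h by auto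
  have q01: "0 \<le> q" "q \<le> 1" by (auto simp: q)
  show ?case
  proof (cases "b \<le> 0")
    case True
    then have "chain_prob h q (Suc m) r p = 1"
      using h by (intro chain_prob_eq_1) (auto simp: b_def)
    then show ?thesis using True pos by (simp add: skellam_cdf_def b_def)
  next
    case b: False
    note IH = Suc.IH[of "r - vel p * h" p] Suc.IH[of "r - vel p * h" "\<not> p"]
    have eq: "skellam_cdf p ((real (Suc m) * h + r) / 2) ((real (Suc m) * h - r) / 2) = skellam_expectation (level_sign p) a b"
      using b by (simp add: skellam_cdf_def a_def b_def)
    show ?thesis
    proof (cases p)
      case True
      note p = this
      have a': "(real m * h + (r - vel p * h)) / 2 = a - h" and b': "(real m * h - (r - vel p * h)) / 2 = b"
        using p by (simp_all add: vel_def a_def b_def field_simps)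
      show ?thesis
      proof (cases "r < h")
        case True
        \<comment> \<open>The distance from the diagonal in the parameter plane is the distance
          \<open>r\<close> to the level, here less than one step.\<close>
        have "a = b + r" by (simp add: a_def b_def field_simps)
        then have "\<bar>skellam_expectation (level_sign True) a b\<bar> \<le> 2 * r"
          using skellam_near_diagonal[of b r] b Suc.prems by simp
        moreover have "chain_prob h q (Suc m) r p = 0"
          using True p by (simp add: chain_prob_neg vel_def)
        ultimately have "\<bar>chain_prob h q (Suc m) r p - skellam_expectation (level_sign p) a b\<bar> \<le> 2 * r"
          using p by simp
        then show ?thesis unfolding eq using True pos by linarith
      next
        case False
        have "0 < a - h" using False b unfolding a_def b_def by (simp add: field_simps)
        have "\<bar>skellam_expectation (level_sign True) a b
          - ((1 - q) * skellam_expectation (level_sign True) (a - h) b + q * skellam_expectation (level_sign False) (a - h) b)\<bar> \<le> 2 * h\<^sup>2"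
          using skellam_step(1)[OF \<open>0 < a - h\<close> _ h q, of b] b by simp
        moreover have "0 \<le> r - vel p * h" using False p by (simp add: vel_def)
        ultimately have "\<bar>(1 - q) * chain_prob h q m (r - vel p * h) True + q * chain_prob h q m (r - vel p * h) False
             - skellam_expectation (level_sign True) a b\<bar> \<le> 2 * h\<^sup>2 + (2 * real m * h\<^sup>2 + 2 * h)"
          using IH p b unfolding a' b' by (intro convex_combination_abs_diff_le q01) (auto simp: skellam_cdf_def)
        then show ?thesis unfolding eq using p Suc.prems by (simp add: algebra_simps)
      qed
    next
      case False
      note p = this
      have a': "(real m * h + (r - vel p * h)) / 2 = a" and b': "(real m * h - (r - vel p * h)) / 2 = b - h"
        using p by (simp_all add: vel_def a_def b_def field_simps)
      have r': "0 \<le> r - vel p * h" using Suc.prems p h by (simp add: vel_def)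
      show ?thesis
      proof (cases "b \<le> h")
        case True
        then have "real m * h \<le> r - vel p * h" using b' by (simp add: field_simps)
        then have "chain_prob h q (Suc m) r p = 1"
          using Suc.prems h by (simp add: chain_prob_eq_1)
        moreover have "\<bar>skellam_expectation (level_sign False) a b - 1\<bar> \<le> 2 * b"
          using b by (intro skellam_near_boundary) auto
        ultimately have "\<bar>chain_prob h q (Suc m) r p - skellam_expectation (level_sign p) a b\<bar> \<le> 2 * b"
          using p by simp
        then show ?thesis unfolding eq using True pos by linarith
      next
        case False
        have "0 < a" using b Suc.prems by (simp add: a_def b_def)
        have "\<bar>skellam_expectation (level_sign False) a b
          - ((1 - q) * skellam_expectation (level_sign False) a (b - h) + q * skellam_expectation (level_sign True) a (b - h))\<bar> \<le> 2 * h\<^sup>2"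
          using skellam_step(2)[OF \<open>0 < a\<close> _ h q, of "b - h"] False by simp
        then have "\<bar>(1 - q) * chain_prob h q m (r - vel p * h) False + q * chain_prob h q m (r - vel p * h) True
             - skellam_expectation (level_sign False) a b\<bar> \<le> 2 * h\<^sup>2 + (2 * real m * h\<^sup>2 + 2 * h)"
          using IH r' p b False unfolding a' b' by (intro convex_combination_abs_diff_le q01) (auto simp: skellam_cdf_def)
        then show ?thesis unfolding eq using p Suc.prems by (simp add: algebra_simps)
      qed
    qed
  qed
qed

section \<open>Flip patterns of the velocity\<close>

text \<open>An entry \<open>e\<close> tells whether the velocity flips after the step, so
  \<open>p \<noteq> e\<close> is the next direction. The level is tested before every step and once
  more at the end.\<close>

fun stays_below :: "real \<Rightarrow> real \<Rightarrow> bool \<Rightarrow> bool list \<Rightarrow> bool" where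
  "stays_below h r p [] = (0 \<le> r)"
| "stays_below h r p (e # es) = (0 \<le> r \<and> stays_below h (r - vel p * h) (p \<noteq> e) es)"

lemma finite_bool_lists: "finite {es :: bool list. length es = m}"
  using finite_lists_length_eq[of "UNIV :: bool set" m] by simp

text \<open>Unrolling the recursion gives a sum over flip patterns, each weighted as a sequence of
  independent flips of probability \<open>q\<close>. In this form it can be matched with finitely
  many Poisson increments.\<close>

lemma chain_prob_eq_sum:
  "chain_prob h q m r p =
     (\<Sum>es | length es = m. if stays_below h r p es then prod_list (map (\<lambda>e. if e then q else 1 - q) es) else 0)"
proof (induction m arbitrary: r p)
  case (Suc m)
  let ?w = "\<lambda>es. prod_list (map (\<lambda>e. if e then q else 1 - q) es)"
  have eq: "{es :: bool list. length es = Suc m} = (\<lambda>(e, es). e # es) ` (UNIV \<times> {es. length es = m})"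
    by (auto simp: image_iff length_Suc_conv)
  have "(\<Sum>es | length es = Suc m. if stays_below h r p es then ?w es else 0)
      = (\<Sum>(e, es) \<in> UNIV \<times> {es. length es = m}. if stays_below h r p (e # es) then ?w (e # es) else 0)"
    unfolding eq by (subst sum.reindex) (auto simp: inj_on_def case_prod_unfold)
  also have "\<dots> = (\<Sum>e\<in>UNIV. \<Sum>es | length es = m. if stays_below h r p (e # es) then ?w (e # es) else 0)"
    by (rule sum.cartesian_product[symmetric])
  also have "\<dots> = chain_prob h q (Suc m) r p"
    by (simp add: UNIV_bool Suc.IH sum_distrib_left if_distrib cong: if_cong)
  finally show ?case by simp
qed simp

text \<open>The parities of the increments multiply up to the sign relative to the start. The term
  \<open>n 0\<close> in the exponent makes the claim invariant under shifting \<open>n\<close>: in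
  the induction the new initial direction absorbs the parity of the first increment. Monotonicity
  makes the truncated subtraction a true one.\<close>

lemma stays_below_iff_partial_sums:
  fixes n :: "nat \<Rightarrow> nat"
  assumes "mono n"
  shows "stays_below h r p (map (\<lambda>i. odd (n (Suc i) - n i)) [0..<m])
     \<longleftrightarrow> (\<forall>k\<le>m. (\<Sum>i<k. vel p * h * (- 1) ^ (n i + n 0)) \<le> r)"
  using assms
proof (induction m arbitrary: n r p)
  case (Suc m)
  define n' where "n' i = n (Suc i)" for i
  have "mono n'" using Suc.prems by (auto simp: n'_def mono_def)
  have le: "n 0 \<le> n 1" using Suc.prems by (auto simp: mono_def)
  have vel': "vel (p \<noteq> odd (n (Suc 0) - n 0)) = vel p * (- 1) ^ (n 1 + n 0)"
    using le by (auto simp: vel_def even_diff_nat)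
  have *: "(\<Sum>i<Suc k. vel p * h * (- 1) ^ (n i + n 0)) = vel p * h
      + (\<Sum>i<k. vel (p \<noteq> odd (n (Suc 0) - n 0)) * h * (- 1) ^ (n' i + n' 0))" for k
    unfolding sum.lessThan_Suc_shift vel'
    by (intro arg_cong2[where f="(+)"] sum.cong) (simp_all add: n'_def minus_one_power_iff)
  have "[0..<Suc m] = 0 # map Suc [0..<m]"
    by (simp add: map_Suc_upt upt_conv_Cons)
  then have "map (\<lambda>i. odd (n (Suc i) - n i)) [0..<Suc m]
      = odd (n (Suc 0) - n 0) # map (\<lambda>i. odd (n' (Suc i) - n' i)) [0..<m]"
    by (simp add: n'_def comp_def)
  then have "stays_below h r p (map (\<lambda>i. odd (n (Suc i) - n i)) [0..<Suc m]) \<longleftrightarrow> 0 \<le> r \<and>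
     (\<forall>k\<le>m. (\<Sum>i<k. vel (p \<noteq> odd (n (Suc 0) - n 0)) * h * (- 1) ^ (n' i + n' 0)) \<le> r - vel p * h)"
    using Suc.IH[OF \<open>mono n'\<close>] by simp
  also have "\<dots> \<longleftrightarrow> 0 \<le> r \<and> (\<forall>k\<le>m. (\<Sum>i<Suc k. vel p * h * (- 1) ^ (n i + n 0)) \<le> r)"
    unfolding * by (simp add: algebra_simps)
  also have "\<dots> \<longleftrightarrow> (\<forall>k\<le>Suc m. (\<Sum>i<k. vel p * h * (- 1) ^ (n i + n 0)) \<le> r)"
    using All_less_Suc2[of "Suc m" "\<lambda>k. (\<Sum>i<k. vel p * h * (- 1) ^ (n i + n 0)) \<le> r"]
    by (simp only: less_Suc_eq_le lessThan_0 sum.empty)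
  finally show ?case .
qed auto

lemma measurable_diff_nat_count_space:
  fixes f g :: "'a \<Rightarrow> nat"
  assumes [measurable]: "f \<in> measurable M (count_space UNIV)" "g \<in> measurable M (count_space UNIV)"
  shows "(\<lambda>x. f x - g x) \<in> measurable M (count_space UNIV)"
  by measurable

lemma (in prob_space) indep_sets_subset_events:
  "indep_sets F I \<Longrightarrow> i \<in> I \<Longrightarrow> F i \<subseteq> events"
  by (simp add: indep_sets_def)

lemma (in poisson_process) N_le:
  "\<omega> \<in> space M \<Longrightarrow> 0 \<le> s \<Longrightarrow> s \<le> u \<Longrightarrow> N s \<omega> \<le> N u \<omega>"
  using N_mono[of \<omega>] by (auto simp: mono_on_def)

context telegraph
begin

definition flips :: "real \<Rightarrow> nat \<Rightarrow> 'a \<Rightarrow> bool list" where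
  "flips h m \<omega> = map (\<lambda>i. odd (N (real (Suc i) * h) \<omega> - N (real i * h) \<omega>)) [0..<m]"

lemma prob_V: "prob {\<omega> \<in> space M. V \<omega> = vel p * c} = 1 / 2"
  using V_plus V_minus by (auto simp: vel_def)

text \<open>The increments over the grid cells are independent with the Poisson law of mean
  \<open>rate * h\<close>, and each entry of the list prescribes the parity of one of them.\<close>

lemma prob_flips:
  assumes h: "0 < h" and es: "length es = m" "0 < m"
    and q: "q = measure_pmf.prob (poisson_pmf (rate * h)) {k. odd k}"
  shows "prob {\<omega> \<in> space M. flips h m \<omega> = es} = prod_list (map (\<lambda>e. if e then q else 1 - q) es)"
proof -
  define \<tau> where "\<tau> i = real i * h" for i :: nat
  define X where "X i \<omega> = N (\<tau> (Suc i)) \<omega> - N (\<tau> i) \<omega>" for i \<omega>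
  define A where "A i = {k :: nat. odd k = es ! i}" for i
  have \<tau>: "0 \<le> \<tau> i" "\<tau> i < \<tau> (Suc i)" "\<tau> (Suc i) - \<tau> i = h" for i
    using h by (auto simp: \<tau>_def algebra_simps)
  have ind: "indep_vars (\<lambda>_. count_space UNIV) X {..<m}"
    using N_indep_increments[unfolded indep_increments_def, rule_format, of \<tau> m] \<tau>
    unfolding X_def by (simp add: less_imp_le)
  have meas: "X i \<in> measurable M (count_space UNIV)" for i
    unfolding X_def using N_measurable[OF \<tau>(1)] by measurable
  have one: "prob (X i -` A i \<inter> space M) = (if es ! i then q else 1 - q)" for i
  proof -
    have "prob (X i -` A i \<inter> space M) = measure (distr M (count_space UNIV) (X i)) (A i)"
      by (subst measure_distr) (auto intro: meas)
    also have "distr M (count_space UNIV) (X i) = measure_pmf (poisson_pmf (rate * h))"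
      using N_increments[OF \<tau>(1) \<tau>(2)] \<tau>(3)[of i] by (simp add: X_def[abs_def])
    also have "measure_pmf.prob (poisson_pmf (rate * h)) (A i) = (if es ! i then q else 1 - q)"
    proof (cases "es ! i")
      case False
      then have "A i = UNIV - {k. odd k}" by (auto simp: A_def)
      then show ?thesis
        using False measure_pmf.prob_compl[of "{k. odd k}" "poisson_pmf (rate * h)"] q by simp
    qed (auto simp: A_def q)
    finally show ?thesis .
  qed
  have "{\<omega> \<in> space M. flips h m \<omega> = es} = (\<Inter>i\<in>{..<m}. X i -` A i \<inter> space M)"
    using es by (auto simp: list_eq_iff_nth_eq flips_def A_def X_def \<tau>_def)
  also have "prob \<dots> = (\<Prod>i<m. prob (X i -` A i \<inter> space M))"
    using es by (intro indep_varsD_finite[OF ind]) auto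
  also have "\<dots> = prod_list (map (\<lambda>e. if e then q else 1 - q) es)"
    unfolding one by (subst prod.list_conv_set_nth) (auto simp: es atLeast0LessThan intro!: prod.cong)
  finally show ?thesis .
qed

text \<open>Independence is assumed between generated sigma-algebras, so the flip event must be
  placed in the one generated by the whole path \<open>?X\<close>; this holds because each
  \<open>N s\<close> is a coordinate of \<open>?X\<close>. Measurability in \<open>M\<close> then
  comes for free, as independent families consist of events.\<close>

lemma prob_V_flips:
  assumes h: "0 < h"
  shows "prob {\<omega> \<in> space M. V \<omega> = vel p * c \<and> flips h m \<omega> = es} = 1 / 2 * prob {\<omega> \<in> space M. flips h m \<omega> = es}"
    and "{\<omega> \<in> space M. flips h m \<omega> = es} \<in> events"
    and "{\<omega> \<in> space M. V \<omega> = vel p * c} \<in> events"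
proof -
  let ?X = "\<lambda>\<omega>. \<lambda>s\<in>{0..}. N s \<omega>" and ?P = "\<Pi>\<^sub>M s\<in>{0::real..}. count_space (UNIV :: nat set)"
  let ?F = "vimage_algebra (space M) ?X ?P" and ?G = "vimage_algebra (space M) V borel"
  have X: "?X \<in> measurable ?F ?P"
    by (rule measurable_vimage_algebra1) (simp add: space_PiM Pi_iff)
  have N_F: "N s \<in> measurable ?F (count_space UNIV)" if "0 \<le> s" for s
    using measurable_compose[OF X measurable_component_singleton[of s "{0..}" "\<lambda>_. count_space UNIV"]] that
    by (simp only: atLeast_iff restrict_apply' if_True)
  have *: "N (real i * h) \<in> measurable ?F (count_space UNIV)" for i :: nat
    using h by (intro N_F) auto
  have eq: "{\<omega> \<in> space M. flips h m \<omega> = es} = {\<omega> \<in> space ?F. length es = m \<and>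
      (\<forall>i\<in>{..<m}. odd (N (real (Suc i) * h) \<omega> - N (real i * h) \<omega>) = es ! i)}"
    by (auto simp: flips_def list_eq_iff_nth_eq)
  have "(\<lambda>\<omega>. N (real (Suc i) * h) \<omega> - N (real i * h) \<omega>) -` {k. odd k = es ! i} \<inter> space ?F \<in> sets ?F" for i
    by (rule measurable_sets[OF measurable_diff_nat_count_space[OF * *]]) simp
  then have "{\<omega> \<in> space ?F. odd (N (real (Suc i) * h) \<omega> - N (real i * h) \<omega>) = es ! i} \<in> sets ?F" for i
    by (simp only: vimage_def Int_def mem_Collect_eq conj_commute)
  then have "{\<omega> \<in> space ?F. length es = m \<and>
      (\<forall>i\<in>{..<m}. odd (N (real (Suc i) * h) \<omega> - N (real i * h) \<omega>) = es ! i)} \<in> sets ?F"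
    by (intro sets.sets_Collect_conj sets.sets_Collect_const sets.sets_Collect_finite_All) auto
  then have F: "{\<omega> \<in> space M. flips h m \<omega> = es} \<in> sets ?F"
    unfolding eq .
  have G: "{\<omega> \<in> space M. V \<omega> = vel p * c} \<in> sets ?G"
  proof -
    have "{vel p * c} \<in> sets borel" by simp
    from in_vimage_algebra[OF this, of V "space M"] show ?thesis
      by (simp only: vimage_def Int_def mem_Collect_eq singleton_iff conj_commute)
  qed
  have FG: "sets ?F \<subseteq> events" "sets ?G \<subseteq> events"
    using indep_sets_subset_events[OF V_N_indep[unfolded indep_set_def], of True] indep_sets_subset_events[OF V_N_indep[unfolded indep_set_def], of False]
    by auto
  show "{\<omega> \<in> space M. flips h m \<omega> = es} \<in> events"
    "{\<omega> \<in> space M. V \<omega> = vel p * c} \<in> events"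
    using F G FG by blast+
  have "{\<omega> \<in> space M. V \<omega> = vel p * c \<and> flips h m \<omega> = es}
    = {\<omega> \<in> space M. V \<omega> = vel p * c} \<inter> {\<omega> \<in> space M. flips h m \<omega> = es}" by auto
  then show "prob {\<omega> \<in> space M. V \<omega> = vel p * c \<and> flips h m \<omega> = es}
      = 1 / 2 * prob {\<omega> \<in> space M. flips h m \<omega> = es}"
    using indep_setD[OF V_N_indep G F] prob_V by simp
qed

text \<open>Multiplication by \<open>rate / c\<close> turns every step into one of length
  \<open>rate * h\<close> and the level into \<open>rate * x / c\<close>, the units of
  \<open>chain_prob\<close>. As \<open>N 0\<close> vanishes, no parity correction remains in the
  partial sums.\<close>

lemma prob_discrete_max:
  assumes h: "0 < h" and m: "0 < m"
    and q: "q = measure_pmf.prob (poisson_pmf (rate * h)) {k. odd k}"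
  shows "prob {\<omega> \<in> space M. V \<omega> = vel p * c \<and> (\<forall>k\<le>m. (\<Sum>i<k. h * (V \<omega> * (- 1) ^ N (real i * h) \<omega>)) \<le> x)}
     = 1 / 2 * chain_prob (rate * h) q m (rate * x / c) p"
proof -
  let ?A = "{es. length es = m \<and> stays_below (rate * h) (rate * x / c) p es}"
  let ?E = "\<lambda>es. {\<omega> \<in> space M. V \<omega> = vel p * c \<and> flips h m \<omega> = es}"
  have finA: "finite ?A" by (rule finite_subset[OF _ finite_bool_lists[of m]]) blast
  define Q where "Q \<omega> \<longleftrightarrow> (\<forall>k\<le>m. (\<Sum>i<k. h * (V \<omega> * (- 1) ^ N (real i * h) \<omega>)) \<le> x)" for \<omega>
  have key: "Q \<omega> \<longleftrightarrow> flips h m \<omega> \<in> ?A"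
    if \<omega>: "\<omega> \<in> space M" "V \<omega> = vel p * c" for \<omega>
  proof -
    have "mono (\<lambda>i. N (real i * h) \<omega>)"
      using h by (intro monoI N_le[OF \<omega>(1)] mult_right_mono mult_nonneg_nonneg) simp_all
    from stays_below_iff_partial_sums[OF this]
    have "stays_below (rate * h) (rate * x / c) p (flips h m \<omega>) \<longleftrightarrow>
       (\<forall>k\<le>m. (\<Sum>i<k. vel p * (rate * h) * (- 1) ^ N (real i * h) \<omega>) \<le> rate * x / c)"
      using \<omega> by (simp add: flips_def N_start)
    moreover have "(\<Sum>i<k. h * (V \<omega> * (- 1) ^ N (real i * h) \<omega>)) \<le> x \<longleftrightarrow>
       (\<Sum>i<k. vel p * (rate * h) * (- 1) ^ N (real i * h) \<omega>) \<le> rate * x / c" for k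
    proof -
      have "(\<Sum>i<k. vel p * (rate * h) * (- 1) ^ N (real i * h) \<omega>)
         = rate / c * (\<Sum>i<k. h * (V \<omega> * (- 1) ^ N (real i * h) \<omega>))"
        using speed_pos \<omega> by (simp add: sum_distrib_left mult_ac)
      then show ?thesis using speed_pos rate_pos by (simp add: field_simps)
    qed
    ultimately show ?thesis unfolding Q_def by (simp add: flips_def)
  qed
  have eq: "{\<omega> \<in> space M. V \<omega> = vel p * c \<and> Q \<omega>} = (\<Union>es\<in>?A. ?E es)"
  proof (intro set_eqI iffI)
    fix \<omega> assume "\<omega> \<in> {\<omega> \<in> space M. V \<omega> = vel p * c \<and> Q \<omega>}"
    then have \<omega>: "\<omega> \<in> space M" "V \<omega> = vel p * c" "Q \<omega>" by simp_all
    have "flips h m \<omega> \<in> ?A" using key[OF \<omega>(1,2)] \<omega>(3) by (rule iffD1)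
    moreover have "\<omega> \<in> ?E (flips h m \<omega>)" using \<omega> by simp
    ultimately show "\<omega> \<in> (\<Union>es\<in>?A. ?E es)" by (rule UN_I)
  next
    fix \<omega> assume "\<omega> \<in> (\<Union>es\<in>?A. ?E es)"
    then obtain es where es: "es \<in> ?A" "\<omega> \<in> ?E es" by (rule UN_E)
    then have \<omega>: "\<omega> \<in> space M" "V \<omega> = vel p * c" "flips h m \<omega> = es" by simp_all
    have "Q \<omega>" using key[OF \<omega>(1,2)] es(1) unfolding \<omega>(3) by (rule iffD2)
    then show "\<omega> \<in> {\<omega> \<in> space M. V \<omega> = vel p * c \<and> Q \<omega>}" using \<omega> by simp
  qed
  have "prob {\<omega> \<in> space M. V \<omega> = vel p * c \<and> Q \<omega>} = (\<Sum>es\<in>?A. prob (?E es))"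
    unfolding eq
  proof (rule finite_measure_finite_Union[OF finA])
    have "?E es \<in> events" for es
    proof -
      have "?E es = {\<omega> \<in> space M. V \<omega> = vel p * c} \<inter> {\<omega> \<in> space M. flips h m \<omega> = es}"
        by auto
      also have "\<dots> \<in> events" by (intro sets.Int prob_V_flips[OF h])
      finally show ?thesis .
    qed
    then show "?E ` ?A \<subseteq> events" by blast
    show "disjoint_family_on ?E ?A" by (auto simp: disjoint_family_on_def)
  qed
  also have "\<dots> = (\<Sum>es\<in>?A. 1 / 2 * prod_list (map (\<lambda>e. if e then q else 1 - q) es))"
  proof (rule sum.cong[OF refl])
    fix es assume "es \<in> ?A"
    then have "length es = m" by simp
    show "prob (?E es) = 1 / 2 * prod_list (map (\<lambda>e. if e then q else 1 - q) es)"
      unfolding prob_V_flips(1)[OF h] prob_flips[OF h \<open>length es = m\<close> m q] by (rule refl)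
  qed
  also have "\<dots> = 1 / 2 * (\<Sum>es\<in>?A. prod_list (map (\<lambda>e. if e then q else 1 - q) es))"
    by (rule sum_distrib_left[symmetric])
  also have "(\<Sum>es\<in>?A. prod_list (map (\<lambda>e. if e then q else 1 - q) es)) = chain_prob (rate * h) q m (rate * x / c) p"
    unfolding chain_prob_eq_sum
    using sum.inter_filter[OF finite_bool_lists[of m], of "\<lambda>es. prod_list (map (\<lambda>e. if e then q else 1 - q) es)"
        "stays_below (rate * h) (rate * x / c) p"] by (simp only: mem_Collect_eq)
  finally show ?thesis unfolding Q_def .
qed

end

section \<open>Discretisation of the paths\<close>

text \<open>The indicators are bounded by 1 and eventually zero at every outcome, so dominated
  convergence applies.\<close>

lemma (in prob_space) prob_indicator_tendsto_0:
  assumes meas: "\<And>m. A m \<in> events"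
    and ev: "\<And>\<omega>. \<omega> \<in> space M \<Longrightarrow> eventually (\<lambda>m. \<omega> \<notin> A m) sequentially"
  shows "(\<lambda>m :: nat. prob (A m)) \<longlonglongrightarrow> 0"
proof -
  have "(\<lambda>m. \<integral>\<omega>. indicator (A m) \<omega> \<partial>M) \<longlonglongrightarrow> (\<integral>\<omega>. (0::real) \<partial>M)"
  proof (rule integral_dominated_convergence[where w="\<lambda>_. 1"])
    show "AE \<omega> in M. (\<lambda>m. indicator (A m) \<omega> :: real) \<longlonglongrightarrow> 0"
    proof (rule AE_I2)
      fix \<omega> assume "\<omega> \<in> space M"
      from ev[OF this] show "(\<lambda>m. indicator (A m) \<omega> :: real) \<longlonglongrightarrow> 0"
        by (intro tendsto_eventually) (auto elim: eventually_mono)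
    qed
  qed (use meas in \<open>auto simp: indicator_def\<close>)
  then show ?thesis using meas by simp
qed

text \<open>For \<open>y < z\<close> the event that \<open>X\<close> is at most \<open>y\<close>
  lies in the event that \<open>Y m\<close> is at most \<open>z\<close>, up to a set on which
  \<open>X\<close> and \<open>Y m\<close> are separated by the gap; its probability tends to 0. The
  same holds with \<open>X\<close> and \<open>Y m\<close> exchanged, and continuity of
  \<open>U\<close> at \<open>x\<close> closes the gap. The bound \<open>l\<close> allows limits that
  are known on a half-line only.\<close>

lemma (in prob_space) prob_le_eq_limit:
  fixes X :: "'a \<Rightarrow> real" and Y :: "nat \<Rightarrow> 'a \<Rightarrow> real"
  assumes X[measurable]: "X \<in> borel_measurable M"
    and Y[measurable]: "\<And>m. Y m \<in> borel_measurable M"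
    and E[measurable]: "Measurable.pred M E"
    and YX: "\<And>\<omega>. \<omega> \<in> space M \<Longrightarrow> (\<lambda>m. Y m \<omega>) \<longlonglongrightarrow> X \<omega>"
    and U: "\<And>z. l < z \<Longrightarrow> (\<lambda>m. prob {\<omega> \<in> space M. E \<omega> \<and> Y m \<omega> \<le> z}) \<longlonglongrightarrow> U z"
    and "l < x" "isCont U x"
  shows "prob {\<omega> \<in> space M. E \<omega> \<and> X \<omega> \<le> x} = U x"
proof (rule antisym)
  have upper: "prob {\<omega> \<in> space M. E \<omega> \<and> X \<omega> \<le> y} \<le> U z" if "y < z" "l < z" for y z
  proof (rule LIMSEQ_le)
    let ?A = "\<lambda>m. {\<omega> \<in> space M. X \<omega> \<le> y \<and> z < Y m \<omega>}"
    have "(\<lambda>m. prob (?A m)) \<longlonglongrightarrow> 0"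
    proof (rule prob_indicator_tendsto_0)
      fix \<omega> assume \<omega>: "\<omega> \<in> space M"
      show "eventually (\<lambda>m. \<omega> \<notin> ?A m) sequentially"
      proof (cases "X \<omega> \<le> y")
        case True
        then show ?thesis
          using order_tendstoD(2)[OF YX[OF \<omega>], of z] \<open>y < z\<close> by (simp add: not_less eventually_mono[OF _ less_imp_le])
      qed auto
    qed measurable
    from tendsto_add[OF U[OF \<open>l < z\<close>] this]
    show "(\<lambda>m. prob {\<omega> \<in> space M. E \<omega> \<and> Y m \<omega> \<le> z} + prob (?A m)) \<longlonglongrightarrow> U z"
      by simp
    have "prob {\<omega> \<in> space M. E \<omega> \<and> X \<omega> \<le> y}
        \<le> prob {\<omega> \<in> space M. E \<omega> \<and> Y m \<omega> \<le> z} + prob (?A m)" for m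
      by (rule order_trans[OF finite_measure_mono measure_Un_le]) (auto simp: not_le[symmetric])
    then show "\<exists>N. \<forall>m\<ge>N. prob {\<omega> \<in> space M. E \<omega> \<and> X \<omega> \<le> y}
        \<le> prob {\<omega> \<in> space M. E \<omega> \<and> Y m \<omega> \<le> z} + prob (?A m)" by blast
  qed simp
  have lower: "U y \<le> prob {\<omega> \<in> space M. E \<omega> \<and> X \<omega> \<le> z}" if "y < z" "l < y" for y z
  proof (rule LIMSEQ_le)
    let ?A = "\<lambda>m. {\<omega> \<in> space M. Y m \<omega> \<le> y \<and> z < X \<omega>}"
    have "(\<lambda>m. prob (?A m)) \<longlonglongrightarrow> 0"
    proof (rule prob_indicator_tendsto_0)
      fix \<omega> assume \<omega>: "\<omega> \<in> space M"
      show "eventually (\<lambda>m. \<omega> \<notin> ?A m) sequentially"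
      proof (cases "z < X \<omega>")
        case True
        then show ?thesis
          using order_tendstoD(1)[OF YX[OF \<omega>], of y] \<open>y < z\<close> by (simp add: not_le)
      qed auto
    qed measurable
    from tendsto_add[OF tendsto_const this]
    show "(\<lambda>m. prob {\<omega> \<in> space M. E \<omega> \<and> X \<omega> \<le> z} + prob (?A m))
        \<longlonglongrightarrow> prob {\<omega> \<in> space M. E \<omega> \<and> X \<omega> \<le> z}" by simp
    show "(\<lambda>m. prob {\<omega> \<in> space M. E \<omega> \<and> Y m \<omega> \<le> y}) \<longlonglongrightarrow> U y"
      by (rule U) fact
    have "prob {\<omega> \<in> space M. E \<omega> \<and> Y m \<omega> \<le> y}
        \<le> prob {\<omega> \<in> space M. E \<omega> \<and> X \<omega> \<le> z} + prob (?A m)" for m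
      by (rule order_trans[OF finite_measure_mono measure_Un_le]) (auto simp: not_le[symmetric])
    then show "\<exists>N. \<forall>m\<ge>N. prob {\<omega> \<in> space M. E \<omega> \<and> Y m \<omega> \<le> y}
        \<le> prob {\<omega> \<in> space M. E \<omega> \<and> X \<omega> \<le> z} + prob (?A m)" by blast
  qed
  have U_right: "(U \<longlongrightarrow> U x) (at_right x)" and U_left: "(U \<longlongrightarrow> U x) (at_left x)"
    using \<open>isCont U x\<close> by (auto simp: isCont_def filterlim_at_split)
  show "prob {\<omega> \<in> space M. E \<omega> \<and> X \<omega> \<le> x} \<le> U x"
    using U_right \<open>l < x\<close>
    by (intro tendsto_lowerbound[OF U_right]) (auto simp: eventually_at_right_field intro!: exI[of _ "x + 1"] upper)
  show "U x \<le> prob {\<omega> \<in> space M. E \<omega> \<and> X \<omega> \<le> x}"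
    using U_left \<open>l < x\<close>
    by (intro tendsto_upperbound[OF U_left]) (auto simp: eventually_at_left_field intro!: exI[of _ l] lower)
qed

text \<open>The alternating sign is a difference of two nondecreasing functions of \<open>k\<close>,
  up to a constant. Composed with a monotone path it is therefore integrable on compact
  intervals.\<close>

lemma minus_one_power_nat_eq:
  "(- 1) ^ k = 1 - 2 * real ((k + 1) div 2) + 2 * real (k div 2)"
proof (cases "even k")
  case True
  then obtain j where "k = 2 * j" by (rule evenE)
  then show ?thesis by simp
next
  case False
  then obtain j where "k = 2 * j + 1" by (rule oddE)
  then show ?thesis by simp
qed

context
  fixes n :: "real \<Rightarrow> nat" and v :: real and g
  assumes n_mono: "\<And>s u. 0 \<le> s \<Longrightarrow> s \<le> u \<Longrightarrow> n s \<le> n u"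
  defines "g \<equiv> \<lambda>u. v * (- 1) ^ n u"
begin

lemma switching_integrable:
  assumes "0 \<le> a" shows "g integrable_on {a..b}"
proof -
  have "(\<lambda>u. real ((n u + 1) div 2)) integrable_on {a..b}" "(\<lambda>u. real (n u div 2)) integrable_on {a..b}"
    using assms by (auto simp: mono_on_def intro!: integrable_on_mono_on div_le_mono n_mono)
  then have "(\<lambda>u. 1 - 2 * real ((n u + 1) div 2) + 2 * real (n u div 2)) integrable_on {a..b}"
    by (intro integrable_add integrable_diff integrable_const_ivl integrable_on_mult_right)
  then have "(\<lambda>u. (- 1) ^ n u :: real) integrable_on {a..b}"
    by (simp only: minus_one_power_nat_eq)
  then show ?thesis
    unfolding g_def by (rule integrable_on_mult_right)
qed

lemma switching_abs: "\<bar>g u\<bar> = \<bar>v\<bar>"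
  by (simp add: g_def abs_mult power_abs)

lemma switching_integral_diff:
  assumes "0 \<le> s" "s \<le> u"
  shows "integral {0..u} g - integral {0..s} g = integral {s..u} g"
  using Henstock_Kurzweil_Integration.integral_combine[of 0 s u g] assms switching_integrable[of 0 u] by simp

lemma switching_integral_lipschitz:
  assumes "0 \<le> s" "s \<le> u"
  shows "\<bar>integral {0..u} g - integral {0..s} g\<bar> \<le> \<bar>v\<bar> * (u - s)"
proof -
  have "\<bar>integral {s..u} g\<bar> \<le> integral {s..u} (\<lambda>_. \<bar>v\<bar>)"
    using Henstock_Kurzweil_Integration.integral_norm_bound_integral[of g "{s..u}" "\<lambda>_. \<bar>v\<bar>"] switching_integrable[of s u] assms switching_abs
    by (simp add: integrable_const_ivl del: integral_const_real)
  then show ?thesis using switching_integral_diff[OF assms] assms by (simp add: mult.commute)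
qed

text \<open>Without a jump in the cell the velocity is constant there and the error is 0; otherwise
  the crude bound \<open>2 * \<bar>v\<bar> * h\<close> suffices. Multiplying it by the number of
  jumps covers both cases and makes the errors telescope when the cells are summed.\<close>

lemma switching_integral_step:
  assumes "0 \<le> s" "0 \<le> h"
  shows "\<bar>integral {s..s + h} g - h * g s\<bar> \<le> 2 * \<bar>v\<bar> * h * (real (n (s + h)) - real (n s))"
proof (cases "n (s + h) = n s")
  case True
  have "g u = g s" if "u \<in> {s..s + h}" for u
  proof -
    have "n u = n s" using n_mono[of s u] n_mono[of u "s + h"] that True assms by auto
    then show ?thesis by (simp add: g_def)
  qed
  then have "integral {s..s + h} g = integral {s..s + h} (\<lambda>_. g s)"
    by (intro integral_cong)
  also have "\<dots> = h * g s" using assms by simp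
  finally show ?thesis using True by simp
next
  case False
  then have "1 \<le> real (n (s + h)) - real (n s)"
    using n_mono[of s "s + h"] assms by linarith
  moreover have "\<bar>integral {s..s + h} g - h * g s\<bar> \<le> \<bar>v\<bar> * h + h * \<bar>v\<bar>"
  proof -
    have "\<bar>integral {s..s + h} g\<bar> \<le> \<bar>v\<bar> * h"
      using switching_integral_lipschitz[of s "s + h"] switching_integral_diff[of s "s + h"] assms by simp
    moreover have "\<bar>h * g s\<bar> = h * \<bar>v\<bar>" using assms by (simp add: abs_mult switching_abs)
    ultimately show ?thesis by linarith
  qed
  ultimately show ?thesis
    using mult_left_mono[of 1 "real (n (s + h)) - real (n s)" "2 * \<bar>v\<bar> * h"] assms by (simp add: mult_ac)
qed

lemma switching_riemann_sum:
  assumes "0 \<le> h"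
  shows "\<bar>integral {0..real k * h} g - (\<Sum>i<k. h * g (real i * h))\<bar> \<le> 2 * \<bar>v\<bar> * h * real (n (real k * h))"
proof (induction k)
  case (Suc k)
  have "real (Suc k) * h = real k * h + h" by (simp add: algebra_simps)
  moreover have "integral {0..real k * h + h} g = integral {0..real k * h} g + integral {real k * h..real k * h + h} g"
    using switching_integral_diff[of "real k * h" "real k * h + h"] assms by simp
  ultimately show ?case
    using Suc.IH switching_integral_step[of "real k * h" h] assms by (simp add: algebra_simps)
qed (use assms in simp)

text \<open>The Riemann sums contribute the term with \<open>n t\<close>; the remaining
  \<open>\<bar>v\<bar> * h\<close> bounds the motion between a time and the last grid point before
  it.\<close>

lemma switching_max_approx:
  assumes "0 < h" "t = real m * h" "0 \<le> t"
  shows "\<bar>(SUP s\<in>{0..t}. integral {0..s} g) - Max ((\<lambda>k. \<Sum>i<k. h * g (real i * h)) ` {..m})\<bar>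
    \<le> \<bar>v\<bar> * h * (1 + 2 * real (n t))"
proof -
  let ?F = "\<lambda>s. integral {0..s} g" and ?S = "\<lambda>k. \<Sum>i<k. h * g (real i * h)"
  have bdd: "bdd_above (?F ` {0..t})"
  proof (rule bdd_aboveI2)
    fix s assume "s \<in> {0..t}"
    then have "\<bar>?F s\<bar> \<le> \<bar>v\<bar> * s" "\<bar>v\<bar> * s \<le> \<bar>v\<bar> * t"
      using switching_integral_lipschitz[of 0 s] by (auto intro: mult_left_mono)
    then show "?F s \<le> \<bar>v\<bar> * t" by linarith
  qed
  have err: "\<bar>?F (real k * h) - ?S k\<bar> \<le> 2 * \<bar>v\<bar> * h * real (n t)" if "k \<le> m" for k
  proof -
    have "real k * h \<le> t" using that assms by (simp add: mult_right_mono)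
    then have "2 * \<bar>v\<bar> * h * real (n (real k * h)) \<le> 2 * \<bar>v\<bar> * h * real (n t)"
      using n_mono[of "real k * h" t] assms by (intro mult_left_mono) auto
    then show ?thesis using switching_riemann_sum[of h k] assms by linarith
  qed
  have "(SUP s\<in>{0..t}. ?F s) \<le> Max (?S ` {..m}) + \<bar>v\<bar> * h * (1 + 2 * real (n t))"
  proof (rule cSUP_least)
    fix s assume s: "s \<in> {0..t}"
    define k where "k = nat \<lfloor>s / h\<rfloor>"
    have fl: "0 \<le> \<lfloor>s / h\<rfloor>" using s assms by simp
    have "real k \<le> s / h" "s / h < real k + 1"
      unfolding k_def using fl by (simp_all add: of_nat_nat)
    then have k: "real k * h \<le> s" "s \<le> real k * h + h" using assms by (simp_all add: field_simps)
    have "real k * h \<le> s" by (rule k)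
    also have "s \<le> t" using s by simp
    also have "t = real m * h" by fact
    finally have "k \<le> m" using assms by simp
    have "?F s \<le> ?F (real k * h) + \<bar>v\<bar> * (s - real k * h)"
      using switching_integral_lipschitz[of "real k * h" s] k assms by simp
    also have "\<bar>v\<bar> * (s - real k * h) \<le> \<bar>v\<bar> * h"
      using k by (intro mult_left_mono) auto
    also have "?F (real k * h) \<le> ?S k + 2 * \<bar>v\<bar> * h * real (n t)"
      using err[OF \<open>k \<le> m\<close>] by linarith
    also have "?S k \<le> Max (?S ` {..m})"
      using \<open>k \<le> m\<close> by (intro Max_ge) auto
    finally show "?F s \<le> Max (?S ` {..m}) + \<bar>v\<bar> * h * (1 + 2 * real (n t))"
      by (simp add: algebra_simps)
  qed (use assms in auto)
  moreover have "Max (?S ` {..m}) \<le> (SUP s\<in>{0..t}. ?F s) + \<bar>v\<bar> * h * (1 + 2 * real (n t))"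
  proof (rule Max.boundedI)
    fix y assume "y \<in> ?S ` {..m}"
    then obtain k where k: "k \<le> m" "y = ?S k" by auto
    have "real k * h \<le> real m * h" using k assms by (intro mult_right_mono) auto
    then have "?F (real k * h) \<le> (SUP s\<in>{0..t}. ?F s)"
      using assms by (intro cSUP_upper bdd) auto
    moreover have "0 \<le> \<bar>v\<bar> * h" using assms by simp
    ultimately show "y \<le> (SUP s\<in>{0..t}. ?F s) + \<bar>v\<bar> * h * (1 + 2 * real (n t))"
      using err[OF k(1)] k(2) by (simp add: algebra_simps)
  qed auto
  ultimately show ?thesis by linarith
qed

lemma switching_max_limit:
  assumes "0 < t"
  shows "(\<lambda>m. Max ((\<lambda>k. \<Sum>i<k. t / real (Suc m) * g (real i * (t / real (Suc m)))) ` {..Suc m}))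
    \<longlonglongrightarrow> (SUP s\<in>{0..t}. integral {0..s} g)"
proof (rule LIMSEQ_I)
  fix r :: real assume "0 < r"
  have "(\<lambda>m. \<bar>v\<bar> * t * (1 + 2 * real (n t)) * inverse (real (Suc m))) \<longlonglongrightarrow> \<bar>v\<bar> * t * (1 + 2 * real (n t)) * 0"
    by (intro tendsto_mult tendsto_const LIMSEQ_inverse_real_of_nat)
  then have "eventually (\<lambda>m. \<bar>v\<bar> * t * (1 + 2 * real (n t)) * inverse (real (Suc m)) < r) sequentially"
    using \<open>0 < r\<close> by (intro order_tendstoD(2)) auto
  then obtain m0 where m0: "\<And>m. m \<ge> m0 \<Longrightarrow> \<bar>v\<bar> * t * (1 + 2 * real (n t)) * inverse (real (Suc m)) < r"
    by (auto simp: eventually_sequentially)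
  show "\<exists>m0. \<forall>m\<ge>m0. norm (Max ((\<lambda>k. \<Sum>i<k. t / real (Suc m) * g (real i * (t / real (Suc m)))) ` {..Suc m})
      - (SUP s\<in>{0..t}. integral {0..s} g)) < r"
  proof (intro exI[of _ m0] allI impI)
    fix m assume "m0 \<le> m"
    have "t = real (Suc m) * (t / real (Suc m))" by simp
    from switching_max_approx[OF _ this] m0[OF \<open>m0 \<le> m\<close>] assms
    show "norm (Max ((\<lambda>k. \<Sum>i<k. t / real (Suc m) * g (real i * (t / real (Suc m)))) ` {..Suc m})
      - (SUP s\<in>{0..t}. integral {0..s} g)) < r"
      by (simp add: abs_minus_commute divide_inverse mult_ac del: of_nat_Suc)
  qed
qed

end

section \<open>Differentiating Skellam expectations\<close>

text \<open>The mass at 0 and 1 determines the expansion, and two or more jumps are of order h^2.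
  The bounds are explicit and depend on \<open>G\<close> through \<open>K\<close> alone, so they
  hold uniformly in the parameters.\<close>

lemma poisson_expectation_taylor:
  assumes h: "0 < h" and G: "\<And>k. \<bar>G k\<bar> \<le> K"
  shows "\<bar>measure_pmf.expectation (poisson_pmf h) G - G 0\<bar> \<le> 2 * K * h"
    and "\<bar>measure_pmf.expectation (poisson_pmf h) G - (G 0 + h * (G 1 - G 0))\<bar> \<le> 4 * K * h\<^sup>2"
proof -
  let ?E = "measure_pmf.expectation (poisson_pmf h)"
  have K: "0 \<le> K" using order_trans[OF abs_ge_zero G] .
  have "\<bar>?E G - ?E (\<lambda>_. G 0)\<bar> \<le> 2 * K * measure_pmf.prob (poisson_pmf h) {1..}"
    by (rule expectation_pmf_diff_le) (auto simp: G not_le)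
  also have "\<dots> \<le> 2 * K * h"
    using K poisson_tail_ge_1[OF h] by (intro mult_left_mono) auto
  finally show "\<bar>?E G - G 0\<bar> \<le> 2 * K * h" by simp
  \<comment> \<open>\<open>H\<close> agrees with \<open>G\<close> at 0 and 1 and is constant from 1
    on, so its expectation involves only the mass e^(-h) at 0.\<close>
  define H where "H k = G 1 + (G 0 - G 1) * indicator {0::nat} k" for k
  have H: "?E H = G 1 + (G 0 - G 1) * exp (- h)"
    unfolding H_def using h integrable_pmf_bounded[of "indicator {0}" 1 "poisson_pmf h"]
    by (simp add: measure_pmf_single)
  have "\<bar>?E G - ?E H\<bar> \<le> 2 * K * measure_pmf.prob (poisson_pmf h) {2..}"
    by (rule expectation_pmf_diff_le) (auto simp: G H_def not_le less_2_cases_iff indicator_def)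
  also have "\<dots> \<le> 2 * K * h\<^sup>2"
    using K poisson_tail_ge_2[OF h] by (intro mult_left_mono) auto
  finally have 1: "\<bar>?E G - ?E H\<bar> \<le> 2 * K * h\<^sup>2" .
  have "\<bar>exp (- h) - 1 + h\<bar> \<le> h\<^sup>2"
  proof -
    have "1 - h \<le> exp (- h)" using exp_ge_add_one_self[of "-h"] by simp
    moreover have "exp (- h) * (1 + h) \<le> 1"
      using exp_ge_add_one_self[of h] by (simp add: exp_minus field_simps)
    then have "exp (- h) \<le> 1 / (1 + h)" using h by (simp add: field_simps)
    moreover have "1 / (1 + h) \<le> 1 - h + h\<^sup>2"
      using h by (simp add: field_simps power2_eq_square)
    ultimately show ?thesis by linarith
  qed
  moreover have "\<bar>G 0 - G 1\<bar> \<le> 2 * K" using G[of 0] G[of 1] by linarith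
  ultimately have "\<bar>(G 0 - G 1) * (exp (- h) - 1 + h)\<bar> \<le> 2 * K * h\<^sup>2"
    unfolding abs_mult using K by (intro mult_mono) auto
  moreover have "?E H - (G 0 + h * (G 1 - G 0)) = (G 0 - G 1) * (exp (- h) - 1 + h)"
    unfolding H by (simp add: algebra_simps)
  ultimately show "\<bar>?E G - (G 0 + h * (G 1 - G 0))\<bar> \<le> 4 * K * h\<^sup>2"
    using 1 by linarith
qed

text \<open>Raising \<open>a\<close> by \<open>h\<close> adds a Poisson number of unit jumps to D,
  so the derivative in \<open>a\<close> is the forward difference of \<open>f\<close>; raising
  \<open>b\<close> gives the backward one.\<close>

lemma skellam_taylor:
  assumes f: "\<And>k. \<bar>f k\<bar> \<le> K" and pos: "0 < a" "0 < b" "0 < h"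
  shows "\<bar>skellam_expectation f (a + h) b - skellam_expectation f a b\<bar> \<le> 2 * K * h"
    and "\<bar>skellam_expectation f a (b + h) - skellam_expectation f a b\<bar> \<le> 2 * K * h"
    and "\<bar>skellam_expectation f (a + h) b - (skellam_expectation f a b
      + h * (skellam_expectation (\<lambda>d. f (d + 1)) a b - skellam_expectation f a b))\<bar> \<le> 4 * K * h\<^sup>2"
    and "\<bar>skellam_expectation f a (b + h) - (skellam_expectation f a b
      + h * (skellam_expectation (\<lambda>d. f (d - 1)) a b - skellam_expectation f a b))\<bar> \<le> 4 * K * h\<^sup>2"
proof -
  have "\<bar>skellam_expectation (\<lambda>d. f (d + int k)) a b\<bar> \<le> K"
       "\<bar>skellam_expectation (\<lambda>d. f (d - int k)) a b\<bar> \<le> K" for k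
    by (auto intro!: skellam_expectation_abs_le f)
  note poisson_expectation_taylor[of h "\<lambda>k. skellam_expectation (\<lambda>d. f (d + int k)) a b" K, OF \<open>0 < h\<close> this(1)]
    poisson_expectation_taylor[of h "\<lambda>k. skellam_expectation (\<lambda>d. f (d - int k)) a b" K, OF \<open>0 < h\<close> this(2)]
  then show "\<bar>skellam_expectation f (a + h) b - skellam_expectation f a b\<bar> \<le> 2 * K * h"
    "\<bar>skellam_expectation f a (b + h) - skellam_expectation f a b\<bar> \<le> 2 * K * h"
    "\<bar>skellam_expectation f (a + h) b - (skellam_expectation f a b
      + h * (skellam_expectation (\<lambda>d. f (d + 1)) a b - skellam_expectation f a b))\<bar> \<le> 4 * K * h\<^sup>2"
    "\<bar>skellam_expectation f a (b + h) - (skellam_expectation f a b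
      + h * (skellam_expectation (\<lambda>d. f (d - 1)) a b - skellam_expectation f a b))\<bar> \<le> 4 * K * h\<^sup>2"
    using pos f by (simp_all add: skellam_expectation_shift_left[where K=K] skellam_expectation_shift_right[where K=K])
qed

text \<open>Poisson means can only be increased by adding variables, so estimates are available for
  positive increments alone. A negative increment is treated as a forward step from
  \<open>x - k\<close>, after which the Lipschitz bound on \<psi> moves the slope back to
  \<open>x\<close>.\<close>

lemma DERIV_of_quadratic_bound:
  fixes \<phi> \<psi> :: "real \<Rightarrow> real"
  assumes "x \<in> {l<..<u}" "0 \<le> C"
    and quad: "\<And>y h. l < y \<Longrightarrow> 0 < h \<Longrightarrow> y + h < u \<Longrightarrow> \<bar>\<phi> (y + h) - \<phi> y - h * \<psi> y\<bar> \<le> C * h\<^sup>2"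
    and lip: "\<And>y h. l < y \<Longrightarrow> 0 < h \<Longrightarrow> y + h < u \<Longrightarrow> \<bar>\<psi> (y + h) - \<psi> y\<bar> \<le> C * h"
  shows "DERIV \<phi> x :> \<psi> x"
proof -
  have both: "\<bar>\<phi> (x + h) - \<phi> x - h * \<psi> x\<bar> \<le> 2 * C * h\<^sup>2" if "l < x + h" "x + h < u" "h \<noteq> 0" for h
  proof (cases "0 < h")
    case True
    have "0 \<le> C * h\<^sup>2" using \<open>0 \<le> C\<close> by simp
    then show ?thesis using quad[of x h] True that assms(1) by simp
  next
    case False
    define k where "k = - h"
    have k: "0 < k" "l < x - k" "h = - k" using False that by (auto simp: k_def)
    have "\<bar>\<phi> x - \<phi> (x - k) - k * \<psi> (x - k)\<bar> \<le> C * k\<^sup>2" "\<bar>\<psi> x - \<psi> (x - k)\<bar> \<le> C * k"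
      using quad[of "x - k" k] lip[of "x - k" k] k assms(1) by auto
    moreover from this(2) have "\<bar>k * (\<psi> x - \<psi> (x - k))\<bar> \<le> k * (C * k)"
      unfolding abs_mult using k by (intro mult_mono) auto
    moreover have "\<phi> (x + h) - \<phi> x - h * \<psi> x
       = - (\<phi> x - \<phi> (x - k) - k * \<psi> (x - k)) + k * (\<psi> x - \<psi> (x - k))"
      unfolding k(3) by (simp add: algebra_simps)
    ultimately show ?thesis unfolding k(3) by (simp add: power2_eq_square algebra_simps)
  qed
  have "((\<lambda>h. (\<phi> (x + h) - \<phi> x) / h - \<psi> x) \<longlongrightarrow> 0) (at 0)"
  proof (rule Lim_null_comparison)
    have "eventually (\<lambda>h. l < x + h) (at 0)" "eventually (\<lambda>h. x + h < u) (at 0)"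
      using assms(1) by (auto intro!: order_tendstoD tendsto_eq_intros)
    then have "eventually (\<lambda>h. l < x + h \<and> x + h < u \<and> h \<noteq> 0) (at 0)"
      by (intro eventually_conj) (auto simp: eventually_at_filter)
    then show "eventually (\<lambda>h. norm ((\<phi> (x + h) - \<phi> x) / h - \<psi> x) \<le> 2 * C * \<bar>h\<bar>) (at 0)"
    proof eventually_elim
      case (elim h)
      have "(\<phi> (x + h) - \<phi> x) / h - \<psi> x = (\<phi> (x + h) - \<phi> x - h * \<psi> x) / h"
        using elim by (simp add: field_simps)
      also have "\<bar>\<dots>\<bar> \<le> 2 * C * h\<^sup>2 / \<bar>h\<bar>"
        unfolding abs_divide using both[of h] elim by (intro divide_right_mono) auto
      also have "\<dots> = 2 * C * \<bar>h\<bar>" using elim by (simp add: power2_eq_square abs_if field_simps)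
      finally show ?case by simp
    qed
    show "((\<lambda>h. 2 * C * \<bar>h\<bar>) \<longlongrightarrow> 0) (at 0)"
      by (auto intro!: tendsto_eq_intros)
  qed
  then have "((\<lambda>h. (\<phi> (x + h) - \<phi> x) / h) \<longlongrightarrow> \<psi> x) (at 0)"
    by (simp add: LIM_zero_iff)
  then show ?thesis by (simp add: DERIV_def)
qed

text \<open>The derivative is the one in the first parameter minus the one in the second; the terms
  in \<open>f\<close> itself cancel.\<close>

lemma skellam_expectation_DERIV:
  assumes f: "\<And>k. \<bar>f k\<bar> \<le> K" and "z \<in> {- s<..<s}"
  shows "DERIV (\<lambda>z. skellam_expectation f (s + z) (s - z)) z :>
    skellam_expectation (\<lambda>d. f (d + 1)) (s + z) (s - z) - skellam_expectation (\<lambda>d. f (d - 1)) (s + z) (s - z)"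
proof (rule DERIV_of_quadratic_bound[OF assms(2), of "12 * K"])
  have K: "0 \<le> K" using order_trans[OF abs_ge_zero f] .
  then show "0 \<le> 12 * K" by simp
  have lip: "\<bar>skellam_expectation g (s + (y + h)) (s - (y + h)) - skellam_expectation g (s + y) (s - y)\<bar> \<le> 4 * K * h"
    if "- s < y" "0 < h" "y + h < s" and g: "\<And>k. \<bar>g k\<bar> \<le> K" for y h g
    using skellam_taylor(1)[of g K "s + y" "s - (y + h)" h] skellam_taylor(2)[of g K "s + y" "s - (y + h)" h] that
    by (simp add: add.assoc)
  fix y h assume yh: "- s < y" "0 < h" "y + h < s"
  show "\<bar>skellam_expectation (\<lambda>d. f (d + 1)) (s + (y + h)) (s - (y + h)) - skellam_expectation (\<lambda>d. f (d - 1)) (s + (y + h)) (s - (y + h))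
     - (skellam_expectation (\<lambda>d. f (d + 1)) (s + y) (s - y) - skellam_expectation (\<lambda>d. f (d - 1)) (s + y) (s - y))\<bar> \<le> 12 * K * h"
    using lip[OF yh f, of "\<lambda>d. d + 1"] lip[OF yh f, of "\<lambda>d. d - 1"] K mult_nonneg_nonneg[of K h] yh(2) by linarith
  \<comment> \<open>From this corner both endpoints are reached by increasing a single parameter by
    \<open>h\<close>. The constant 12 collects two expansion errors of
    \<open>4 * K * h\<^sup>2\<close> and another \<open>4 * K * h\<^sup>2\<close> for moving the
    slope to the corner.\<close>
  let ?a = "s + y" and ?b = "s - (y + h)"
  let ?E = "\<lambda>g. skellam_expectation g ?a ?b"
  have ab: "0 < ?a" "0 < ?b" "s + (y + h) = ?a + h" "s - y = ?b + h" using yh by auto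
  have "\<bar>skellam_expectation f (?a + h) ?b - (?E f + h * (?E (\<lambda>d. f (d + 1)) - ?E f))\<bar> \<le> 4 * K * h\<^sup>2"
    "\<bar>skellam_expectation f ?a (?b + h) - (?E f + h * (?E (\<lambda>d. f (d - 1)) - ?E f))\<bar> \<le> 4 * K * h\<^sup>2"
    by (intro skellam_taylor ab f yh)+
  moreover have "\<bar>skellam_expectation (\<lambda>d. f (d + 1)) ?a (?b + h) - ?E (\<lambda>d. f (d + 1))\<bar> \<le> 2 * K * h"
    "\<bar>skellam_expectation (\<lambda>d. f (d - 1)) ?a (?b + h) - ?E (\<lambda>d. f (d - 1))\<bar> \<le> 2 * K * h"
    by (intro skellam_taylor ab f yh)+
  then have "\<bar>h * ((skellam_expectation (\<lambda>d. f (d + 1)) ?a (?b + h) - ?E (\<lambda>d. f (d + 1)))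
      - (skellam_expectation (\<lambda>d. f (d - 1)) ?a (?b + h) - ?E (\<lambda>d. f (d - 1))))\<bar> \<le> h * (4 * K * h)"
    unfolding abs_mult using yh by (intro mult_mono) auto
  ultimately show "\<bar>skellam_expectation f (s + (y + h)) (s - (y + h)) - skellam_expectation f (s + y) (s - y)
     - h * (skellam_expectation (\<lambda>d. f (d + 1)) (s + y) (s - y) - skellam_expectation (\<lambda>d. f (d - 1)) (s + y) (s - y))\<bar>
     \<le> 12 * K * h\<^sup>2"
    unfolding ab(3,4) by (simp add: algebra_simps power2_eq_square)
qed

section \<open>Bessel series and the closed forms of the density and the atom\<close>

definition bessel_series :: "nat \<Rightarrow> real \<Rightarrow> real" where
  "bessel_series k z = (\<Sum>j. z ^ j / (fact j * fact (j + k)))"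

lemma summable_bessel_series: "summable (\<lambda>j. z ^ j / (fact j * fact (j + k)) :: real)"
proof (rule summable_comparison_test'[of "\<lambda>j. \<bar>z\<bar> ^ j / fact j" 0])
  show "summable (\<lambda>j. \<bar>z\<bar> ^ j / fact j)"
    using summable_exp[of "\<bar>z\<bar>"] by (simp add: field_simps)
  fix j
  have "\<bar>z\<bar> ^ j / (fact j * fact (j + k)) \<le> \<bar>z\<bar> ^ j / (fact j * 1)"
    by (intro divide_left_mono mult_left_mono fact_ge_1) auto
  then show "norm (z ^ j / (fact j * fact (j + k))) \<le> \<bar>z\<bar> ^ j / fact j"
    by (simp add: power_abs)
qed

lemma bessel_I_eq_series:
  assumes "0 \<le> z"
  shows "bessel_I k (2 * sqrt z) = sqrt z ^ k * bessel_series k z"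
proof -
  have *: "(2 * sqrt z / 2) ^ (2 * j + k) / (fact j * Gamma (real j + real k + 1))
      = sqrt z ^ k * (z ^ j / (fact j * fact (j + k)))" for j
  proof -
    have "Gamma (real j + real k + 1) = fact (j + k)"
      using Gamma_fact[of "j + k", where 'a=real] by (simp add: add_ac)
    then show ?thesis using assms by (simp add: power_add power_mult)
  qed
  show ?thesis
    unfolding bessel_I_def bessel_series_def * by (rule suminf_mult[OF summable_bessel_series])
qed

text \<open>This is the recurrence for I_2 freed of square roots. After an index shift the
  coefficients on the right are 1/(j! (j+1)!) and j/(j! (j+1)!), with sum 1/(j! j!).\<close>

lemma bessel_series_recurrence: "bessel_series 0 z = bessel_series 1 z + z * bessel_series 2 z"
proof -
  let ?g = "\<lambda>j. if j = 0 then 0 else z ^ j / (fact (j - 1) * fact (j + 1))"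
  have Suc: "?g (Suc j) = z * (z ^ j / (fact j * fact (j + 2)))" for j by simp
  have "summable (\<lambda>j. ?g (Suc j))"
    unfolding Suc by (intro summable_mult summable_bessel_series)
  then have g: "summable ?g" by (subst (asm) summable_Suc_iff)
  have "z * bessel_series 2 z = (\<Sum>j. ?g (Suc j))"
    unfolding Suc bessel_series_def by (rule suminf_mult[OF summable_bessel_series, symmetric])
  also have "\<dots> = suminf ?g"
    using suminf_split_head[OF g] by simp
  finally have "bessel_series 1 z + z * bessel_series 2 z = bessel_series 1 z + suminf ?g" by (rule arg_cong)
  also have "\<dots> = (\<Sum>j. z ^ j / (fact j * fact (j + 1)) + ?g j)"
    unfolding bessel_series_def by (rule suminf_add[OF summable_bessel_series g])
  also have "\<dots> = bessel_series 0 z"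
    unfolding bessel_series_def
  proof (rule suminf_cong)
    fix j
    show "z ^ j / (fact j * fact (j + 1)) + ?g j = z ^ j / (fact j * fact (j + 0))"
    proof (cases j)
      case (Suc i)
      have "fact (i + 2) = (real i + 2) * ((real i + 1) * fact i)" "fact (i + 1) = (real i + 1) * (fact i :: real)"
        by (simp_all add: algebra_simps)
      moreover have "real i + 1 \<noteq> 0" "real i + 2 \<noteq> 0" "fact i \<noteq> (0::real)" by (simp_all add: add_nonneg_eq_0_iff)
      moreover have "j = i + 1" "j + 1 = i + 2" "j - 1 = i" "j \<noteq> 0" "j + 0 = i + 1" using Suc by auto
      ultimately show ?thesis by (simp add: divide_simps) (simp add: algebra_simps)
    qed simp
  qed
  finally show ?thesis ..
qed

text \<open>D = -k means X = i and Y = i + k for some i; summing the products of the two masses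
  produces the series.\<close>

lemma skellam_point_mass:
  assumes "0 < a" "0 < b"
  shows "skellam_expectation (indicator {- int k}) a b = exp (- (a + b)) * b ^ k * bessel_series k (a * b)"
proof -
  have "skellam_expectation (indicator {- int k}) a b =
     measure_pmf.expectation (poisson_pmf a) (\<lambda>i. measure_pmf.expectation (poisson_pmf b) (\<lambda>j. indicator {- int k} (int i - int j)))"
    unfolding skellam_expectation_def by (subst expectation_pair_pmf[where K=1]) (auto simp: indicator_def)
  also have "(\<lambda>i j. indicator {- int k} (int i - int j) :: real) = (\<lambda>i. indicator {i + k})"
    by (auto simp: indicator_def fun_eq_iff)
  also have "measure_pmf.expectation (poisson_pmf a) (\<lambda>i. measure_pmf.expectation (poisson_pmf b) (indicator {i + k}))
      = (\<Sum>i. pmf (poisson_pmf a) i * pmf (poisson_pmf b) (i + k))"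
    by (subst sums_unique[OF expectation_nat_pmf_sums[where K=1]]) (auto simp: measure_pmf_single pmf_le_1 simp del: pmf_poisson)
  also have "\<dots> = (\<Sum>i. exp (- (a + b)) * b ^ k * ((a * b) ^ i / (fact i * fact (i + k))))"
    using assms by (simp add: power_add power_mult_distrib exp_add exp_minus exp_diff field_simps)
  also have "\<dots> = exp (- (a + b)) * b ^ k * bessel_series k (a * b)"
    unfolding bessel_series_def by (rule suminf_mult[OF summable_bessel_series])
  finally show ?thesis .
qed

text \<open>The difference sgn(d + 2) - sgn(d) equals 1, 2, 1 at d = 0, -1, -2 and vanishes
  elsewhere. The factor \<open>b\<^sup>2\<close> of the third mass is written as
  \<open>b / a * (a * b)\<close> so that the recurrence can eliminate the series of order 2.\<close>

lemma skellam_density: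
  assumes "0 < a" "0 < b"
  shows "skellam_expectation (\<lambda>d. level_sign False (d + 1)) a b - skellam_expectation (\<lambda>d. level_sign False (d - 1)) a b
    = exp (- (a + b)) * ((1 + b / a) * bessel_series 0 (a * b) + (2 * b - b / a) * bessel_series 1 (a * b))"
proof -
  let ?i = "\<lambda>k. indicator {- int k} :: int \<Rightarrow> real"
  have bd: "\<bar>?i k d\<bar> \<le> 1" "\<bar>2 * ?i k d\<bar> \<le> 2" "\<bar>- 2 * ?i k d\<bar> \<le> 2" for k d by (auto simp: indicator_def)
  have int: "integrable (measure_pmf p) (\<lambda>(i, j). ?i k (int i - int j))" for p k
    by (rule integrable_pmf_bounded[where K=1]) (auto simp: indicator_def)
  have eq: "(\<lambda>d. level_sign False (d + 1) - level_sign False (d - 1)) = (\<lambda>d. ?i 0 d + 2 * ?i 1 d + ?i 2 d)"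
  proof
    fix d :: int
    consider "d > 0" | "d = 0" | "d = -1" | "d = -2" | "d < -2" by linarith
    then show "level_sign False (d + 1) - level_sign False (d - 1) = ?i 0 d + 2 * ?i 1 d + ?i 2 d"
      by cases (auto simp: level_sign_def indicator_def sgn_if)
  qed
  have "skellam_expectation (\<lambda>d. level_sign False (d + 1)) a b - skellam_expectation (\<lambda>d. level_sign False (d - 1)) a b
    = skellam_expectation (\<lambda>d. ?i 0 d + 2 * ?i 1 d + ?i 2 d) a b"
    unfolding eq[symmetric] by (rule skellam_expectation_diff[where K=1, symmetric]) (rule level_sign_abs_le)+
  also have "\<dots> = skellam_expectation (?i 0) a b + 2 * skellam_expectation (?i 1) a b + skellam_expectation (?i 2) a b"
    using int[of _ 0] int[of _ 1] int[of _ 2] unfolding skellam_expectation_def case_prod_unfold by simp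
  also have "\<dots> = exp (- (a + b)) * (bessel_series 0 (a * b) + 2 * b * bessel_series 1 (a * b) + b\<^sup>2 * bessel_series 2 (a * b))"
    unfolding skellam_point_mass[OF assms] by (simp add: algebra_simps)
  also have "b\<^sup>2 * bessel_series 2 (a * b) = b / a * (a * b * bessel_series 2 (a * b))"
    using assms by (simp add: power2_eq_square)
  also have "a * b * bessel_series 2 (a * b) = bessel_series 0 (a * b) - bessel_series 1 (a * b)"
    using bessel_series_recurrence[of "a * b"] by simp
  finally show ?thesis by (simp add: algebra_simps)
qed

text \<open>For equal means the expectation of sgn D is 0 and can be subtracted; sgn(d + 1) - sgn(d)
  is the indicator of d = 0 and d = -1.\<close>

lemma skellam_atom:
  assumes "0 < s"
  shows "skellam_expectation (level_sign False) s s = exp (- 2 * s) * (bessel_I 0 (2 * s) + bessel_I 1 (2 * s))"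
proof -
  let ?i = "\<lambda>k. indicator {- int k} :: int \<Rightarrow> real"
  have int: "integrable (measure_pmf p) (\<lambda>(i, j). ?i k (int i - int j))" for p k
    by (rule integrable_pmf_bounded[where K=1]) (auto simp: indicator_def)
  have eq: "(\<lambda>d. level_sign False d - level_sign True d) = (\<lambda>d. ?i 0 d + ?i 1 d)"
  proof
    fix d :: int
    consider "d > 0" | "d = 0" | "d = -1" | "d < -1" by linarith
    then show "level_sign False d - level_sign True d = ?i 0 d + ?i 1 d"
      by cases (auto simp: level_sign_def indicator_def sgn_if)
  qed
  have "skellam_expectation (level_sign False) s s - skellam_expectation (level_sign True) s s = skellam_expectation (\<lambda>d. ?i 0 d + ?i 1 d) s s"
    unfolding eq[symmetric] by (rule skellam_expectation_diff[where K=1, symmetric]) (rule level_sign_abs_le)+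
  also have "\<dots> = skellam_expectation (?i 0) s s + skellam_expectation (?i 1) s s"
    using int[of _ 0] int[of _ 1] unfolding skellam_expectation_def case_prod_unfold by simp
  also have "\<dots> = exp (- (s + s)) * (bessel_series 0 (s * s) + s * bessel_series 1 (s * s))"
    unfolding skellam_point_mass[OF assms assms] by (simp add: algebra_simps)
  also have "bessel_series 0 (s * s) + s * bessel_series 1 (s * s) = bessel_I 0 (2 * s) + bessel_I 1 (2 * s)"
    using bessel_I_eq_series[of "s * s" 0] bessel_I_eq_series[of "s * s" 1] assms by simp
  finally show ?thesis by (simp add: skellam_expectation_antisym)
qed

lemma max_density_eq:
  assumes "0 < c" "0 < rate" and x: "- (c * t) < x" "x < c * t"
  defines "s \<equiv> rate * t / 2" and "k \<equiv> rate / (2 * c)"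
  shows "max_density c rate t x = k *
    (skellam_expectation (\<lambda>d. level_sign False (d + 1)) (s + k * x) (s - k * x)
      - skellam_expectation (\<lambda>d. level_sign False (d - 1)) (s + k * x) (s - k * x))"
proof -
  define a b where "a = s + k * x" and "b = s - k * x"
  have a: "a = k * (c * t + x)" and b: "b = k * (c * t - x)"
    using assms by (simp_all add: a_def b_def s_def k_def field_simps)
  have pos: "0 < k" "0 < c * t + x" "0 < c * t - x" using assms by (auto simp: k_def)
  then have ab: "0 < a" "0 < b" by (simp_all add: a b)
  have sqrt_ab: "sqrt (a * b) = k * sqrt (c\<^sup>2 * t\<^sup>2 - x\<^sup>2)"
  proof -
    have "a * b = k\<^sup>2 * (c\<^sup>2 * t\<^sup>2 - x\<^sup>2)" by (simp add: a b power2_eq_square algebra_simps)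
    then show ?thesis using pos by (simp add: real_sqrt_mult)
  qed
  have arg: "rate / c * sqrt (c\<^sup>2 * t\<^sup>2 - x\<^sup>2) = 2 * sqrt (a * b)"
    unfolding sqrt_ab k_def by simp
  have I0: "bessel_I 0 (2 * sqrt (a * b)) = bessel_series 0 (a * b)"
    and I1: "bessel_I 1 (2 * sqrt (a * b)) = sqrt (a * b) * bessel_series 1 (a * b)"
    using ab by (simp_all add: bessel_I_eq_series)
  have root: "sqrt ((c * t - x) / (c * t + x)) * sqrt (a * b) = b"
  proof -
    have "(c * t - x) / (c * t + x) = b / a" using pos by (simp add: a b)
    then have "sqrt ((c * t - x) / (c * t + x)) * sqrt (a * b) = sqrt (b / a * (a * b))"
      by (simp add: real_sqrt_mult[symmetric])
    also have "b / a * (a * b) = b\<^sup>2" using ab by (simp add: power2_eq_square)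
    finally show ?thesis using ab by simp
  qed
  have "max_density c rate t x = exp (- rate * t) *
     (rate * t / (c * t + x) * bessel_series 0 (a * b)
      + (sqrt ((c * t - x) / (c * t + x)) * sqrt (a * b)) * (rate / c - 1 / (c * t + x)) * bessel_series 1 (a * b))"
    unfolding max_density_def arg I0 I1 by (simp add: mult_ac)
  also have "\<dots> = exp (- rate * t) * (rate * t / (c * t + x) * bessel_series 0 (a * b)
      + b * (2 * k - 1 / (c * t + x)) * bessel_series 1 (a * b))"
    unfolding root by (simp add: k_def)
  also have "rate * t / (c * t + x) = k * (1 + b / a)"
  proof -
    have "b / a = (c * t - x) / (c * t + x)" using pos by (simp add: a b)
    also have "1 + \<dots> = 2 * c * t / (c * t + x)" using pos by (simp add: field_simps)
    finally show ?thesis using assms by (simp add: k_def)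
  qed
  also have "b * (2 * k - 1 / (c * t + x)) = k * (2 * b - b / a)"
  proof -
    have "k * (b / a) = b / (c * t + x)" using pos by (simp add: a)
    then show ?thesis by (simp add: algebra_simps)
  qed
  also have "exp (- rate * t) = exp (- (a + b))" by (simp add: a_def b_def s_def)
  finally show ?thesis
    unfolding a_def[symmetric] b_def[symmetric] skellam_density[OF ab] by (simp add: algebra_simps)
qed

lemma skellam_cdf_DERIV:
  assumes "0 < c" "0 < rate" and x: "- (c * t) < x" "x < c * t"
  defines "s \<equiv> rate * t / 2" and "k \<equiv> rate / (2 * c)"
  shows "DERIV (\<lambda>x. skellam_expectation (level_sign p) (s + k * x) (s - k * x)) x :>
    (skellam_expectation (\<lambda>d. level_sign p (d + 1)) (s + k * x) (s - k * x)
      - skellam_expectation (\<lambda>d. level_sign p (d - 1)) (s + k * x) (s - k * x)) * k"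
proof (rule DERIV_chain2[where g="\<lambda>x. k * x" and f="\<lambda>z. skellam_expectation (level_sign p) (s + z) (s - z)"])
  have "s = k * (c * t)" "0 < k" using assms by (simp_all add: s_def k_def)
  then have "- s < k * x" "k * x < s"
    using mult_strict_left_mono[OF x(1), of k] mult_strict_left_mono[OF x(2), of k] by simp_all
  then show "DERIV (\<lambda>z. skellam_expectation (level_sign p) (s + z) (s - z)) (k * x) :>
    skellam_expectation (\<lambda>d. level_sign p (d + 1)) (s + k * x) (s - k * x)
      - skellam_expectation (\<lambda>d. level_sign p (d - 1)) (s + k * x) (s - k * x)"
    by (intro skellam_expectation_DERIV[where K=1] level_sign_abs_le) auto
qed (auto intro!: derivative_eq_intros)

section \<open>From the grid maxima to the maximum of the telegraph process\<close>

context telegraph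
begin

abbreviation max_T :: "real \<Rightarrow> 'a \<Rightarrow> real" where
  "max_T t \<equiv> running_max (telegraph_process V N) t"

definition grid_max :: "real \<Rightarrow> nat \<Rightarrow> 'a \<Rightarrow> real" where
  "grid_max t m \<omega> = Max ((\<lambda>k. \<Sum>i<k. t / real (Suc m) *
     (V \<omega> * (- 1) ^ N (real i * (t / real (Suc m))) \<omega>)) ` {..Suc m})"

lemma grid_max_measurable:
  assumes "0 < t" shows "grid_max t m \<in> borel_measurable M"
proof -
  have [measurable]: "N (real i * (t / real (Suc m))) \<in> measurable M (count_space UNIV)" for i
    using assms by (intro N_measurable) auto
  note V_measurable[measurable]
  show ?thesis unfolding grid_max_def by measurable
qed

lemma grid_max_limit:
  assumes "0 < t" "\<omega> \<in> space M"
  shows "(\<lambda>m. grid_max t m \<omega>) \<longlonglongrightarrow> max_T t \<omega>"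
  using switching_max_limit[of "\<lambda>u. N u \<omega>" t "V \<omega>"] assms N_le
  by (simp only: grid_max_def running_max_def telegraph_process_def)

lemma max_T_measurable:
  assumes "0 < t" shows "max_T t \<in> borel_measurable M"
  using grid_max_limit[OF assms] grid_max_measurable[OF assms]
  by (rule borel_measurable_LIMSEQ_real)

lemma max_T_nonneg:
  assumes "0 < t" "\<omega> \<in> space M"
  shows "0 \<le> max_T t \<omega>"
proof (rule LIMSEQ_le_const[OF grid_max_limit[OF assms]])
  have "0 \<le> grid_max t m \<omega>" for m
    unfolding grid_max_def by (intro Max_ge) (auto intro!: image_eqI[of _ _ 0])
  then show "\<exists>m0. \<forall>m\<ge>m0. 0 \<le> grid_max t m \<omega>" by blast
qed

lemma prob_grid_max_limit:
  assumes "0 < t" "0 \<le> x"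
  shows "(\<lambda>m. prob {\<omega> \<in> space M. V \<omega> = vel p * c \<and> grid_max t m \<omega> \<le> x})
    \<longlonglongrightarrow> 1 / 2 * skellam_cdf p (rate * t / 2 + rate / (2 * c) * x) (rate * t / 2 - rate / (2 * c) * x)"
proof -
  define h where "h m = t / real (Suc m)" for m
  define q where "q m = measure_pmf.prob (poisson_pmf (rate * h m)) {k. odd k}" for m
  have h: "0 < h m" "real (Suc m) * h m = t" for m using assms by (simp_all add: h_def)
  have eq: "prob {\<omega> \<in> space M. V \<omega> = vel p * c \<and> grid_max t m \<omega> \<le> x}
     = 1 / 2 * chain_prob (rate * h m) (q m) (Suc m) (rate * x / c) p" for m
    unfolding prob_discrete_max[OF h(1) zero_less_Suc q_def, symmetric]
    by (intro arg_cong[where f=prob]) (auto simp: grid_max_def h_def)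
  let ?U = "skellam_cdf p (rate * t / 2 + rate / (2 * c) * x) (rate * t / 2 - rate / (2 * c) * x)"
  have "(\<lambda>m. chain_prob (rate * h m) (q m) (Suc m) (rate * x / c) p) \<longlonglongrightarrow> ?U"
  proof (rule LIMSEQ_I)
    fix r :: real assume "0 < r"
    \<comment> \<open>The bound of \<open>chain_prob_approx\<close> with \<open>Suc m\<close> steps
      of length \<open>rate * t / Suc m\<close> equals \<open>?C / Suc m\<close>.\<close>
    let ?C = "2 * (rate * t) * (rate * t) + 2 * (rate * t)"
    have "(\<lambda>m. ?C * inverse (real (Suc m))) \<longlonglongrightarrow> ?C * 0"
      by (intro tendsto_mult tendsto_const LIMSEQ_inverse_real_of_nat)
    then have "eventually (\<lambda>m. ?C * inverse (real (Suc m)) < r) sequentially"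
      using \<open>0 < r\<close> by (intro order_tendstoD(2)) auto
    then obtain m0 where m0: "\<And>m. m \<ge> m0 \<Longrightarrow> ?C * inverse (real (Suc m)) < r"
      by (auto simp: eventually_sequentially)
    have "norm (chain_prob (rate * h m) (q m) (Suc m) (rate * x / c) p - ?U) < r" if "m0 \<le> m" for m
    proof -
      have args: "(real (Suc m) * (rate * h m) + rate * x / c) / 2 = rate * t / 2 + rate / (2 * c) * x"
        "(real (Suc m) * (rate * h m) - rate * x / c) / 2 = rate * t / 2 - rate / (2 * c) * x"
        using h(2)[of m] by (simp_all add: field_simps del: of_nat_Suc)
      have "\<bar>chain_prob (rate * h m) (q m) (Suc m) (rate * x / c) p - ?U\<bar>
          \<le> 2 * real (Suc m) * (rate * h m)\<^sup>2 + 2 * (rate * h m)"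
        using chain_prob_approx[OF _ q_def, of m "rate * x / c" "Suc m" p] h rate_pos speed_pos assms
        unfolding args by simp
      also have "2 * real (Suc m) * (rate * h m)\<^sup>2 + 2 * (rate * h m) = ?C * inverse (real (Suc m))"
        by (simp add: h_def power2_eq_square field_simps del: of_nat_Suc)
      finally show ?thesis using m0[OF that] by simp
    qed
    then show "\<exists>m0. \<forall>m\<ge>m0. norm (chain_prob (rate * h m) (q m) (Suc m) (rate * x / c) p - ?U) < r" by blast
  qed
  then show ?thesis unfolding eq by (intro tendsto_mult tendsto_const)
qed

lemma V_pred: "Measurable.pred M (\<lambda>\<omega>. V \<omega> = vel p * c)"
  using V_measurable by measurable

text \<open>Convergence of the grid maxima identifies the distribution function where the candidate
  is continuous. For \<open>p = True\<close> the candidate jumps at \<open>c * t\<close>, the value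
  reached by a path without flips, hence the restriction to the open interval.\<close>

lemma prob_max_T:
  assumes "0 < t" "0 < x" "x < c * t"
  shows "prob {\<omega> \<in> space M. V \<omega> = vel p * c \<and> max_T t \<omega> \<le> x} =
    1 / 2 * skellam_expectation (level_sign p) (rate * t / 2 + rate / (2 * c) * x) (rate * t / 2 - rate / (2 * c) * x)"
proof -
  let ?s = "rate * t / 2" and ?k = "rate / (2 * c)"
  let ?U = "\<lambda>x. 1 / 2 * skellam_cdf p (?s + ?k * x) (?s - ?k * x)"
  have lt: "?k * y < ?s \<longleftrightarrow> y < c * t" for y
    using rate_pos speed_pos by (simp add: field_simps)
  have "isCont (\<lambda>x. skellam_expectation (level_sign p) (?s + ?k * x) (?s - ?k * x)) x"
    using assms by (intro DERIV_isCont[OF skellam_cdf_DERIV[OF speed_pos rate_pos]]) auto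
  moreover have "eventually (\<lambda>y. skellam_expectation (level_sign p) (?s + ?k * y) (?s - ?k * y) = skellam_cdf p (?s + ?k * y) (?s - ?k * y)) (nhds x)"
  proof (rule eventually_mono[OF eventually_nhds_in_open[of "{0<..<c * t}" x]])
    fix y assume "y \<in> {0<..<c * t}"
    then have "?k * y < ?s" using lt[of y] by simp
    then show "skellam_expectation (level_sign p) (?s + ?k * y) (?s - ?k * y) = skellam_cdf p (?s + ?k * y) (?s - ?k * y)"
      by (simp add: skellam_cdf_def)
  qed (use assms in auto)
  ultimately have "isCont (\<lambda>x. skellam_cdf p (?s + ?k * x) (?s - ?k * x)) x"
    by (subst (asm) isCont_cong)
  then have "isCont ?U x" by (intro continuous_intros)
  have "prob {\<omega> \<in> space M. V \<omega> = vel p * c \<and> max_T t \<omega> \<le> x} = ?U x"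
    by (rule prob_le_eq_limit[where U="?U" and l=0, OF max_T_measurable grid_max_measurable V_pred grid_max_limit
       prob_grid_max_limit \<open>0 < x\<close> \<open>isCont ?U x\<close>]) (use assms in auto)
  also have "\<dots> = 1 / 2 * skellam_expectation (level_sign p) (?s + ?k * x) (?s - ?k * x)"
    using lt[of x] assms by (simp add: skellam_cdf_def)
  finally show ?thesis .
qed

end

section \<open>The law of the maximum\<close>

lemma bessel_I_measurable [measurable]: "bessel_I n \<in> borel_measurable borel"
  unfolding bessel_I_def
  by (intro borel_measurable_suminf borel_measurable_divide borel_measurable_power borel_measurable_const measurable_ident_sets[OF refl])

lemma max_density_measurable [measurable]: "max_density c rate t \<in> borel_measurable borel"
  unfolding max_density_def by measurable

text \<open>The closed form does not show its sign, since \<open>rate / c - 1 / (c * t + x)\<close>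
  can be negative. As an expected increment of a nondecreasing function of D it is
  nonnegative.\<close>

lemma max_density_nonneg:
  assumes "0 < c" "0 < rate" "- (c * t) < x" "x < c * t"
  shows "0 \<le> max_density c rate t x"
proof -
  have "level_sign False (d + 1) - level_sign False (d - 1) \<ge> 0" for d
    by (auto simp: level_sign_def sgn_if)
  then have "0 \<le> skellam_expectation (\<lambda>d. level_sign False (d + 1) - level_sign False (d - 1)) a b" for a b
    unfolding skellam_expectation_def by (intro Bochner_Integration.integral_nonneg) (simp add: case_prod_unfold)
  then have "0 \<le> skellam_expectation (\<lambda>d. level_sign False (d + 1)) a b - skellam_expectation (\<lambda>d. level_sign False (d - 1)) a b" for a b
    by (subst (asm) skellam_expectation_diff[where K=1]) (auto intro: level_sign_abs_le)
  then show ?thesis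
    unfolding max_density_eq[OF assms] using assms by (intro mult_nonneg_nonneg) auto
qed

text \<open>The fundamental theorem of calculus gives the closed interval; removing the Lebesgue
  null point 0 leaves the half-open one, which matches a difference of distribution functions and
  excludes the atom.\<close>

lemma nn_integral_max_density:
  assumes "0 < c" "0 < rate" "0 \<le> x" "x < c * t"
  shows "(\<integral>\<^sup>+y. ennreal (max_density c rate t y) * indicator {0<..x} y \<partial>lborel) =
    ennreal (skellam_expectation (level_sign False) (rate * t / 2 + rate / (2 * c) * x) (rate * t / 2 - rate / (2 * c) * x)
      - skellam_expectation (level_sign False) (rate * t / 2) (rate * t / 2))"
proof -
  let ?F = "\<lambda>x. skellam_expectation (level_sign False) (rate * t / 2 + rate / (2 * c) * x) (rate * t / 2 - rate / (2 * c) * x)"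
  have "0 < c * t" using assms by linarith
  have "(\<integral>\<^sup>+y. ennreal (max_density c rate t y) * indicator {0..x} y \<partial>lborel) = ennreal (?F x - ?F 0)"
  proof (rule nn_integral_FTC_Icc)
    fix y assume "y \<in> {0..x}"
    then have y: "0 \<le> y" "y \<le> x" by auto
    have *: "- (c * t) < y" "y < c * t" using y assms \<open>0 < c * t\<close> by linarith+
    show "DERIV ?F y :> max_density c rate t y"
      using skellam_cdf_DERIV[OF assms(1,2) *, of False] unfolding max_density_eq[OF assms(1,2) *]
      by (simp only: mult.commute)
    show "0 \<le> max_density c rate t y" by (rule max_density_nonneg[OF assms(1,2) *])
  qed (use assms in auto)
  also have "(\<integral>\<^sup>+y. ennreal (max_density c rate t y) * indicator {0..x} y \<partial>lborel)
     = (\<integral>\<^sup>+y. ennreal (max_density c rate t y) * indicator {0<..x} y \<partial>lborel)"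
  proof (rule nn_integral_cong_AE)
    show "AE y in lborel. ennreal (max_density c rate t y) * indicator {0..x} y = ennreal (max_density c rate t y) * indicator {0<..x} y"
      using AE_lborel_singleton[of 0] by eventually_elim (simp add: indicator_def)
  qed
  finally show ?thesis by simp
qed

context telegraph
begin

abbreviation max_law :: "bool \<Rightarrow> real \<Rightarrow> real measure" where
  "max_law p t \<equiv> cond_law M (\<lambda>\<omega>. V \<omega> = vel p * c) (max_T t)"

lemma velocity_event:
  "{\<omega> \<in> space M. V \<omega> = vel p * c} \<in> events" "emeasure M {\<omega> \<in> space M. V \<omega> = vel p * c} \<noteq> 0"
  using V_pred[of p] prob_V[of p] by (auto simp: emeasure_eq_measure)

lemma real_distribution_max_law:
  assumes "0 < t" shows "real_distribution (max_law p t)"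
proof -
  interpret U: prob_space "uniform_measure M {\<omega> \<in> space M. V \<omega> = vel p * c}"
    by (rule prob_space_uniform_measure) (use velocity_event in auto)
  show ?thesis
    unfolding cond_law_def using max_T_measurable[OF assms] by (intro U.real_distribution_distr) simp
qed

lemma measure_max_law:
  assumes "0 < t" "A \<in> sets borel"
  shows "measure (max_law p t) A = 2 * prob {\<omega> \<in> space M. V \<omega> = vel p * c \<and> max_T t \<omega> \<in> A}"
proof -
  have "measure (max_law p t) A = measure (uniform_measure M {\<omega> \<in> space M. V \<omega> = vel p * c}) (max_T t -` A \<inter> space M)"
    unfolding cond_law_def using assms max_T_measurable[OF assms(1)] by (subst measure_distr) auto
  also have "\<dots> = prob ({\<omega> \<in> space M. V \<omega> = vel p * c} \<inter> (max_T t -` A \<inter> space M)) / prob {\<omega> \<in> space M. V \<omega> = vel p * c}"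
    using velocity_event measurable_sets[OF max_T_measurable[OF assms(1)] assms(2)]
    by (intro measure_uniform_measure) auto
  also have "{\<omega> \<in> space M. V \<omega> = vel p * c} \<inter> (max_T t -` A \<inter> space M) = {\<omega> \<in> space M. V \<omega> = vel p * c \<and> max_T t \<omega> \<in> A}"
    by auto
  finally show ?thesis by (simp add: prob_V)
qed

lemma cond_prob_max_T:
  assumes "0 < t" "A \<in> sets borel"
  shows "\<P>(\<omega> in M. max_T t \<omega> \<in> A \<bar> V \<omega> = vel p * c) = measure (max_law p t) A"
  unfolding measure_max_law[OF assms] cond_prob_def prob_V by (simp add: conj_commute)

lemma cdf_max_law_neg:
  assumes "0 < t" "x < 0"
  shows "cdf (max_law p t) x = 0"
proof -
  have "{\<omega> \<in> space M. V \<omega> = vel p * c \<and> max_T t \<omega> \<in> {..x}} = {}"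
    using max_T_nonneg[OF assms(1)] assms(2) by force
  then show ?thesis using assms by (simp only: cdf_def2 measure_max_law[OF assms(1)] atMost_borel measure_empty)
qed

text \<open>At 0 both sides are limits from the right of values already known: a distribution
  function is right continuous, and the Skellam expectation is even differentiable there.\<close>

lemma cdf_max_law:
  assumes "0 < t" "0 \<le> x" "x < c * t"
  shows "cdf (max_law p t) x = skellam_expectation (level_sign p) (rate * t / 2 + rate / (2 * c) * x) (rate * t / 2 - rate / (2 * c) * x)"
    (is "_ = ?F x")
proof -
  interpret D: real_distribution "max_law p t" by (rule real_distribution_max_law[OF assms(1)])
  have pos: "cdf (max_law p t) y = ?F y" if "0 < y" "y < c * t" for y
    unfolding cdf_def2 using prob_max_T[OF assms(1) that, of p] assms(1) by (simp add: measure_max_law)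
  show ?thesis
  proof (cases "x = 0")
    case True
    have ct: "0 < c * t" using assms speed_pos by simp
    have "(cdf (max_law p t) \<longlongrightarrow> cdf (max_law p t) 0) (at_right 0)"
      using D.cdf_is_right_cont[of 0] by (simp add: continuous_within)
    moreover have "eventually (\<lambda>y. cdf (max_law p t) y = ?F y) (at_right 0)"
      unfolding eventually_at_right_field using ct pos by (intro exI[of _ "c * t"]) auto
    ultimately have "(?F \<longlongrightarrow> cdf (max_law p t) 0) (at_right 0)"
      by (rule Lim_transform_eventually)
    moreover have "isCont ?F 0"
      using ct by (intro DERIV_isCont[OF skellam_cdf_DERIV[OF speed_pos rate_pos]]) auto
    then have "(?F \<longlongrightarrow> ?F 0) (at_right 0)"
      unfolding isCont_def by (rule tendsto_mono[rotated]) (auto intro: at_le)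
    ultimately have "cdf (max_law p t) 0 = ?F 0"
      by (intro tendsto_unique[of "at_right 0"]) auto
    then show ?thesis using True by simp
  qed (use assms pos in auto)
qed

text \<open>Cut down to \<open>{0<..y}\<close>, the law and the measure with the claimed density are
  finite and have the same distribution function, hence coincide. Staying below \<open>c * t\<close>
  keeps the formula for the distribution function available.\<close>

lemma emeasure_max_law_below:
  assumes t: "0 < t" and y: "0 < y" "y < c * t" and A: "A \<in> sets borel"
  shows "emeasure (max_law False t) (A \<inter> {0<..y}) =
    (\<integral>\<^sup>+x. ennreal (max_density c rate t x) * indicator (A \<inter> {0<..y}) x \<partial>lborel)"
proof -
  interpret D: real_distribution "max_law False t" by (rule real_distribution_max_law[OF t])
  let ?M1 = "density (max_law False t) (indicator {0<..y})"
  let ?M2 = "density lborel (\<lambda>x. ennreal (max_density c rate t x) * indicator {0<..y} x)"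
  let ?F = "\<lambda>x. skellam_expectation (level_sign False) (rate * t / 2 + rate / (2 * c) * x) (rate * t / 2 - rate / (2 * c) * x)"
  have F0: "?F 0 = skellam_expectation (level_sign False) (rate * t / 2) (rate * t / 2)" by simp
  have sets_law: "sets (max_law False t) = sets borel" by (rule D.events_eq_borel)
  have M1: "emeasure ?M1 B = emeasure (max_law False t) (B \<inter> {0<..y})" if B: "B \<in> sets borel" for B
  proof -
    have "emeasure ?M1 B = (\<integral>\<^sup>+x. indicator {0<..y} x * indicator B x \<partial>max_law False t)"
      by (rule emeasure_density) (use B sets_law in \<open>auto simp: measurable_cong_sets[OF sets_law refl]\<close>)
    also have "\<dots> = (\<integral>\<^sup>+x. indicator (B \<inter> {0<..y}) x \<partial>max_law False t)"
      by (intro nn_integral_cong) (auto simp: indicator_def)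
    also have "\<dots> = emeasure (max_law False t) (B \<inter> {0<..y})"
      by (rule nn_integral_indicator) (use B sets_law in auto)
    finally show ?thesis .
  qed
  have M2: "emeasure ?M2 B = (\<integral>\<^sup>+x. ennreal (max_density c rate t x) * indicator (B \<inter> {0<..y}) x \<partial>lborel)" if "B \<in> sets borel" for B
    using that by (subst emeasure_density) (auto simp: indicator_inter_arith ac_simps intro!: nn_integral_cong)
  have Iic: "emeasure ?M1 {..x} = emeasure ?M2 {..x}" for x
  proof (cases "x \<le> 0")
    case True
    then have "{..x} \<inter> {0<..y} = {}" by auto
    then show ?thesis by (simp add: M1 M2)
  next
    case False
    define z where "z = min x y"
    have z: "0 < z" "z < c * t" using False y by (auto simp: z_def)
    have eq: "{..x} \<inter> {0<..y} = {0<..z}" by (auto simp: z_def)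
    have "emeasure (max_law False t) {0<..z} = ennreal (cdf (max_law False t) z - cdf (max_law False t) 0)"
      using z by (intro D.emeasure_Ioc) auto
    also have "\<dots> = ennreal (?F z - ?F 0)"
      using z t by (simp add: cdf_max_law)
    also have "\<dots> = (\<integral>\<^sup>+x. ennreal (max_density c rate t x) * indicator {0<..z} x \<partial>lborel)"
      unfolding F0 using nn_integral_max_density[OF speed_pos rate_pos, of z t] z by simp
    finally show ?thesis by (simp add: M1 M2 eq)
  qed
  have fin1: "emeasure ?M1 UNIV \<noteq> \<infinity>"
    by (subst M1) (auto simp: D.emeasure_eq_measure)
  have fin2: "emeasure ?M2 UNIV = (\<integral>\<^sup>+x. ennreal (max_density c rate t x) * indicator {0<..y} x \<partial>lborel)"
    by (subst M2) auto
  have fin2': "emeasure ?M2 UNIV \<noteq> \<infinity>"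
    unfolding fin2 using nn_integral_max_density[OF speed_pos rate_pos, of y t] y by simp
  have "?M1 = ?M2"
  proof (rule cdf_unique')
    have "finite_measure ?M1" "finite_measure ?M2"
      using fin1 fin2' by (auto intro!: finite_measureI simp only: space_density D.space_eq_univ space_lborel space_borel)
    then show "finite_borel_measure ?M1" "finite_borel_measure ?M2"
      unfolding finite_borel_measure_def finite_borel_measure_axioms_def by (simp_all only: sets_density sets_law sets_lborel simp_thms)
    show "cdf ?M1 = cdf ?M2" by (rule ext) (simp only: cdf_def2 measure_def Iic)
  qed
  then have "emeasure ?M1 A = emeasure ?M2 A" by (rule arg_cong)
  then show ?thesis unfolding M1[OF A] M2[OF A] .
qed

lemma emeasure_max_law_density:
  assumes t: "0 < t" and A: "A \<in> sets borel" "A \<subseteq> {0<..<c * t}"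
  shows "emeasure (max_law False t) A = (\<integral>\<^sup>+x. ennreal (max_density c rate t x) * indicator A x \<partial>lborel)"
proof -
  \<comment> \<open>These points increase to \<open>c * t\<close>, so the half-open intervals
    exhaust the open one; the shift by 2 keeps even the first point positive.\<close>
  define y where "y n = c * t - c * t / real (n + 2)" for n
  have ct: "0 < c * t" using t speed_pos by simp
  have y: "0 < y n" "y n < c * t" for n
    using ct divide_strict_left_mono[of 1 "real (n + 2)" "c * t"] by (auto simp: y_def)
  have "incseq y"
    unfolding incseq_Suc_iff y_def using ct by (auto intro!: divide_left_mono)
  then have inc: "incseq (\<lambda>n. A \<inter> {0<..y n})"
    unfolding incseq_def by (fastforce intro: order_trans)
  have "y \<longlonglongrightarrow> c * t - 0"
  proof -
    have "(\<lambda>n. c * t * inverse (real (Suc (n + 1)))) \<longlonglongrightarrow> c * t * 0"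
      by (intro tendsto_mult tendsto_const LIMSEQ_ignore_initial_segment LIMSEQ_inverse_real_of_nat)
    then have "(\<lambda>n. c * t / real (n + 2)) \<longlonglongrightarrow> 0" by (simp add: divide_inverse)
    then show ?thesis unfolding y_def by (intro tendsto_diff tendsto_const)
  qed
  then have ylim: "y \<longlonglongrightarrow> c * t" by simp
  have UN: "(\<Union>n. A \<inter> {0<..y n}) = A"
  proof (intro equalityI subsetI)
    fix x assume "x \<in> A"
    then have "0 < x" "x < c * t" using A(2) by auto
    from order_tendstoD(1)[OF ylim this(2)] obtain n where "x < y n"
      by (auto simp: eventually_sequentially)
    then show "x \<in> (\<Union>n. A \<inter> {0<..y n})" using \<open>x \<in> A\<close> \<open>0 < x\<close> by (auto intro: less_imp_le)
  qed auto
  let ?M2 = "density lborel (\<lambda>x. ennreal (max_density c rate t x))"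
  have M2: "emeasure ?M2 B = (\<integral>\<^sup>+x. ennreal (max_density c rate t x) * indicator B x \<partial>lborel)" if "B \<in> sets borel" for B
    using that by (subst emeasure_density) auto
  have "(\<lambda>n. emeasure (max_law False t) (A \<inter> {0<..y n})) \<longlonglongrightarrow> emeasure (max_law False t) (\<Union>n. A \<inter> {0<..y n})"
    using A inc by (intro Lim_emeasure_incseq) (auto simp: cond_law_def)
  moreover have "(\<lambda>n. emeasure ?M2 (A \<inter> {0<..y n})) \<longlonglongrightarrow> emeasure ?M2 (\<Union>n. A \<inter> {0<..y n})"
    using A inc by (intro Lim_emeasure_incseq) auto
  moreover have "emeasure ?M2 (A \<inter> {0<..y n}) = emeasure (max_law False t) (A \<inter> {0<..y n})" for n
    using A by (subst M2) (auto simp: emeasure_max_law_below[OF t y])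
  ultimately have "emeasure (max_law False t) A = emeasure ?M2 A"
    unfolding UN by (simp add: LIMSEQ_unique)
  then show ?thesis using M2[OF A(1)] by simp
qed

text \<open>Integrability is claimed separately because the Bochner integral of a nonintegrable
  function defaults to 0. It follows from the density being nonnegative with an integral that is a
  probability.\<close>

theorem max_T_density:
  assumes t: "0 < t"
  shows "set_integrable lborel {0<..<c * t} (max_density c rate t)"
    and "A \<in> sets borel \<Longrightarrow> A \<subseteq> {0<..<c * t} \<Longrightarrow>
      \<P>(\<omega> in M. max_T t \<omega> \<in> A \<bar> V \<omega> = - c) = (LBINT \<beta>:A. max_density c rate t \<beta>)"
proof -
  interpret D: real_distribution "max_law False t" by (rule real_distribution_max_law[OF t])
  let ?f = "max_density c rate t"
  have ct: "0 < c * t" using t speed_pos by simp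
  have nonneg: "0 \<le> indicator A x * ?f x" if "A \<subseteq> {0<..<c * t}" for A x
  proof (cases "x \<in> A")
    case True
    then have "- (c * t) < x" "x < c * t" using that ct by auto
    then show ?thesis using max_density_nonneg[OF speed_pos rate_pos, of t x] by simp
  qed simp
  have nn: "(\<integral>\<^sup>+x. ennreal (indicator A x * ?f x) \<partial>lborel) = ennreal (measure (max_law False t) A)"
    if "A \<in> sets borel" "A \<subseteq> {0<..<c * t}" for A
  proof -
    have "(\<integral>\<^sup>+x. ennreal (indicator A x * ?f x) \<partial>lborel) = (\<integral>\<^sup>+x. ennreal (?f x) * indicator A x \<partial>lborel)"
      by (intro nn_integral_cong) (auto simp: indicator_def)
    then show ?thesis using emeasure_max_law_density[OF t that] by (simp add: D.emeasure_eq_measure)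
  qed
  show "set_integrable lborel {0<..<c * t} ?f"
    unfolding set_integrable_def real_scaleR_def
    by (rule integrableI_nn_integral_finite[OF _ _ nn]) (use nonneg in auto)
  assume A: "A \<in> sets borel" "A \<subseteq> {0<..<c * t}"
  have "\<P>(\<omega> in M. max_T t \<omega> \<in> A \<bar> V \<omega> = - c) = measure (max_law False t) A"
    using cond_prob_max_T[OF t A(1), of False] by (simp add: vel_def)
  also have "\<dots> = (LBINT \<beta>:A. ?f \<beta>)"
    unfolding set_lebesgue_integral_def real_scaleR_def
    by (subst integral_eq_nn_integral) (use A nonneg nn[OF A] in auto)
  finally show "\<P>(\<omega> in M. max_T t \<omega> \<in> A \<bar> V \<omega> = - c) = (LBINT \<beta>:A. ?f \<beta>)" .
qed

theorem max_T_atom: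
  assumes t: "0 < t"
  shows "\<P>(\<omega> in M. max_T t \<omega> = 0 \<bar> V \<omega> = - c) = exp (- rate * t) * (bessel_I 0 (rate * t) + bessel_I 1 (rate * t))"
proof -
  \<comment> \<open>The path starts at 0, so its maximum is nonnegative and the atom is the
    distribution function at 0.\<close>
  have "\<P>(\<omega> in M. max_T t \<omega> = 0 \<bar> V \<omega> = - c) = \<P>(\<omega> in M. max_T t \<omega> \<in> {..0} \<bar> V \<omega> = - c)"
    unfolding cond_prob_def using max_T_nonneg[OF t] by (intro arg_cong2[where f="(/)"] arg_cong[where f=prob]) force+
  also have "\<dots> = cdf (max_law False t) 0"
    using cond_prob_max_T[OF t, of "{..0}" False] by (simp add: vel_def cdf_def2)
  also have "\<dots> = skellam_expectation (level_sign False) (rate * t / 2) (rate * t / 2)"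
    using cdf_max_law[OF t, of 0 False] t speed_pos by simp
  also have "\<dots> = exp (- rate * t) * (bessel_I 0 (rate * t) + bessel_I 1 (rate * t))"
    using skellam_atom[of "rate * t / 2"] t rate_pos by simp
  finally show ?thesis .
qed

end

section \<open>Normal approximation of the Skellam law\<close>

lemma expectation_pair_pmf_complex:
  fixes f :: "'a \<times> 'b \<Rightarrow> complex"
  assumes "\<And>z. norm (f z) \<le> K"
  shows "measure_pmf.expectation (pair_pmf p q) f
    = measure_pmf.expectation p (\<lambda>x. measure_pmf.expectation q (\<lambda>y. f (x, y)))"
proof -
  have int: "integrable (measure_pmf r) g" if "\<And>z. norm (g z) \<le> K" for r and g :: "'c \<Rightarrow> complex"
    using that by (intro measure_pmf.integrable_const_bound[where B=K]) auto
  have inner: "norm (measure_pmf.expectation q (\<lambda>y. f (x, y))) \<le> K" for x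
  proof -
    have "norm (measure_pmf.expectation q (\<lambda>y. f (x, y))) \<le> measure_pmf.expectation q (\<lambda>y. norm (f (x, y)))"
      by (rule integral_norm_bound)
    also have "\<dots> \<le> K"
      using expectation_pmf_abs_le[of "\<lambda>y. norm (f (x, y))" K q] assms by simp
    finally show ?thesis .
  qed
  have bd: "\<bar>Re (f z)\<bar> \<le> K" "\<bar>Im (f z)\<bar> \<le> K" for z
    using abs_Re_le_cmod[of "f z"] abs_Im_le_cmod[of "f z"] assms[of z] by linarith+
  have int2: "integrable p (\<lambda>x. measure_pmf.expectation q (\<lambda>y. f (x, y)))" "integrable (pair_pmf p q) f"
    "\<And>x. integrable q (\<lambda>y. f (x, y))"
    by (intro int inner assms)+
  show ?thesis
  proof (rule complex_eqI)
    have "Re (measure_pmf.expectation (pair_pmf p q) f) = measure_pmf.expectation (pair_pmf p q) (\<lambda>z. Re (f z))"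
      by (rule integral_Re[OF int2(2), symmetric])
    also have "\<dots> = measure_pmf.expectation p (\<lambda>x. measure_pmf.expectation q (\<lambda>y. Re (f (x, y))))"
      by (rule expectation_pair_pmf[OF bd(1)])
    also have "\<dots> = measure_pmf.expectation p (\<lambda>x. Re (measure_pmf.expectation q (\<lambda>y. f (x, y))))"
      by (simp only: integral_Re[OF int2(3)])
    also have "\<dots> = Re (measure_pmf.expectation p (\<lambda>x. measure_pmf.expectation q (\<lambda>y. f (x, y))))"
      by (rule integral_Re[OF int2(1)])
    finally show "Re (measure_pmf.expectation (pair_pmf p q) f) = \<dots>" .
    have "Im (measure_pmf.expectation (pair_pmf p q) f) = measure_pmf.expectation (pair_pmf p q) (\<lambda>z. Im (f z))"
      by (rule integral_Im[OF int2(2), symmetric])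
    also have "\<dots> = measure_pmf.expectation p (\<lambda>x. measure_pmf.expectation q (\<lambda>y. Im (f (x, y))))"
      by (rule expectation_pair_pmf[OF bd(2)])
    also have "\<dots> = measure_pmf.expectation p (\<lambda>x. Im (measure_pmf.expectation q (\<lambda>y. f (x, y))))"
      by (simp only: integral_Im[OF int2(3)])
    also have "\<dots> = Im (measure_pmf.expectation p (\<lambda>x. measure_pmf.expectation q (\<lambda>y. f (x, y))))"
      by (rule integral_Im[OF int2(1)])
    finally show "Im (measure_pmf.expectation (pair_pmf p q) f) = \<dots>" .
  qed
qed

lemma poisson_char:
  assumes "0 < a"
  shows "measure_pmf.expectation (poisson_pmf a) (\<lambda>k. iexp (u * real k)) = exp (of_real a * (iexp u - 1))"
proof -
  have "(\<lambda>i. pmf (poisson_pmf a) i *\<^sub>R iexp (u * real i)) sums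
      measure_pmf.expectation (poisson_pmf a) (\<lambda>k. iexp (u * real k))"
    by (rule expectation_nat_pmf_sums[where K=1]) simp
  moreover have "(\<lambda>i. exp (- of_real a) * ((of_real a * iexp u) ^ i /\<^sub>R fact i)) sums (exp (- of_real a) * exp (of_real a * iexp u :: complex))"
    by (intro sums_mult exp_converges)
  moreover have "pmf (poisson_pmf a) i *\<^sub>R iexp (u * real i) = exp (- of_real a) * ((of_real a * iexp u) ^ i /\<^sub>R fact i)" for i
  proof -
    have "iexp (u * real i) = iexp u ^ i"
      by (simp add: exp_of_nat_mult[symmetric] mult_ac)
    then show ?thesis
      using assms by (simp add: scaleR_conv_of_real power_mult_distrib exp_of_real[symmetric] divide_inverse mult_ac)
  qed
  ultimately have "measure_pmf.expectation (poisson_pmf a) (\<lambda>k. iexp (u * real k)) = exp (- of_real a) * exp (of_real a * iexp u :: complex)"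
    by (simp add: sums_unique2)
  then show ?thesis by (simp add: exp_add[symmetric] algebra_simps)
qed

text \<open>The law of (D + e) / r. The offset \<open>e\<close> carries the integer shifts inside
  the signs and disappears in the limit of large \<open>r\<close>.\<close>

definition skellam_law :: "real \<Rightarrow> real \<Rightarrow> real \<Rightarrow> real \<Rightarrow> real measure" where
  "skellam_law e r a b = distr (measure_pmf (pair_pmf (poisson_pmf a) (poisson_pmf b))) borel (\<lambda>(i, j). (real i - real j + e) / r)"

lemma real_distribution_skellam_law: "real_distribution (skellam_law e r a b)"
  unfolding skellam_law_def by (rule prob_space.real_distribution_distr[OF measure_pmf.prob_space_axioms]) simp

text \<open>The exponent is arranged as a sum of products whose factors each converge when
  \<open>r\<close> grows: one for the variance, one for the offset, one for the mean.\<close>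

lemma char_skellam_law:
  assumes "0 < a" "0 < b" "0 < r"
  shows "char (skellam_law e r a b) \<theta> =
    exp (of_real (r\<^sup>2 * (cos (\<theta> / r) - 1)) * of_real ((a + b) / r\<^sup>2)
      + \<i> * of_real (\<theta> / r * e) + \<i> * of_real (r * sin (\<theta> / r)) * of_real ((a - b) / r))"
    (is "_ = exp ?R")
proof -
  let ?u = "\<theta> / r"
  have "char (skellam_law e r a b) \<theta> = measure_pmf.expectation (pair_pmf (poisson_pmf a) (poisson_pmf b))
      (\<lambda>z. iexp (\<theta> * ((real (fst z) - real (snd z) + e) / r)))"
    unfolding char_def skellam_law_def by (subst integral_distr) (auto simp: case_prod_unfold)
  also have "\<dots> = measure_pmf.expectation (poisson_pmf a) (\<lambda>i. measure_pmf.expectation (poisson_pmf b)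
      (\<lambda>j. iexp (\<theta> * ((real i - real j + e) / r))))"
    by (subst expectation_pair_pmf_complex[where K=1]) (auto simp: norm_exp_i_times[of "\<theta> * x" for x, simplified])
  also have "(\<lambda>i j. iexp (\<theta> * ((real i - real j + e) / r))) = (\<lambda>i j. iexp (?u * e) * iexp (?u * real i) * iexp (- ?u * real j))"
    by (intro ext) (simp add: exp_add[symmetric] add_divide_distrib diff_divide_distrib algebra_simps)
  also have "measure_pmf.expectation (poisson_pmf a) (\<lambda>i. measure_pmf.expectation (poisson_pmf b)
      (\<lambda>j. iexp (?u * e) * iexp (?u * real i) * iexp (- ?u * real j)))
    = iexp (?u * e) * exp (of_real a * (iexp ?u - 1)) * exp (of_real b * (iexp (- ?u) - 1))"
    unfolding integral_mult_right_zero integral_mult_left_zero poisson_char[OF assms(1)] poisson_char[OF assms(2)] by simp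
  also have "\<dots> = exp (\<i> * of_real (?u * e) + of_real a * (iexp ?u - 1) + of_real b * (iexp (- ?u) - 1))"
    by (simp add: exp_add)
  also have "\<i> * of_real (?u * e) + of_real a * (iexp ?u - 1) + of_real b * (iexp (- ?u) - 1) = ?R"
  proof -
    have I: "iexp ?u = of_real (cos ?u) + \<i> * of_real (sin ?u)" "iexp (- ?u) = of_real (cos ?u) - \<i> * of_real (sin ?u)"
      using cis_conv_exp[of ?u] cis_conv_exp[of "- ?u"] by (auto simp: complex_eq_iff)
    have E1: "of_real (r\<^sup>2 * (cos ?u - 1)) * of_real ((a + b) / r\<^sup>2) = (of_real ((cos ?u - 1) * (a + b)) :: complex)"
    proof -
      have "r\<^sup>2 * (cos ?u - 1) * ((a + b) / r\<^sup>2) = (cos ?u - 1) * (a + b)" using assms by simp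
      then show ?thesis by (simp only: of_real_mult[symmetric])
    qed
    have E2: "\<i> * of_real (r * sin ?u) * of_real ((a - b) / r) = \<i> * of_real (sin ?u * (a - b))"
    proof -
      have "r * sin ?u * ((a - b) / r) = sin ?u * (a - b)" using assms by simp
      from arg_cong[OF this, of "\<lambda>z. \<i> * of_real z"] show ?thesis
        by (simp only: of_real_mult mult.assoc)
    qed
    show ?thesis unfolding I E1 E2 by (simp add: algebra_simps)
  qed
  finally show ?thesis .
qed

lemma scaled_sin_limit:
  fixes r :: "nat \<Rightarrow> real"
  assumes "filterlim r at_top sequentially"
  shows "(\<lambda>n. r n * sin (\<theta> / r n)) \<longlonglongrightarrow> \<theta>"
proof -
  have "DERIV (\<lambda>u. sin (\<theta> * u)) 0 :> \<theta>"
    by (auto intro!: derivative_eq_intros)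
  then have "((\<lambda>u. sin (\<theta> * u) / u) \<longlongrightarrow> \<theta>) (at 0)"
    by (simp add: DERIV_def)
  moreover have "filterlim (\<lambda>n. inverse (r n)) (at 0) sequentially"
    using filterlim_compose[OF filterlim_inverse_at_right_top assms] by (rule filterlim_mono) (auto intro: at_le)
  ultimately have "(\<lambda>n. sin (\<theta> * inverse (r n)) / inverse (r n)) \<longlonglongrightarrow> \<theta>"
    by (rule filterlim_compose)
  then show ?thesis by (simp add: divide_inverse mult_ac)
qed

lemma scaled_cos_limit:
  fixes r :: "nat \<Rightarrow> real"
  assumes "filterlim r at_top sequentially"
  shows "(\<lambda>n. (r n)\<^sup>2 * (cos (\<theta> / r n) - 1)) \<longlonglongrightarrow> - (\<theta>\<^sup>2 / 2)"
proof -
  have "(\<lambda>n. - 2 * (r n * sin (\<theta> / 2 / r n))\<^sup>2) \<longlonglongrightarrow> - 2 * (\<theta> / 2)\<^sup>2"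
    by (intro tendsto_mult tendsto_const tendsto_power scaled_sin_limit assms)
  moreover have "- 2 * (r n * sin (\<theta> / 2 / r n))\<^sup>2 = (r n)\<^sup>2 * (cos (\<theta> / r n) - 1)" for n
  proof -
    have "cos (\<theta> / r n) = 1 - 2 * (sin (\<theta> / 2 / r n))\<^sup>2"
      using cos_double_sin[of "\<theta> / 2 / r n"] by simp
    then show ?thesis by (simp only: power_mult_distrib) (simp add: algebra_simps)
  qed
  ultimately show ?thesis by (simp add: power2_eq_square)
qed

lemma std_normal_point: "measure std_normal_distribution {z} = 0"
proof -
  have "emeasure std_normal_distribution {z} = (\<integral>\<^sup>+x. ennreal (std_normal_density x) * indicator {z} x \<partial>lborel)"
    by (subst emeasure_density) auto
  also have "\<dots> = (\<integral>\<^sup>+(x::real). 0 \<partial>lborel)"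
  proof (rule nn_integral_cong_AE)
    show "AE x in lborel. ennreal (std_normal_density x) * indicator {z} x = 0"
      using AE_lborel_singleton[of z] by eventually_elim (simp add: indicator_def)
  qed
  finally show ?thesis by (simp add: measure_def)
qed

lemma std_normal_isCont_cdf: "isCont (cdf std_normal_distribution) z"
proof -
  interpret real_distribution std_normal_distribution by (rule real_dist_normal_dist)
  show ?thesis by (simp add: isCont_cdf std_normal_point)
qed

text \<open>The characteristic function is even, so reflection preserves the law by
  uniqueness.\<close>

lemma std_normal_symmetric:
  assumes "A \<in> sets borel"
  shows "measure std_normal_distribution (uminus -` A) = measure std_normal_distribution A"
proof -
  interpret real_distribution std_normal_distribution by (rule real_dist_normal_dist)
  have "char (distr std_normal_distribution borel uminus) t = char std_normal_distribution t" for t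
  proof -
    have "char (distr std_normal_distribution borel uminus) t = char std_normal_distribution (- t)"
      unfolding char_def by (subst integral_distr) auto
    then show ?thesis by (simp add: char_std_normal_distribution)
  qed
  then have "distr std_normal_distribution borel uminus = std_normal_distribution"
    by (intro Levy_uniqueness real_distribution_distr real_dist_normal_dist) auto
  then have "measure std_normal_distribution A = measure (distr std_normal_distribution borel uminus) A" by simp
  also have "\<dots> = measure std_normal_distribution (uminus -` A)"
    using assms by (subst measure_distr) auto
  finally show ?thesis ..
qed

lemma std_normal_upper_tail:
  "measure std_normal_distribution {z..} = cdf std_normal_distribution (- z)"
  "measure std_normal_distribution {z<..} = cdf std_normal_distribution (- z)"
proof -
  interpret real_distribution std_normal_distribution by (rule real_dist_normal_dist)
  have *: "uminus -` {..- z} = {z..}" by auto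
  show ge: "measure std_normal_distribution {z..} = cdf std_normal_distribution (- z)"
    using std_normal_symmetric[of "{..- z}"] by (simp add: * cdf_def2)
  have "measure std_normal_distribution ({z} \<union> {z<..}) = measure std_normal_distribution {z} + measure std_normal_distribution {z<..}"
    by (rule finite_measure_Union) auto
  moreover have "{z} \<union> {z<..} = {z..}" by auto
  ultimately show "measure std_normal_distribution {z<..} = cdf std_normal_distribution (- z)"
    by (simp add: std_normal_point ge)
qed

lemma std_normal_cdf_0: "cdf std_normal_distribution 0 = 1 / 2"
proof -
  interpret real_distribution std_normal_distribution by (rule real_dist_normal_dist)
  have "UNIV - {..0} = {0::real<..}" by auto
  then have "measure std_normal_distribution {0<..} = 1 - cdf std_normal_distribution 0"
    using prob_compl[of "{..0}"] by (simp add: cdf_def2)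
  then show ?thesis using std_normal_upper_tail(2)[of 0] by simp
qed

text \<open>D is scaled but not centred: its mean and variance after scaling tend to
  \<open>x\<close> and \<open>t\<close>. The limit is therefore normal with these parameters, and
  its distribution function is read off at 0.\<close>

lemma skellam_law_weak_limit:
  assumes r: "filterlim r at_top sequentially"
    and pos: "eventually (\<lambda>n. 0 < a n) sequentially" "eventually (\<lambda>n. 0 < b n) sequentially"
    and lims: "(\<lambda>n. (a n + b n) / (r n)\<^sup>2) \<longlonglongrightarrow> t" "(\<lambda>n. (a n - b n) / r n) \<longlonglongrightarrow> x"
    and t: "0 < t"
  shows "(\<lambda>n. cdf (skellam_law e (r n) (a n) (b n)) 0) \<longlonglongrightarrow> cdf std_normal_distribution (- x / sqrt t)"
proof -
  interpret S: real_distribution std_normal_distribution by (rule real_dist_normal_dist)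
  let ?L = "distr std_normal_distribution borel (\<lambda>z. x + sqrt t * z)"
  have L: "real_distribution ?L" by (rule S.real_distribution_distr) simp
  interpret L: real_distribution ?L by (rule L)
  have "weak_conv_m (\<lambda>n. skellam_law e (r n) (a n) (b n)) ?L"
  proof (rule levy_continuity[OF real_distribution_skellam_law L])
    fix \<theta>
    have sqrt_t: "(of_real (sqrt t))\<^sup>2 = (of_real t :: complex)"
      using t by (simp flip: of_real_power)
    have "char ?L \<theta> = (CLINT z|std_normal_distribution. iexp (\<theta> * x) * iexp (\<theta> * sqrt t * z))"
      unfolding char_def by (subst integral_distr) (auto simp: exp_add[symmetric] algebra_simps)
    also have "\<dots> = iexp (\<theta> * x) * char std_normal_distribution (\<theta> * sqrt t)"
      unfolding char_def by (rule integral_mult_right_zero)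
    also have "\<dots> = exp (of_real (- (\<theta>\<^sup>2 / 2)) * of_real t + \<i> * of_real 0 + \<i> * of_real \<theta> * of_real x)"
      using sqrt_t by (simp add: char_std_normal_distribution exp_of_real[symmetric] exp_add[symmetric] power_mult_distrib algebra_simps)
    finally have charL: "char ?L \<theta> = exp (of_real (- (\<theta>\<^sup>2 / 2)) * of_real t + \<i> * of_real 0 + \<i> * of_real \<theta> * of_real x)" .
    have "(\<lambda>n. \<theta> / r n * e) \<longlonglongrightarrow> 0 * e"
      by (intro tendsto_mult tendsto_const tendsto_divide_0[OF tendsto_const] filterlim_at_top_imp_at_infinity r)
    then have e0: "(\<lambda>n. \<theta> / r n * e) \<longlonglongrightarrow> 0" by simp
    have "(\<lambda>n. exp (of_real ((r n)\<^sup>2 * (cos (\<theta> / r n) - 1)) * of_real ((a n + b n) / (r n)\<^sup>2)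
      + \<i> * of_real (\<theta> / r n * e) + \<i> * of_real (r n * sin (\<theta> / r n)) * of_real ((a n - b n) / r n)) :: complex)
      \<longlonglongrightarrow> char ?L \<theta>"
      unfolding charL
      by (intro tendsto_exp tendsto_add tendsto_mult tendsto_const tendsto_of_real lims e0 scaled_sin_limit scaled_cos_limit r)
    moreover have "eventually (\<lambda>n. exp (of_real ((r n)\<^sup>2 * (cos (\<theta> / r n) - 1)) * of_real ((a n + b n) / (r n)\<^sup>2)
      + \<i> * of_real (\<theta> / r n * e) + \<i> * of_real (r n * sin (\<theta> / r n)) * of_real ((a n - b n) / r n))
      = char (skellam_law e (r n) (a n) (b n)) \<theta>) sequentially"
      using pos filterlim_at_top_dense[THEN iffD1, OF r, rule_format, of 0]
      by eventually_elim (rule char_skellam_law[symmetric])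
    ultimately show "(\<lambda>n. char (skellam_law e (r n) (a n) (b n)) \<theta>) \<longlonglongrightarrow> char ?L \<theta>"
      by (rule Lim_transform_eventually)
  qed
  moreover have cdfL: "cdf ?L y = cdf std_normal_distribution ((y - x) / sqrt t)" for y
  proof -
    have "(\<lambda>z. x + sqrt t * z) -` {..y} = {..(y - x) / sqrt t}"
      using t by (auto simp: field_simps)
    then show ?thesis unfolding cdf_def2 by (subst measure_distr) auto
  qed
  then have "isCont (cdf ?L) 0"
    unfolding cdfL[abs_def] by (intro isCont_o2[OF _ std_normal_isCont_cdf] continuous_intros) (use t in auto)
  ultimately have "(\<lambda>n. cdf (skellam_law e (r n) (a n) (b n)) 0) \<longlonglongrightarrow> cdf ?L 0"
    unfolding weak_conv_m_def weak_conv_def by blast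
  then show ?thesis by (simp add: cdfL)
qed

text \<open>For an integer n, sgn n is 1 minus the indicator of n \<le> 0 minus that of n + 1 \<le>
  0. Weak convergence thus applies although the sign is discontinuous.\<close>

lemma skellam_expectation_level_sign:
  fixes p :: bool
  assumes "0 < r"
  defines "e \<equiv> if p then 0 else 1"
  shows "skellam_expectation (level_sign p) a b = 1 - cdf (skellam_law e r a b) 0 - cdf (skellam_law (e + 1) r a b) 0"
proof -
  let ?P = "pair_pmf (poisson_pmf a) (poisson_pmf b)"
  define A where "A d = {(i, j). real i - real j + d \<le> 0}" for d :: real
  have cdf: "cdf (skellam_law d r a b) 0 = measure_pmf.prob ?P (A d)" for d
  proof -
    have "(\<lambda>(i, j). (real i - real j + d) / r) -` {..0} = A d"
      using assms(1) by (auto simp: A_def divide_le_0_iff)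
    then show ?thesis unfolding cdf_def2 skellam_law_def by (subst measure_distr) auto
  qed
  have "(\<lambda>(i, j). level_sign p (int i - int j)) = (\<lambda>z. 1 - indicator (A e) z - indicator (A (e + 1)) z)"
    by (auto simp: fun_eq_iff A_def level_sign_def sgn_if e_def indicator_def)
  then have "skellam_expectation (level_sign p) a b = measure_pmf.expectation ?P (\<lambda>z. 1 - indicator (A e) z - indicator (A (e + 1)) z)"
    unfolding skellam_expectation_def by simp
  also have "\<dots> = 1 - measure_pmf.prob ?P (A e) - measure_pmf.prob ?P (A (e + 1))"
    using integrable_pmf_bounded[of "indicator (A d)" 1 ?P for d] by simp
  finally show ?thesis unfolding cdf .
qed

text \<open>All integer offsets have the same limit, so both values of \<open>p\<close> lead to the
  same law: the initial direction is forgotten.\<close>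

theorem skellam_expectation_limit:
  assumes r: "filterlim r at_top sequentially"
    and pos: "eventually (\<lambda>n. 0 < a n) sequentially" "eventually (\<lambda>n. 0 < b n) sequentially"
    and lims: "(\<lambda>n. (a n + b n) / (r n)\<^sup>2) \<longlonglongrightarrow> t" "(\<lambda>n. (a n - b n) / r n) \<longlonglongrightarrow> x"
    and t: "0 < t"
  shows "(\<lambda>n. skellam_expectation (level_sign p) (a n) (b n)) \<longlonglongrightarrow> 1 - 2 * cdf std_normal_distribution (- x / sqrt t)"
proof -
  let ?e = "if p then 0 else 1 :: real" and ?c = "cdf std_normal_distribution (- x / sqrt t)"
  have "(\<lambda>n. 1 - cdf (skellam_law ?e (r n) (a n) (b n)) 0 - cdf (skellam_law (?e + 1) (r n) (a n) (b n)) 0) \<longlonglongrightarrow> 1 - ?c - ?c"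
    by (intro tendsto_diff tendsto_const skellam_law_weak_limit assms)
  moreover have "eventually (\<lambda>n. 1 - cdf (skellam_law ?e (r n) (a n) (b n)) 0 - cdf (skellam_law (?e + 1) (r n) (a n) (b n)) 0
      = skellam_expectation (level_sign p) (a n) (b n)) sequentially"
    using filterlim_at_top_dense[THEN iffD1, OF r, rule_format, of 0]
    by eventually_elim (rule skellam_expectation_level_sign[symmetric])
  ultimately show ?thesis by (simp add: Lim_transform_eventually)
qed

section \<open>The maximum of Brownian motion\<close>

lemma continuous_max_grid_limit:
  fixes f :: "real \<Rightarrow> real"
  assumes t: "0 < t" and f: "continuous_on {0..t} f"
  shows "(\<lambda>m. Max ((\<lambda>k. f (real k * (t / real (Suc m)))) ` {..Suc m})) \<longlonglongrightarrow> (SUP s\<in>{0..t}. f s)"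
proof -
  obtain s where s: "s \<in> {0..t}" "\<And>u. u \<in> {0..t} \<Longrightarrow> f u \<le> f s"
    using continuous_attains_sup[of "{0..t}" f] t f by auto
  have sup: "(SUP u\<in>{0..t}. f u) = f s"
    by (rule cSup_eq_maximum) (use s in auto)
  show ?thesis unfolding sup
  proof (rule LIMSEQ_I)
    fix r :: real assume "0 < r"
    then obtain d where d: "0 < d" "\<And>u. u \<in> {0..t} \<Longrightarrow> dist u s < d \<Longrightarrow> dist (f u) (f s) < r"
      using f s(1) unfolding continuous_on_iff by blast
    have "(\<lambda>m. t * inverse (real (Suc m))) \<longlonglongrightarrow> t * 0"
      by (intro tendsto_mult tendsto_const LIMSEQ_inverse_real_of_nat)
    then have "eventually (\<lambda>m. t * inverse (real (Suc m)) < d) sequentially"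
      using d(1) by (intro order_tendstoD(2)) auto
    then obtain m0 where m0: "\<And>m. m \<ge> m0 \<Longrightarrow> t / real (Suc m) < d"
      by (auto simp: eventually_sequentially divide_inverse)
    show "\<exists>m0. \<forall>m\<ge>m0. norm (Max ((\<lambda>k. f (real k * (t / real (Suc m)))) ` {..Suc m}) - f s) < r"
    proof (intro exI[of _ m0] allI impI)
      fix m assume "m0 \<le> m"
      define h where "h = t / real (Suc m)"
      have h: "0 < h" "real (Suc m) * h = t" "h < d"
        using t m0[OF \<open>m0 \<le> m\<close>] by (simp_all add: h_def del: of_nat_Suc)
      have grid: "real k * h \<in> {0..t}" if "k \<le> Suc m" for k
      proof -
        have "real k * h \<le> real (Suc m) * h" using that h by (intro mult_right_mono) auto
        then show ?thesis using h by (simp del: of_nat_Suc)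
      qed
      define k where "k = nat \<lfloor>s / h\<rfloor>"
      have fl: "0 \<le> \<lfloor>s / h\<rfloor>" using s h by simp
      have "real k \<le> s / h" "s / h < real k + 1"
        unfolding k_def using fl by (simp_all add: of_nat_nat)
      then have k: "real k * h \<le> s" "s < real k * h + h" using h by (simp_all add: field_simps)
      have "real k * h \<le> s" by (rule k)
      also have "s \<le> t" using s by simp
      also have "t = real (Suc m) * h" by (rule h(2)[symmetric])
      finally have "k \<le> Suc m" using h(1) by (simp del: of_nat_Suc)
      have "dist (f (real k * h)) (f s) < r"
        using k h(3) by (intro d grid \<open>k \<le> Suc m\<close>) (auto simp: dist_real_def)
      then have "f s - r < f (real k * h)" by (simp add: dist_real_def)
      also have "\<dots> \<le> Max ((\<lambda>k. f (real k * h)) ` {..Suc m})"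
        using \<open>k \<le> Suc m\<close> by (intro Max_ge) auto
      finally have "f s - r < Max ((\<lambda>k. f (real k * h)) ` {..Suc m})" .
      moreover have "Max ((\<lambda>k. f (real k * h)) ` {..Suc m}) \<le> f s"
        using grid s(2) by (intro Max.boundedI) auto
      ultimately show "norm (Max ((\<lambda>k. f (real k * (t / real (Suc m)))) ` {..Suc m}) - f s) < r"
        unfolding h_def using \<open>0 < r\<close> by simp
    qed
  qed
qed

context brownian_motion
begin

lemma prob_B_increment:
  assumes "0 \<le> s" "s < u"
  shows "prob {\<omega> \<in> space M. z < B u \<omega> - B s \<omega>} = cdf std_normal_distribution (- z / sqrt (u - s))"
proof -
  define r where "r = sqrt (u - s)"
  have r: "0 < r" using assms by (simp add: r_def)
  have D: "distributed M lborel (\<lambda>\<omega>. (B u \<omega> - B s \<omega> - 0) / r) std_normal_density"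
    using B_increments[OF assms] normal_standard_normal_convert[OF r] by (simp only: r_def)
  have "{\<omega> \<in> space M. z < B u \<omega> - B s \<omega>} = (\<lambda>\<omega>. (B u \<omega> - B s \<omega> - 0) / r) -` {z / r<..} \<inter> space M"
    using r by (auto simp: field_simps)
  also have "prob \<dots> = measure (distr M lborel (\<lambda>\<omega>. (B u \<omega> - B s \<omega> - 0) / r)) {z / r<..}"
    using distributed_measurable[OF D] by (subst measure_distr) auto
  also have "\<dots> = measure std_normal_distribution {z / r<..}"
    by (simp only: distributed_distr_eq_density[OF D])
  finally show ?thesis by (simp add: std_normal_upper_tail r_def)
qed

lemma prob_B:
  assumes "0 < t"
  shows "prob {\<omega> \<in> space M. z < B t \<omega>} = cdf std_normal_distribution (- z / sqrt t)"
proof -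
  have "{\<omega> \<in> space M. z < B t \<omega>} = {\<omega> \<in> space M. z < B t \<omega> - B 0 \<omega>}"
    by (auto simp: B_start)
  then show ?thesis using prob_B_increment[of 0 t z] assms by simp
qed

text \<open>The event that \<open>k\<close> is the first grid index at which the level is exceeded.
  On a grid the reflection argument needs independent increments only, in place of the strong Markov
  property at a hitting time.\<close>

definition passage :: "real \<Rightarrow> real \<Rightarrow> nat \<Rightarrow> 'a set" where
  "passage h x k = {\<omega> \<in> space M. (\<forall>j<k. B (real j * h) \<omega> \<le> x) \<and> x < B (real k * h) \<omega>}"

lemma passage_event:
  assumes "0 < h" shows "passage h x k \<in> events"
proof -
  have [measurable]: "B (real j * h) \<in> borel_measurable M" for j :: nat
    using assms by (intro B_measurable) auto
  show ?thesis unfolding passage_def by measurable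
qed

text \<open>The passage event depends on the increments before the grid time \<open>k\<close>, while
  the later increment is independent of them and positive with probability 1/2.\<close>

lemma passage_independent:
  assumes h: "0 < h" and t: "real k * h < t"
  shows "prob (passage h x k \<inter> {\<omega> \<in> space M. 0 < B t \<omega> - B (real k * h) \<omega>}) = prob (passage h x k) / 2"
proof -
  \<comment> \<open>The grid times up to index \<open>k\<close> are followed by a single jump to
    \<open>t\<close>, so that the last of the \<open>k + 1\<close> increments is the one after the
    passage.\<close>
  define \<tau> where "\<tau> i = (if i \<le> k then real i * h else t)" for i :: nat
  define X where "X i \<omega> = B (\<tau> (Suc i)) \<omega> - B (\<tau> i) \<omega>" for i \<omega>
  have "0 \<le> \<tau> 0" using h by (simp add: \<tau>_def)
  moreover have "\<tau> i \<le> \<tau> (Suc i)" if "i < Suc k" for i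
    using that h t by (auto simp: \<tau>_def not_le less_Suc_eq)
  ultimately have ind: "indep_vars (\<lambda>_. borel) X {..<Suc k}"
    using B_indep_increments[unfolded indep_increments_def] unfolding X_def by blast
  have sum: "(\<Sum>i<j. X i \<omega>) = B (real j * h) \<omega>" if "j \<le> k" "\<omega> \<in> space M" for j \<omega>
    using that by (induction j) (auto simp: X_def \<tau>_def B_start)
  have Xk: "X k \<omega> = B t \<omega> - B (real k * h) \<omega>" for \<omega>
    by (simp add: X_def \<tau>_def)
  let ?P = "PiM {..<k} (\<lambda>_. borel :: real measure)" and ?Q = "PiM {k} (\<lambda>_. borel :: real measure)"
  let ?RX = "\<lambda>\<omega>. \<lambda>i\<in>{..<k}. X i \<omega>" and ?RY = "\<lambda>\<omega>. \<lambda>i\<in>{k}. X i \<omega>"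
  define Xa where "Xa = {f \<in> space ?P. (\<forall>j\<in>{..<k}. (\<Sum>i<j. f i) \<le> x) \<and> x < (\<Sum>i<k. f i)}"
  define Xb where "Xb = {f \<in> space ?Q. 0 < f k}"
  have sum_meas: "(\<lambda>f. \<Sum>i<j. f i) \<in> borel_measurable ?P" if "j \<le> k" for j
    using that by (intro borel_measurable_sum measurable_component_singleton) auto
  have Xa: "Xa \<in> sets ?P"
    unfolding Xa_def
    by (intro sets.sets_Collect_conj sets.sets_Collect_finite_All borel_measurable_le borel_measurable_less sum_meas) auto
  have Xb: "Xb \<in> sets ?Q"
    unfolding Xb_def by (intro borel_measurable_less borel_measurable_const measurable_component_singleton) auto
  have "indep_var ?P ?RX ?Q ?RY"
    by (rule indep_var_restrict[OF ind]) auto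
  from indep_varD[OF this Xa Xb]
  have "prob ((\<lambda>\<omega>. (?RX \<omega>, ?RY \<omega>)) -` (Xa \<times> Xb) \<inter> space M) = prob (?RX -` Xa \<inter> space M) * prob (?RY -` Xb \<inter> space M)" .
  moreover have A: "?RX -` Xa \<inter> space M = passage h x k"
  proof -
    have "?RX \<omega> \<in> Xa \<longleftrightarrow> (\<forall>j<k. B (real j * h) \<omega> \<le> x) \<and> x < B (real k * h) \<omega>" if \<omega>: "\<omega> \<in> space M" for \<omega>
    proof -
      have "(\<Sum>i<j. ?RX \<omega> i) = B (real j * h) \<omega>" if "j \<le> k" for j
        using sum[OF that \<omega>] that by (auto intro!: sum.cong)
      then show ?thesis by (auto simp: Xa_def space_PiM)
    qed
    then show ?thesis by (auto simp: passage_def)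
  qed
  moreover have C: "?RY -` Xb \<inter> space M = {\<omega> \<in> space M. 0 < B t \<omega> - B (real k * h) \<omega>}"
    by (auto simp: Xb_def Xk space_PiM)
  moreover have "(\<lambda>\<omega>. (?RX \<omega>, ?RY \<omega>)) -` (Xa \<times> Xb) \<inter> space M = (?RX -` Xa \<inter> space M) \<inter> (?RY -` Xb \<inter> space M)"
    by auto
  ultimately have "prob (passage h x k \<inter> {\<omega> \<in> space M. 0 < B t \<omega> - B (real k * h) \<omega>})
     = prob (passage h x k) * prob {\<omega> \<in> space M. 0 < B t \<omega> - B (real k * h) \<omega>}"
    by (simp only:)
  then show ?thesis using prob_B_increment[of "real k * h" t 0] h t by (simp add: std_normal_cdf_0)
qed

lemma passage_disjoint: "disjoint_family_on (passage h x) K"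
  unfolding disjoint_family_on_def passage_def
proof (intro ballI impI)
  fix j k :: nat assume "j \<noteq> k"
  then show "{\<omega> \<in> space M. (\<forall>i<j. B (real i * h) \<omega> \<le> x) \<and> x < B (real j * h) \<omega>} \<inter>
    {\<omega> \<in> space M. (\<forall>i<k. B (real i * h) \<omega> \<le> x) \<and> x < B (real k * h) \<omega>} = {}"
    by (cases j k rule: linorder_cases) (auto simp: not_le[symmetric])
qed

lemma passage_union: "(\<Union>k\<le>m. passage h x k) = {\<omega> \<in> space M. \<exists>k\<le>m. x < B (real k * h) \<omega>}"
proof (intro equalityI subsetI)
  fix \<omega> assume "\<omega> \<in> {\<omega> \<in> space M. \<exists>k\<le>m. x < B (real k * h) \<omega>}"
  then obtain k where k: "\<omega> \<in> space M" "k \<le> m" "x < B (real k * h) \<omega>" by auto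
  define i where "i = (LEAST i. x < B (real i * h) \<omega>)"
  have "x < B (real i * h) \<omega>" unfolding i_def by (rule LeastI[of _ k]) (rule k)
  moreover have "i \<le> k" unfolding i_def by (rule Least_le) (rule k)
  moreover have "B (real j * h) \<omega> \<le> x" if "j < i" for j
    using not_less_Least[of j "\<lambda>i. x < B (real i * h) \<omega>"] that unfolding i_def by (simp add: not_less)
  ultimately have "\<omega> \<in> passage h x i" "i \<in> {..m}" using k by (auto simp: passage_def)
  then show "\<omega> \<in> (\<Union>k\<le>m. passage h x k)" by blast
qed (auto simp: passage_def)

lemma prob_passage_union:
  assumes "0 < h"
  shows "prob {\<omega> \<in> space M. \<exists>k\<le>m. x < B (real k * h) \<omega>} = (\<Sum>k\<le>m. prob (passage h x k))"
  unfolding passage_union[symmetric]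
  using finite_measure_finite_Union[of "{..m}" "passage h x", OF finite_atMost _ passage_disjoint] passage_event[OF assms]
  by blast

text \<open>At the first passage the path is already above \<open>x\<close>, and with probability at
  least 1/2 it is still above \<open>x\<close> at time \<open>t\<close>. If the passage occurs at
  the last index this is certain.\<close>

lemma grid_maximal_upper:
  assumes h: "0 < h" and t: "t = real m * h"
  shows "prob {\<omega> \<in> space M. \<exists>k\<le>m. x < B (real k * h) \<omega>} \<le> 2 * prob {\<omega> \<in> space M. x < B t \<omega>}"
proof -
  let ?C = "\<lambda>k. passage h x k \<inter> {\<omega> \<in> space M. x < B t \<omega>}"
  have [measurable]: "B t \<in> borel_measurable M" using h t by (intro B_measurable) auto
  have ev: "{\<omega> \<in> space M. x < B t \<omega>} \<in> events" by measurable
  have C: "?C k \<in> events" for k using passage_event[OF h] ev by auto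
  have "prob (passage h x k) / 2 \<le> prob (?C k)" if "k \<le> m" for k
  proof (cases "k = m")
    case True
    then have "?C k = passage h x k" by (auto simp: passage_def t)
    then show ?thesis by simp
  next
    case False
    then have "real k * h < t" using that h t by simp
    from passage_independent[OF h this, of x]
    have "prob (passage h x k) / 2 = prob (passage h x k \<inter> {\<omega> \<in> space M. 0 < B t \<omega> - B (real k * h) \<omega>})" by simp
    also have "\<dots> \<le> prob (?C k)"
    proof (rule finite_measure_mono[OF _ C])
      show "passage h x k \<inter> {\<omega> \<in> space M. 0 < B t \<omega> - B (real k * h) \<omega>} \<subseteq> ?C k"
        unfolding passage_def by auto
    qed
    finally show ?thesis .
  qed
  then have "(\<Sum>k\<le>m. prob (passage h x k) / 2) \<le> (\<Sum>k\<le>m. prob (?C k))"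
    by (intro sum_mono) auto
  also have "\<dots> = prob (\<Union>k\<le>m. ?C k)"
  proof (rule finite_measure_finite_Union[symmetric])
    show "?C ` {..m} \<subseteq> events" using C by blast
    show "disjoint_family_on ?C {..m}"
      using passage_disjoint[of h x "{..m}"] unfolding disjoint_family_on_def by blast
  qed simp
  also have "\<dots> \<le> prob {\<omega> \<in> space M. x < B t \<omega>}"
    using ev by (intro finite_measure_mono) auto
  finally show ?thesis unfolding prob_passage_union[OF h] by (simp add: sum_divide_distrib[symmetric])
qed

text \<open>A path ending above \<open>x + \<epsilon>\<close> has passed \<open>x\<close> at some
  grid index. Unless some grid step exceeds \<epsilon>, it is at most \<open>x + \<epsilon>\<close>
  at that index, so the increment after the passage is positive and the factor 1/2 is
  gained.\<close>

lemma grid_maximal_lower: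
  assumes h: "0 < h" and t: "t = real m * h" and "0 \<le> x" "0 < \<epsilon>"
  shows "prob {\<omega> \<in> space M. x + \<epsilon> < B t \<omega>} \<le> prob {\<omega> \<in> space M. \<exists>k\<le>m. x < B (real k * h) \<omega>} / 2
    + prob {\<omega> \<in> space M. \<exists>k<m. \<epsilon> < B (real (Suc k) * h) \<omega> - B (real k * h) \<omega>}"
proof -
  let ?J = "{\<omega> \<in> space M. \<exists>k<m. \<epsilon> < B (real (Suc k) * h) \<omega> - B (real k * h) \<omega>}"
  let ?C = "\<lambda>k. passage h x k \<inter> {\<omega> \<in> space M. 0 < B t \<omega> - B (real k * h) \<omega>}"
  have [measurable]: "B t \<in> borel_measurable M" using h t by (intro B_measurable) auto
  have [measurable]: "B (real k * h) \<in> borel_measurable M" for k :: nat using h by (intro B_measurable) auto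
  have J: "?J \<in> events" by measurable
  have C: "?C k \<in> events" for k
  proof (rule sets.Int[OF passage_event[OF h]])
    show "{\<omega> \<in> space M. 0 < B t \<omega> - B (real k * h) \<omega>} \<in> events" by measurable
  qed
  have "{\<omega> \<in> space M. x + \<epsilon> < B t \<omega>} \<subseteq> (\<Union>k<m. ?C k) \<union> ?J"
  proof
    fix \<omega> assume "\<omega> \<in> {\<omega> \<in> space M. x + \<epsilon> < B t \<omega>}"
    then have \<omega>: "\<omega> \<in> space M" "x + \<epsilon> < B (real m * h) \<omega>" by (auto simp: t)
    then have "\<omega> \<in> (\<Union>k\<le>m. passage h x k)"
      unfolding passage_union using \<open>0 < \<epsilon>\<close> by (auto intro!: exI[of _ m])
    then obtain k where k: "k \<le> m" "\<omega> \<in> passage h x k" by auto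
    \<comment> \<open>The passage has a predecessor on the grid because the path starts at 0, which
      does not exceed \<open>x\<close>; this bounds the overshoot by one grid step.\<close>
    have "k \<noteq> 0"
    proof
      assume "k = 0"
      then have "x < B 0 \<omega>" using k(2) by (simp add: passage_def)
      then show False using B_start[OF \<omega>(1)] \<open>0 \<le> x\<close> by simp
    qed
    then obtain j where j: "k = Suc j" by (cases k) auto
    have le: "B (real j * h) \<omega> \<le> x" using k(2) by (auto simp: passage_def j)
    show "\<omega> \<in> (\<Union>k<m. ?C k) \<union> ?J"
    proof (cases "\<epsilon> < B (real (Suc j) * h) \<omega> - B (real j * h) \<omega>")
      case True
      then have "\<omega> \<in> ?J" using \<omega> k(1) j by (auto intro!: exI[of _ j] simp del: of_nat_Suc)
      then show ?thesis by blast
    next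
      case False
      then have *: "B (real k * h) \<omega> \<le> x + \<epsilon>" using le unfolding j by linarith
      then have "k \<noteq> m" using \<omega> by auto
      moreover have "0 < B t \<omega> - B (real k * h) \<omega>" using * \<omega> by (simp add: t)
      ultimately show ?thesis using k \<omega> by auto
    qed
  qed
  moreover have UC: "(\<Union>k<m. ?C k) \<in> events"
    by (rule sets.finite_UN) (simp_all only: finite_lessThan C)
  ultimately have "prob {\<omega> \<in> space M. x + \<epsilon> < B t \<omega>} \<le> prob ((\<Union>k<m. ?C k) \<union> ?J)"
    using J by (intro finite_measure_mono sets.Un)
  also have "\<dots> \<le> prob (\<Union>k<m. ?C k) + prob ?J"
    by (rule measure_Un_le[OF UC J])
  also have "prob (\<Union>k<m. ?C k) \<le> (\<Sum>k<m. prob (?C k))"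
    using C by (intro finite_measure_subadditive_finite) blast+
  also have "(\<Sum>k<m. prob (?C k)) = (\<Sum>k<m. prob (passage h x k) / 2)"
    using h t by (intro sum.cong refl passage_independent) auto
  also have "\<dots> \<le> (\<Sum>k\<le>m. prob (passage h x k) / 2)"
    by (intro sum_mono2) auto
  also have "\<dots> = prob {\<omega> \<in> space M. \<exists>k\<le>m. x < B (real k * h) \<omega>} / 2"
    unfolding prob_passage_union[OF h] by (simp add: sum_divide_distrib)
  finally show ?thesis by simp
qed

lemma prob_large_grid_increment:
  assumes t: "0 < t" and "0 < \<epsilon>"
  defines "h \<equiv> \<lambda>m. t / real (Suc m)"
  shows "(\<lambda>m. prob {\<omega> \<in> space M. \<exists>k<Suc m. \<epsilon> < B (real (Suc k) * h m) \<omega> - B (real k * h m) \<omega>}) \<longlonglongrightarrow> 0"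
proof (rule prob_indicator_tendsto_0)
  have h: "0 < h m" "real (Suc m) * h m = t" for m using t by (simp_all add: h_def del: of_nat_Suc)
  have [measurable]: "B (real k * h m) \<in> borel_measurable M" for k m :: nat
    using h(1)[of m] by (intro B_measurable) auto
  show "{\<omega> \<in> space M. \<exists>k<Suc m. \<epsilon> < B (real (Suc k) * h m) \<omega> - B (real k * h m) \<omega>} \<in> events" for m
    by measurable
  fix \<omega> assume \<omega>: "\<omega> \<in> space M"
  have "uniformly_continuous_on {0..t} (\<lambda>s. B s \<omega>)"
    using continuous_on_subset[OF B_continuous[OF \<omega>]] by (intro compact_uniformly_continuous) auto
  then obtain d where d: "0 < d" "\<And>s u. s \<in> {0..t} \<Longrightarrow> u \<in> {0..t} \<Longrightarrow> dist u s < d \<Longrightarrow> dist (B u \<omega>) (B s \<omega>) < \<epsilon>"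
    unfolding uniformly_continuous_on_def using \<open>0 < \<epsilon>\<close> by blast
  have "(\<lambda>m. t * inverse (real (Suc m))) \<longlonglongrightarrow> t * 0"
    by (intro tendsto_mult tendsto_const LIMSEQ_inverse_real_of_nat)
  then have "eventually (\<lambda>m. h m < d) sequentially"
    using d(1) unfolding h_def divide_inverse by (intro order_tendstoD(2)) auto
  then show "eventually (\<lambda>m. \<omega> \<notin> {\<omega> \<in> space M. \<exists>k<Suc m. \<epsilon> < B (real (Suc k) * h m) \<omega> - B (real k * h m) \<omega>}) sequentially"
  proof eventually_elim
    case (elim m)
    have "B (real (Suc k) * h m) \<omega> - B (real k * h m) \<omega> \<le> \<epsilon>" if "k < Suc m" for k
    proof -
      have "real k * h m \<le> real (Suc m) * h m" "real (Suc k) * h m \<le> real (Suc m) * h m"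
        using that h(1)[of m] by (auto intro!: mult_right_mono)
      then have "real k * h m \<in> {0..t}" "real (Suc k) * h m \<in> {0..t}"
        using h(1)[of m] unfolding h(2) by auto
      moreover have "dist (real (Suc k) * h m) (real k * h m) < d"
        using elim h(1)[of m] by (simp add: dist_real_def algebra_simps)
      ultimately have "dist (B (real (Suc k) * h m) \<omega>) (B (real k * h m) \<omega>) < \<epsilon>" by (intro d)
      then show ?thesis unfolding dist_real_def by linarith
    qed
    then show ?case by (auto simp: not_less[symmetric])
  qed
qed

text \<open>The upper bound holds for every mesh. For the lower one \<epsilon> is fixed first, the
  mesh tends to 0 so that large grid steps become improbable, and \<epsilon> is absorbed by
  continuity of the normal distribution function.\<close>

lemma prob_grid_exceeds_limit:
  assumes t: "0 < t" and x: "0 \<le> x"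
  defines "h \<equiv> \<lambda>m. t / real (Suc m)"
  shows "(\<lambda>m. prob {\<omega> \<in> space M. \<exists>k\<le>Suc m. x < B (real k * h m) \<omega>})
    \<longlonglongrightarrow> 2 * cdf std_normal_distribution (- x / sqrt t)"
proof (rule order_tendstoI)
  let ?a = "\<lambda>m. prob {\<omega> \<in> space M. \<exists>k\<le>Suc m. x < B (real k * h m) \<omega>}"
  let ?T = "\<lambda>x. cdf std_normal_distribution (- x / sqrt t)"
  let ?j = "\<lambda>\<epsilon> m. prob {\<omega> \<in> space M. \<exists>k<Suc m. \<epsilon> < B (real (Suc k) * h m) \<omega> - B (real k * h m) \<omega>}"
  have h: "0 < h m" "t = real (Suc m) * h m" for m using t by (simp_all add: h_def del: of_nat_Suc)
  {
    fix c assume "2 * ?T x < c"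
    have "?a m \<le> 2 * ?T x" for m
      using grid_maximal_upper[OF h(1)[of m] h(2)[of m], of x] prob_B[OF t, of x] by simp
    then show "eventually (\<lambda>m. ?a m < c) sequentially"
      using \<open>2 * ?T x < c\<close> by (intro always_eventually) (auto intro: le_less_trans)
  next
    fix c assume c: "c < 2 * ?T x"
    have "isCont (\<lambda>\<epsilon>. 2 * ?T (x + \<epsilon>)) 0"
      using t by (intro continuous_intros isCont_o2[OF _ std_normal_isCont_cdf]) auto
    then have "((\<lambda>\<epsilon>. 2 * ?T (x + \<epsilon>)) \<longlongrightarrow> 2 * ?T x) (at_right 0)"
      by (auto simp: isCont_def filterlim_at_split)
    from order_tendstoD(1)[OF this c] have "eventually (\<lambda>\<epsilon>. c < 2 * ?T (x + \<epsilon>)) (at_right 0)" .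
    moreover have "eventually (\<lambda>\<epsilon>::real. 0 < \<epsilon>) (at_right 0)" by (rule eventually_at_right_less)
    ultimately obtain \<epsilon> where \<epsilon>: "0 < \<epsilon>" "c < 2 * ?T (x + \<epsilon>)"
      using eventually_happens'[OF _ eventually_conj] by (metis (mono_tags, lifting) trivial_limit_at_right_real)
    have "(\<lambda>m. 2 * (?T (x + \<epsilon>) - ?j \<epsilon> m)) \<longlonglongrightarrow> 2 * (?T (x + \<epsilon>) - 0)"
      unfolding h_def by (intro tendsto_intros prob_large_grid_increment t \<epsilon>)
    then have "eventually (\<lambda>m. c < 2 * (?T (x + \<epsilon>) - ?j \<epsilon> m)) sequentially"
      using \<epsilon>(2) by (intro order_tendstoD(1)) auto
    then show "eventually (\<lambda>m. c < ?a m) sequentially"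
    proof eventually_elim
      case (elim m)
      then show ?case
        using grid_maximal_lower[OF h(1)[of m] h(2)[of m] x \<epsilon>(1)] prob_B[OF t, of "x + \<epsilon>"] by argo
    qed
  }
qed

definition grid_max_B :: "real \<Rightarrow> nat \<Rightarrow> 'a \<Rightarrow> real" where
  "grid_max_B t m \<omega> = Max ((\<lambda>k. B (real k * (t / real (Suc m))) \<omega>) ` {..Suc m})"

lemma grid_max_B_measurable:
  assumes "0 < t" shows "grid_max_B t m \<in> borel_measurable M"
proof -
  have [measurable]: "B (real k * (t / real (Suc m))) \<in> borel_measurable M" for k
    using assms by (intro B_measurable) auto
  show ?thesis unfolding grid_max_B_def by measurable
qed

lemma grid_max_B_limit:
  assumes "0 < t" "\<omega> \<in> space M"
  shows "(\<lambda>m. grid_max_B t m \<omega>) \<longlonglongrightarrow> running_max B t \<omega>"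
  unfolding grid_max_B_def running_max_def
  using assms by (intro continuous_max_grid_limit continuous_on_subset[OF B_continuous]) auto

lemma running_max_B_measurable:
  assumes "0 < t" shows "running_max B t \<in> borel_measurable M"
  using grid_max_B_limit[OF assms] grid_max_B_measurable[OF assms]
  by (rule borel_measurable_LIMSEQ_real)

lemma running_max_B_nonneg:
  assumes "0 < t" "\<omega> \<in> space M"
  shows "0 \<le> running_max B t \<omega>"
proof (rule LIMSEQ_le_const[OF grid_max_B_limit[OF assms]])
  have "0 \<le> grid_max_B t m \<omega>" for m
    unfolding grid_max_B_def using B_start[OF assms(2)] by (intro Max_ge) (auto intro!: image_eqI[of _ _ 0])
  then show "\<exists>m0. \<forall>m\<ge>m0. 0 \<le> grid_max_B t m \<omega>" by blast
qed

text \<open>The conjunct \<open>True\<close> instantiates the side condition \<open>E\<close> of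
  \<open>prob_le_eq_limit\<close>, which for the telegraph process is the initial direction.\<close>

lemma prob_running_max_B:
  assumes t: "0 < t" and x: "0 < x"
  shows "prob {\<omega> \<in> space M. True \<and> running_max B t \<omega> \<le> x} = 1 - 2 * cdf std_normal_distribution (- x / sqrt t)"
proof (rule prob_le_eq_limit[where l=0, OF running_max_B_measurable[OF t] grid_max_B_measurable[OF t] _ grid_max_B_limit[OF t] _ x])
  show "isCont (\<lambda>x. 1 - 2 * cdf std_normal_distribution (- x / sqrt t)) x"
    using t by (intro continuous_intros isCont_o2[OF _ std_normal_isCont_cdf]) auto
  fix z :: real assume z: "0 < z"
  let ?A = "\<lambda>m. {\<omega> \<in> space M. \<exists>k\<le>Suc m. z < B (real k * (t / real (Suc m))) \<omega>}"
  have "prob {\<omega> \<in> space M. True \<and> grid_max_B t m \<omega> \<le> z} = 1 - prob (?A m)" for m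
  proof -
    have [measurable]: "B (real k * (t / real (Suc m))) \<in> borel_measurable M" for k
      using t by (intro B_measurable) auto
    have "?A m \<in> events" by measurable
    moreover have "{\<omega> \<in> space M. True \<and> grid_max_B t m \<omega> \<le> z} = space M - ?A m"
      by (auto simp: grid_max_B_def Ball_def not_less simp del: of_nat_Suc)
    ultimately show ?thesis by (simp only: prob_compl)
  qed
  then show "(\<lambda>m. prob {\<omega> \<in> space M. True \<and> grid_max_B t m \<omega> \<le> z}) \<longlonglongrightarrow> 1 - 2 * cdf std_normal_distribution (- z / sqrt t)"
    using z by (simp only:) (intro tendsto_diff tendsto_const prob_grid_exceeds_limit[OF t], simp)
qed simp

lemma cdf_running_max_B_neg:
  assumes "0 < t" "x < 0"
  shows "cdf (distr M borel (running_max B t)) x = 0"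
proof -
  have "running_max B t -` {..x} \<inter> space M = {}"
    using running_max_B_nonneg[OF assms(1)] assms(2) by force
  then show ?thesis
    unfolding cdf_def2 using running_max_B_measurable[OF assms(1)] by (subst measure_distr) auto
qed

lemma cdf_running_max_B:
  assumes t: "0 < t" and x: "0 \<le> x"
  shows "cdf (distr M borel (running_max B t)) x = 1 - 2 * cdf std_normal_distribution (- x / sqrt t)"
    (is "?L x = ?R x")
proof -
  interpret D: real_distribution "distr M borel (running_max B t)"
    using running_max_B_measurable[OF t] by simp
  have pos: "?L y = ?R y" if "0 < y" for y
  proof -
    have "?L y = prob (running_max B t -` {..y} \<inter> space M)"
      unfolding cdf_def2 using running_max_B_measurable[OF t] by (subst measure_distr) auto
    also have "running_max B t -` {..y} \<inter> space M = {\<omega> \<in> space M. True \<and> running_max B t \<omega> \<le> y}" by auto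
    finally show ?thesis using prob_running_max_B[OF t that] by simp
  qed
  show ?thesis
  proof (cases "x = 0")
    case True
    have "(?L \<longlongrightarrow> ?L 0) (at_right 0)"
      using D.cdf_is_right_cont[of 0] by (simp add: continuous_within)
    moreover have "eventually (\<lambda>y. ?L y = ?R y) (at_right 0)"
      unfolding eventually_at_right_field using pos by (intro exI[of _ 1]) auto
    ultimately have "(?R \<longlongrightarrow> ?L 0) (at_right 0)"
      by (rule Lim_transform_eventually)
    moreover have "isCont ?R 0"
      using t by (intro continuous_intros isCont_o2[OF _ std_normal_isCont_cdf]) auto
    then have "(?R \<longlongrightarrow> ?R 0) (at_right 0)"
      by (auto simp: isCont_def filterlim_at_split)
    ultimately have "?L 0 = ?R 0"
      by (intro tendsto_unique[of "at_right 0"]) auto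
    then show ?thesis using True by simp
  qed (use x pos in auto)
qed

end

section \<open>The Kac limit\<close>

text \<open>The velocity \<open>V\<close> takes its two values only almost surely; their events are
  disjoint with total probability 1, which is enough to split the law.\<close>

lemma (in telegraph) cdf_max_T:
  assumes t: "0 < t"
  shows "cdf (distr M borel (max_T t)) x = (cdf (max_law True t) x + cdf (max_law False t) x) / 2"
proof -
  define E where "E p = {\<omega> \<in> space M. V \<omega> = vel p * c}" for p
  define A where "A = {\<omega> \<in> space M. max_T t \<omega> \<le> x}"
  have E: "E p \<in> events" "prob (E p) = 1 / 2" for p
    using velocity_event(1) prob_V unfolding E_def by auto
  have A: "A \<in> events"
    unfolding A_def using max_T_measurable[OF t] by measurable
  have disj: "E True \<inter> E False = {}"
    using speed_pos by (auto simp: E_def vel_def)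
  have part: "prob (A \<inter> E p) = cdf (max_law p t) x / 2" for p
  proof -
    have "A \<inter> E p = {\<omega> \<in> space M. V \<omega> = vel p * c \<and> max_T t \<omega> \<in> {..x}}"
      by (auto simp: A_def E_def)
    then show ?thesis unfolding cdf_def2 using measure_max_law[OF t, of "{..x}" p] by simp
  qed
  have "prob (E True \<union> E False) = 1"
    using finite_measure_Union[OF E(1) E(1) disj] E(2) by simp
  then have "prob A = prob (A \<inter> (E True \<union> E False))"
    using A E(1) by (intro measure_space_inter[symmetric]) (auto simp: prob_space)
  also have "\<dots> = prob ((A \<inter> E True) \<union> (A \<inter> E False))"
    by (simp only: Int_Un_distrib)
  also have "\<dots> = prob (A \<inter> E True) + prob (A \<inter> E False)"
    using A E(1) disj by (intro finite_measure_Union) auto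
  finally have "prob A = (cdf (max_law True t) x + cdf (max_law False t) x) / 2"
    unfolding part by simp
  moreover have "cdf (distr M borel (max_T t)) x = prob A"
    unfolding cdf_def2 A_def using max_T_measurable[OF t]
    by (subst measure_distr) (auto simp: vimage_def Int_def conj_commute)
  ultimately show ?thesis by simp
qed

text \<open>The scale is sqrt(rate): the two means have sum \<open>rate * t\<close> and difference
  \<open>rate * x / c\<close>, which after scaling become \<open>t\<close> and
  \<open>sqrt (rate / c\<^sup>2) * x\<close>, the latter tending to \<open>x\<close>. A fixed
  \<open>x\<close> is below \<open>c * t\<close> eventually because \<open>c\<close> tends to
  infinity.\<close>

lemma cdf_max_law_kac_limit:
  fixes M :: "nat \<Rightarrow> 'a measure"
  assumes t: "0 < t"
    and T: "\<And>n. telegraph (M n) (c n) (rate n) (V n) (N n)"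
    and rate: "filterlim rate at_top sequentially" and c: "filterlim c at_top sequentially"
    and ratio: "(\<lambda>n. rate n / (c n)\<^sup>2) \<longlonglongrightarrow> 1"
  shows "(\<lambda>n. cdf (cond_law (M n) (\<lambda>\<omega>. V n \<omega> = vel p * c n) (running_max (telegraph_process (V n) (N n)) t)) x)
    \<longlonglongrightarrow> (if x < 0 then 0 else 1 - 2 * cdf std_normal_distribution (- x / sqrt t))"
proof (cases "x < 0")
  case True
  then show ?thesis by (simp add: telegraph.cdf_max_law_neg[OF T t])
next
  case False
  then have x: "0 \<le> x" by simp
  have pos: "0 < c n" "0 < rate n" for n
    using telegraph.speed_pos[OF T] poisson_process.rate_pos[OF telegraph.axioms(1)[OF T]] by auto
  let ?a = "\<lambda>n. rate n * t / 2 + rate n / (2 * c n) * x" and ?b = "\<lambda>n. rate n * t / 2 - rate n / (2 * c n) * x"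
  have ev: "eventually (\<lambda>n. x < c n * t) sequentially"
  proof -
    have "eventually (\<lambda>n. x / t < c n) sequentially"
      using filterlim_at_top_dense[THEN iffD1, OF c] by blast
    then show ?thesis using t by (simp add: field_simps)
  qed
  have "(\<lambda>n. skellam_expectation (level_sign p) (?a n) (?b n)) \<longlonglongrightarrow> 1 - 2 * cdf std_normal_distribution (- x / sqrt t)"
  proof (rule skellam_expectation_limit[OF _ _ _ _ _ t])
    show "filterlim (\<lambda>n. sqrt (rate n)) at_top sequentially"
      by (rule filterlim_compose[OF sqrt_at_top rate])
    have "0 < ?a n" for n
      using pos[of n] x t by (intro add_pos_nonneg) auto
    then show "eventually (\<lambda>n. 0 < ?a n) sequentially" by (simp add: always_eventually)
    show "eventually (\<lambda>n. 0 < ?b n) sequentially"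
      using ev
    proof eventually_elim
      case (elim n)
      have "?b n = rate n / (2 * c n) * (c n * t - x)" using pos[of n] by (simp add: field_simps)
      then show ?case using elim pos[of n] by simp
    qed
    have "(?a n + ?b n) / (sqrt (rate n))\<^sup>2 = t" for n using pos[of n] by simp
    then show "(\<lambda>n. (?a n + ?b n) / (sqrt (rate n))\<^sup>2) \<longlonglongrightarrow> t" by simp
    have eq: "(?a n - ?b n) / sqrt (rate n) = sqrt (rate n / (c n)\<^sup>2) * x" for n
    proof -
      have "?a n - ?b n = sqrt (rate n) * (sqrt (rate n) / c n * x)" using pos[of n] by simp
      also have "\<dots> / sqrt (rate n) = sqrt (rate n) / c n * x" using pos[of n] by simp
      finally show ?thesis using pos[of n] by (simp add: real_sqrt_divide)
    qed
    have "(\<lambda>n. sqrt (rate n / (c n)\<^sup>2) * x) \<longlonglongrightarrow> sqrt 1 * x"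
      by (intro tendsto_mult tendsto_const tendsto_real_sqrt ratio)
    then show "(\<lambda>n. (?a n - ?b n) / sqrt (rate n)) \<longlonglongrightarrow> x" unfolding eq by simp
  qed
  moreover have "eventually (\<lambda>n. skellam_expectation (level_sign p) (?a n) (?b n)
      = cdf (cond_law (M n) (\<lambda>\<omega>. V n \<omega> = vel p * c n) (running_max (telegraph_process (V n) (N n)) t)) x) sequentially"
    using ev
  proof eventually_elim
    case (elim n)
    show ?case by (rule telegraph.cdf_max_law[OF T[of n] t x elim, symmetric])
  qed
  ultimately show ?thesis using False by (simp add: Lim_transform_eventually)
qed

text \<open>Both conditional distribution functions converge at every point to that of the Brownian
  maximum, hence so does their mean, the unconditional one.\<close>

theorem max_telegraph_kac_limit:
  fixes M :: "nat \<Rightarrow> 'a measure" and W :: "'b measure"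
  assumes t: "0 < t"
    and T: "\<And>n. telegraph (M n) (c n) (rate n) (V n) (N n)"
    and lims: "filterlim rate at_top sequentially" "filterlim c at_top sequentially"
      "(\<lambda>n. rate n / (c n)\<^sup>2) \<longlonglongrightarrow> 1"
    and B: "brownian_motion W B"
  shows "weak_conv_m
      (\<lambda>n. cond_law (M n) (\<lambda>\<omega>. V n \<omega> = - c n) (running_max (telegraph_process (V n) (N n)) t))
      (distr W borel (running_max B t))"
    and "weak_conv_m
      (\<lambda>n. distr (M n) borel (running_max (telegraph_process (V n) (N n)) t))
      (distr W borel (running_max B t))"
proof -
  have BM: "cdf (distr W borel (running_max B t)) x = (if x < 0 then 0 else 1 - 2 * cdf std_normal_distribution (- x / sqrt t))" for x
    using brownian_motion.cdf_running_max_B[OF B t, of x] brownian_motion.cdf_running_max_B_neg[OF B t, of x] by simp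
  note lim = cdf_max_law_kac_limit[OF t T lims, folded BM]
  show "weak_conv_m
      (\<lambda>n. cond_law (M n) (\<lambda>\<omega>. V n \<omega> = - c n) (running_max (telegraph_process (V n) (N n)) t))
      (distr W borel (running_max B t))"
    using lim[of False] by (simp add: weak_conv_m_def weak_conv_def vel_def)
  have "(\<lambda>n. cdf (distr (M n) borel (running_max (telegraph_process (V n) (N n)) t)) x)
      \<longlonglongrightarrow> cdf (distr W borel (running_max B t)) x" for x
  proof -
    let ?F = "\<lambda>p n. cdf (cond_law (M n) (\<lambda>\<omega>. V n \<omega> = vel p * c n) (running_max (telegraph_process (V n) (N n)) t)) x"
    have "(\<lambda>n. (?F True n + ?F False n) / 2) \<longlonglongrightarrow>
       (cdf (distr W borel (running_max B t)) x + cdf (distr W borel (running_max B t)) x) / 2"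
      by (intro tendsto_intros lim) simp
    then show ?thesis by (simp add: telegraph.cdf_max_T[OF T t])
  qed
  then show "weak_conv_m
      (\<lambda>n. distr (M n) borel (running_max (telegraph_process (V n) (N n)) t))
      (distr W borel (running_max B t))"
    by (simp add: weak_conv_m_def weak_conv_def)
qed

theorem mainTheorem11:
  fixes t :: real
  assumes "0 < t"
  shows
    "(\<forall>(M :: 'a measure) c rate V N. telegraph M c rate V N \<longrightarrow>
        set_integrable lborel {0<..<c * t} (max_density c rate t) \<and>
        (\<forall>A \<in> sets borel. A \<subseteq> {0<..<c * t} \<longrightarrow>
           \<P>(\<omega> in M. running_max (telegraph_process V N) t \<omega> \<in> A \<bar> V \<omega> = - c) =
           (LBINT \<beta>:A. max_density c rate t \<beta>)) \<and>
        \<P>(\<omega> in M. running_max (telegraph_process V N) t \<omega> = 0 \<bar> V \<omega> = - c) =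
          exp (- rate * t) * (bessel_I 0 (rate * t) + bessel_I 1 (rate * t))) \<and>
     (\<forall>(M :: nat \<Rightarrow> 'a measure) c rate V N (W :: 'b measure) B.
        (\<forall>n. telegraph (M n) (c n) (rate n) (V n) (N n)) \<and>
        filterlim rate at_top sequentially \<and>
        filterlim c at_top sequentially \<and>
        (\<lambda>n. rate n / (c n)\<^sup>2) \<longlonglongrightarrow> 1 \<and>
        brownian_motion W B \<longrightarrow>
        weak_conv_m
          (\<lambda>n. cond_law (M n) (\<lambda>\<omega>. V n \<omega> = - c n) (running_max (telegraph_process (V n) (N n)) t))
          (distr W borel (running_max B t)) \<and>
        weak_conv_m
          (\<lambda>n. distr (M n) borel (running_max (telegraph_process (V n) (N n)) t))
          (distr W borel (running_max B t)))"
proof (intro conjI allI impI ballI)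
  fix M :: "'a measure" and c rate V N A
  assume T: "telegraph M c rate V N"
  show "set_integrable lborel {0<..<c * t} (max_density c rate t)"
    by (rule telegraph.max_T_density(1)[OF T assms])
  show "\<P>(\<omega> in M. running_max (telegraph_process V N) t \<omega> = 0 \<bar> V \<omega> = - c) =
      exp (- rate * t) * (bessel_I 0 (rate * t) + bessel_I 1 (rate * t))"
    by (rule telegraph.max_T_atom[OF T assms])
  assume "A \<in> sets borel" "A \<subseteq> {0<..<c * t}"
  then show "\<P>(\<omega> in M. running_max (telegraph_process V N) t \<omega> \<in> A \<bar> V \<omega> = - c) =
      (LBINT \<beta>:A. max_density c rate t \<beta>)"
    by (rule telegraph.max_T_density(2)[OF T assms])
next
  fix M :: "nat \<Rightarrow> 'a measure" and c rate V N and W :: "'b measure" and B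
  assume *: "(\<forall>n. telegraph (M n) (c n) (rate n) (V n) (N n)) \<and>
        filterlim rate at_top sequentially \<and>
        filterlim c at_top sequentially \<and>
        (\<lambda>n. rate n / (c n)\<^sup>2) \<longlonglongrightarrow> 1 \<and>
        brownian_motion W B"
  then have T: "telegraph (M n) (c n) (rate n) (V n) (N n)" for n by blast
  from * have lims: "filterlim rate at_top sequentially" "filterlim c at_top sequentially"
    "(\<lambda>n. rate n / (c n)\<^sup>2) \<longlonglongrightarrow> 1" "brownian_motion W B" by blast+
  show "weak_conv_m
          (\<lambda>n. cond_law (M n) (\<lambda>\<omega>. V n \<omega> = - c n) (running_max (telegraph_process (V n) (N n)) t))
          (distr W borel (running_max B t))"
    by (rule max_telegraph_kac_limit(1)[OF assms T lims])
  show "weak_conv_m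
          (\<lambda>n. distr (M n) borel (running_max (telegraph_process (V n) (N n)) t))
          (distr W borel (running_max B t))"
    by (rule max_telegraph_kac_limit(2)[OF assms T lims])
qed

end
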